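(* Let $f:\mathbb{R}\to\mathbb{R}$ belong to the Zygmund class $\Lambda_*$. Then the set of points $x\in\mathbb{R}$ such that $$\iint_{|t|+|s|<1}\Big|\frac{f(x+s)-f(x)}{s}-\frac{f(x+t)-f(x)}{t}\Big|^2\frac{ds\,dt}{|s-t|^2}<\infty$$ coincides, except possibly for a set of Lebesgue measure zero, with the set of points where $f$ is differentiable.
   Context: A bounded function $f:\mathbb{R}\to\mathbb{R}$ is in the Zygmund class $\Lambda_*$ if there exists a constant $c=c(f)>0$ such that $|f(x+h)+f(x-h)-2f(x)|\le c|h|$ for all $x,h\in\mathbb{R}$. *)

theory Defs
  imports "HOL-Analysis.Analysis"
begin

definition zygmund_class :: "(real \<Rightarrow> real) set" where
  "zygmund_class = {f. bounded (range f) \<and>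
     (\<exists>c>0. \<forall>x h. \<bar>f (x + h) + f (x - h) - 2 * f x\<bar> \<le> c * \<bar>h\<bar>)}"

definition diff_quot :: "(real \<Rightarrow> real) \<Rightarrow> real \<Rightarrow> real \<Rightarrow> real" where
  "diff_quot f x h = (f (x + h) - f x) / h"

text \<open>The double integral is a Lebesgue integral of a nonnegative function, with values in
  \<open>[0, \<infinity>]\<close>. The integrand is undefined only on the lines \<open>s = 0\<close>, \<open>t = 0\<close> and \<open>s = t\<close>, which
  are null sets in the plane, so the convention \<open>a / 0 = 0\<close> does not affect its value.\<close>

definition quotient_energy :: "(real \<Rightarrow> real) \<Rightarrow> real \<Rightarrow> ennreal" where
  "quotient_energy f x =
     (\<integral>\<^sup>+ (s, t) \<in> {(s, t). \<bar>t\<bar> + \<bar>s\<bar> < 1}.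
        ennreal (\<bar>diff_quot f x s - diff_quot f x t\<bar>\<^sup>2 / \<bar>s - t\<bar>\<^sup>2) \<partial>lborel)"

end

theory Submission
  imports Defs
begin

text \<open>Since \<open>(q\<^sub>x s - q\<^sub>x t) / (s - t)\<close> is the second divided difference of \<open>f\<close> at \<open>x\<close>,
  \<open>x + s\<close>, \<open>x + t\<close>, where \<open>q\<^sub>x\<close> is the difference quotient, the energy is the integral of a square
  that is symmetric in three points.

  If \<open>f\<close> is differentiable at \<open>x\<close>, then \<open>x\<close> lies in one of countably many bounded closed sets \<open>K\<close> on
  which \<open>\<bar>f y - f x\<bar> \<le> M * \<bar>y - x\<bar>\<close> for all \<open>y\<close>. Write \<open>f = F + g\<close> with \<open>F\<close> a compactly supported
  Lipschitz extension of the restriction of \<open>f\<close> to \<open>K\<close>. For \<open>F\<close>, put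
  \<open>\<nu> r = \<integral> ((F (x + r) - F x) / r)\<^sup>2 dx\<close>; by the parallelogram law the energy over triples of diameter \<open>r\<close>
  and ratio \<open>l\<close> is \<open>l * \<nu> (l * r) + (1 - l) * \<nu> ((1 - l) * r) - \<nu> r\<close> up to explicit weights, and
  integration against \<open>dr / r\<close> telescopes. For \<open>g\<close>, which is bounded by the distance to \<open>K\<close>, the energy
  over \<open>K\<close> is controlled by a Marcinkiewicz integral.

  Conversely, if the energy at \<open>x\<close> is finite, then for almost every shift of the dyadic grid the slopes
  of \<open>f\<close> over the dyadic intervals that contain \<open>x\<close> form a martingale with finite square function at
  \<open>x\<close>, so they converge almost everywhere; the Hoelder regularity of \<open>f\<close> and the vanishing of the
  energy at small scales transfer the convergence to all difference quotients.\<close>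

section \<open>Sign transforms of dyadic functions\<close>

text \<open>The Zygmund condition enters mainly through Hoelder continuity with exponent 3/4. Any
  exponent strictly between 1/2 and 1 would serve: squared difference quotients across a small gap
  \<open>v\<close> are then integrable in \<open>v\<close>, here of size
  \<open>v powr (-1/2)\<close>. For a Lipschitz function \<open>F\<close> absolute values are too
  crude. The function \<open>\<nu>\<close> is merely bounded and \<open>dr / r\<close> diverges
  logarithmically at 0, so the cancellation between scales has to be used before integrating. In the
  converse direction the energy is an average over positions, while a martingale difference of a
  fixed grid samples \<open>f\<close> at three prescribed points. Averaging over the position of the
  given point inside its dyadic interval bridges this gap. The price is an exchange of quantifiers
  by Fubini: convergence is known for each shift at almost every position, and it is wanted at
  almost every point for almost every shift.\<close>

definition dyadic_adapted :: "nat \<Rightarrow> (real \<Rightarrow> 'a) \<Rightarrow> bool" where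
  "dyadic_adapted n h \<longleftrightarrow> (\<forall>x y. \<lfloor>2 ^ n * x\<rfloor> = \<lfloor>2 ^ n * y\<rfloor> \<longrightarrow> h x = h y)"

text \<open>The index \<open>Suc n\<close> reads the next binary digit: the sign is -1 on the left
  half and 1 on the right half of each dyadic interval of length 2^-n. So it is adapted at level
  \<open>Suc n\<close> and averages to 0 over each interval of level \<open>n\<close>.\<close>

definition rademacher :: "nat \<Rightarrow> real \<Rightarrow> real" where
  "rademacher n x = (if even \<lfloor>2 ^ Suc n * x\<rfloor> then -1 else 1)"

text \<open>Dropping \<open>n - m\<close> binary digits is integer division by a power of two, so
  the fine cell determines the coarse one; monotonicity of \<open>dyadic_adapted\<close> rests on
  this.\<close>

lemma floor_dyadic_div:
  assumes "m \<le> n"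
  shows "\<lfloor>2 ^ m * (x::real)\<rfloor> = \<lfloor>2 ^ n * x\<rfloor> div 2 ^ (n - m)"
proof -
  define k where "k = n - m"
  have n: "n = m + k" using assms by (simp add: k_def)
  have "2 ^ m * x = (2 ^ n * x) / real_of_int (2 ^ k)"
    unfolding n by (simp add: power_add)
  then have "\<lfloor>2 ^ m * x\<rfloor> = \<lfloor>(2 ^ n * x) / real_of_int (2 ^ k)\<rfloor>" by (rule arg_cong)
  also have "\<dots> =  \<lfloor>2 ^ n * x\<rfloor> div 2 ^ k"
    by (rule floor_divide_real_eq_div) simp
  finally show ?thesis unfolding k_def .
qed

lemma dyadic_adaptedD: "dyadic_adapted n h \<Longrightarrow> \<lfloor>2 ^ n * x\<rfloor> = \<lfloor>2 ^ n * y\<rfloor> \<Longrightarrow> h x = h y"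
  unfolding dyadic_adapted_def by blast

lemma dyadic_adapted_mono:
  assumes "dyadic_adapted m h" "m \<le> n"
  shows "dyadic_adapted n h"
  unfolding dyadic_adapted_def
  by (intro allI impI dyadic_adaptedD[OF assms(1)]) (simp only: floor_dyadic_div[OF assms(2)])

lemma dyadic_adapted_comp:
  assumes "dyadic_adapted n g"
  shows "dyadic_adapted n (\<lambda>x. \<phi> (g x))"
  unfolding dyadic_adapted_def by (intro allI impI arg_cong[of _ _ \<phi>] dyadic_adaptedD[OF assms])

lemma dyadic_adapted_comp2:
  assumes "dyadic_adapted n g" "dyadic_adapted n h"
  shows "dyadic_adapted n (\<lambda>x. \<phi> (g x) (h x))"
  unfolding dyadic_adapted_def
  by (intro allI impI arg_cong2[of _ _ _ _ \<phi>] dyadic_adaptedD[OF assms(1)] dyadic_adaptedD[OF assms(2)])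

lemma dyadic_adapted_rademacher: "dyadic_adapted (Suc n) (rademacher n)"
  unfolding dyadic_adapted_def rademacher_def by metis

lemma dyadic_adapted_unit_interval: "dyadic_adapted n (\<lambda>x. x \<in> {0..<1::real})"
proof -
  have "x \<in> {0..<1} \<longleftrightarrow> \<lfloor>x\<rfloor> = 0" for x :: real
    unfolding floor_eq_iff by simp
  then have "dyadic_adapted 0 (\<lambda>x. x \<in> {0..<1::real})"
    unfolding dyadic_adapted_def power_0 mult_1_left by metis
  then show ?thesis by (rule dyadic_adapted_mono) simp
qed

lemma dyadic_adapted_measurable:
  fixes h :: "real \<Rightarrow> real"
  assumes "dyadic_adapted n h"
  shows "h \<in> borel_measurable borel"
proof -
  have "h = (\<lambda>x. (\<lambda>k::int. h (k / 2 ^ n)) \<lfloor>2 ^ n * x\<rfloor>)"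
    by (rule ext, rule dyadic_adaptedD[OF assms]) simp
  also have "\<dots> \<in> borel_measurable borel"
    by measurable
  finally show ?thesis .
qed

lemma dyadic_adapted_integrable:
  fixes h :: "real \<Rightarrow> real"
  assumes h: "dyadic_adapted n h" and supp: "\<And>x. x \<notin> {0..<1} \<Longrightarrow> h x = 0"
  shows "integrable lborel h"
proof -
  define C where "C = (\<Sum>k<2^n. \<bar>h (real k / 2 ^ n)\<bar>)"
  have "\<bar>h x\<bar> \<le> C * indicator {0..<1} x" for x
  proof (cases "x \<in> {0..<1}")
    case True
    let ?k = "nat \<lfloor>2 ^ n * x\<rfloor>"
    have nn: "0 \<le> \<lfloor>2 ^ n * x\<rfloor>" using True by simp
    have eq: "h x = h (real ?k / 2 ^ n)"
      by (rule dyadic_adaptedD[OF h]) (use nn in simp)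
    have "2 ^ n * x < 2 ^ n" using True by simp
    then have "\<lfloor>2 ^ n * x\<rfloor> < 2 ^ n" by (simp add: floor_less_iff)
    then have "?k < 2 ^ n" using nn by (simp add: nat_less_iff)
    then have "\<bar>h (real ?k / 2 ^ n)\<bar> \<le> C"
      unfolding C_def by (intro member_le_sum) auto
    then show ?thesis using eq True by simp
  qed (use supp in simp)
  moreover have "integrable lborel (\<lambda>x::real. C * indicator {0..<1} x :: real)"
    by (intro integrable_mult_right integrable_real_indicator) auto
  ultimately show ?thesis
    using dyadic_adapted_measurable[OF h]
    by (intro Bochner_Integration.integrable_bound[of _ "\<lambda>x. C * indicator {0..<1} x" h])
      (auto simp: C_def intro!: AE_I2 order_trans[OF _ abs_ge_self])
qed

text \<open>Translation by \<open>t\<close>, half a cell of level \<open>n\<close>, carries the left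
  halves \<open>A\<close> onto the right halves and stays within the cell, where \<open>h\<close> is
  constant. The two halves therefore contribute opposite amounts.\<close>

lemma integral_rademacher_zero:
  fixes h :: "real \<Rightarrow> real"
  assumes h: "dyadic_adapted n h" and int: "integrable lborel h"
  shows "(\<integral>x. rademacher n x * h x \<partial>lborel) = 0"
proof -
  define A where "A = {x::real. even \<lfloor>2 ^ Suc n * x\<rfloor>}"
  define t :: real where "t = 1 / 2 ^ Suc n"
  have A[measurable]: "A \<in> sets borel" unfolding A_def by measurable
  have shift: "\<lfloor>2 ^ Suc n * (t + x)\<rfloor> = \<lfloor>2 ^ Suc n * x\<rfloor> + 1" for x :: real
  proof -
    have "2 ^ Suc n * (t + x) = 2 ^ Suc n * x + 1" by (simp add: t_def field_simps)
    then show ?thesis by linarith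
  qed
  have A1: "t + x \<notin> A \<longleftrightarrow> x \<in> A" for x
    unfolding A_def mem_Collect_eq shift by simp
  have h1: "h (t + x) = h x" if "x \<in> A" for x
  proof (rule dyadic_adaptedD[OF h])
    show "\<lfloor>2 ^ n * (t + x)\<rfloor> = \<lfloor>2 ^ n * x\<rfloor>"
      using that floor_dyadic_div[of n "Suc n" x] floor_dyadic_div[of n "Suc n" "t + x"]
      unfolding shift by (simp add: A_def)
  qed
  have i1: "integrable lborel (\<lambda>x. h x * indicator A x)" "integrable lborel (\<lambda>x. h x * indicator (-A) x)"
    using int by (auto intro!: integrable_real_mult_indicator)
  have "(\<integral>x. h x * indicator (-A) x \<partial>lborel) = (\<integral>x. h (t + x) * indicator (-A) (t + x) \<partial>lborel)"
    using lborel_integral_real_affine[of 1 "\<lambda>x. h x * indicator (-A) x" t] by simp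
  also have "\<dots> = (\<integral>x. h x * indicator A x \<partial>lborel)"
    using A1 h1 by (intro Bochner_Integration.integral_cong) (auto simp: indicator_def)
  finally have "(\<integral>x. h x * indicator (-A) x - h x * indicator A x \<partial>lborel) = 0"
    using i1 by simp
  also have "(\<lambda>x. h x * indicator (-A) x - h x * indicator A x) = (\<lambda>x. rademacher n x * h x)"
    by (auto simp: rademacher_def A_def indicator_def)
  finally show ?thesis .
qed

lemma dyadic_adapted_transform:
  fixes b :: "nat \<Rightarrow> real \<Rightarrow> real"
  assumes b: "\<And>j. dyadic_adapted j (b j)"
  shows "dyadic_adapted n (\<lambda>x. \<Sum>j<n. rademacher j x * b j x)"
  unfolding dyadic_adapted_def
proof (intro allI impI sum.cong refl)
  fix x y :: real and j assume eq: "\<lfloor>2 ^ n * x\<rfloor> = \<lfloor>2 ^ n * y\<rfloor>" and j: "j \<in> {..<n}"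
  have "rademacher j x = rademacher j y" "b j x = b j y"
    using dyadic_adaptedD[OF dyadic_adapted_mono[OF dyadic_adapted_rademacher, of j n] eq]
      dyadic_adaptedD[OF dyadic_adapted_mono[OF b, of j n] eq] j by auto
  then show "rademacher j x * b j x = rademacher j y * b j y" by simp
qed

text \<open>Orthogonality: the earlier sum times \<open>b n\<close> is adapted at level
  \<open>n\<close>, so the cross term integrates to 0 against the sign, and the signs have square
  1.\<close>

lemma integral_transform_square:
  fixes b :: "nat \<Rightarrow> real \<Rightarrow> real"
  assumes b: "\<And>j. dyadic_adapted j (b j)" and supp: "\<And>j x. x \<notin> {0..<1} \<Longrightarrow> b j x = 0"
  shows "(\<integral>x. (\<Sum>j<n. rademacher j x * b j x)\<^sup>2 \<partial>lborel) = (\<Sum>j<n. \<integral>x. (b j x)\<^sup>2 \<partial>lborel)"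
proof (induction n)
  case (Suc n)
  let ?T = "\<lambda>x. \<Sum>j<n. rademacher j x * b j x"
  note T = dyadic_adapted_transform[of b n, OF b]
  have ad: "dyadic_adapted n (\<lambda>x. (?T x)\<^sup>2)" "dyadic_adapted n (\<lambda>x. (b n x)\<^sup>2)"
    "dyadic_adapted n (\<lambda>x. ?T x * b n x)"
    by (rule dyadic_adapted_comp[OF T] dyadic_adapted_comp[OF b] dyadic_adapted_comp2[OF T b])+
  have zero: "?T x = 0" "b n x = 0" if "x \<notin> {0..<1}" for x
    by (simp_all only: supp[OF that] mult_zero_right sum.neutral_const)
  have int1: "integrable lborel (\<lambda>x. (?T x)\<^sup>2)"
    by (rule dyadic_adapted_integrable[OF ad(1)]) (simp only: zero zero_power2 not_False_eq_True)
  have int2: "integrable lborel (\<lambda>x. (b n x)\<^sup>2)"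
    by (rule dyadic_adapted_integrable[OF ad(2)]) (simp only: zero zero_power2 not_False_eq_True)
  have int12: "integrable lborel (\<lambda>x. ?T x * b n x)"
  proof (rule dyadic_adapted_integrable[OF ad(3)])
    fix x :: real assume "x \<notin> {0..<1}"
    from zero(2)[OF this] show "?T x * b n x = 0" by simp
  qed
  have int3: "integrable lborel (\<lambda>x. rademacher n x * (?T x * b n x))"
  proof (rule dyadic_adapted_integrable)
    show "dyadic_adapted (Suc n) (\<lambda>x. rademacher n x * (?T x * b n x))"
      by (rule dyadic_adapted_comp2[where \<phi> = times, OF dyadic_adapted_rademacher dyadic_adapted_mono[OF ad(3)]]) simp
  next
    fix x :: real assume "x \<notin> {0..<1}"
    from zero(2)[OF this] show "rademacher n x * (?T x * b n x) = 0" by simp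
  qed
  have sq: "(rademacher n x)\<^sup>2 = 1" for x by (simp add: rademacher_def)
  have "(\<integral>x. (\<Sum>j<Suc n. rademacher j x * b j x)\<^sup>2 \<partial>lborel)
     = (\<integral>x. ((?T x)\<^sup>2 + (b n x)\<^sup>2) + 2 * (rademacher n x * (?T x * b n x)) \<partial>lborel)"
    by (rule Bochner_Integration.integral_cong)
      (auto simp: power2_sum power_mult_distrib sq)
  also have "\<dots> = (\<integral>x. (?T x)\<^sup>2 \<partial>lborel) + (\<integral>x. (b n x)\<^sup>2 \<partial>lborel)
      + 2 * (\<integral>x. rademacher n x * (?T x * b n x) \<partial>lborel)"
    using int1 int2 int3 by simp
  also have "(\<integral>x. rademacher n x * (?T x * b n x) \<partial>lborel) = 0"
    by (rule integral_rademacher_zero[OF ad(3) int12])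
  finally show ?case using Suc by simp
qed simp

text \<open>Doob's maximal inequality by stopping. The coefficients \<open>c\<close> agree with
  \<open>b\<close> until a partial sum exceeds \<open>l\<close> and vanish afterwards; this is
  decided by the sums \<open>T k\<close> with \<open>k \<le> j\<close>, so \<open>c\<close> stays
  adapted. The stopped sum \<open>U n\<close> remains above \<open>l\<close> in absolute value on
  \<open>A n\<close>, its square has integral at most \<delta>, and Chebyshev's inequality
  applies.\<close>

lemma transform_maximal:
  fixes b :: "nat \<Rightarrow> real \<Rightarrow> real"
  assumes b: "\<And>j. dyadic_adapted j (b j)" and supp: "\<And>j x. x \<notin> {0..<1} \<Longrightarrow> b j x = 0"
    and \<delta>: "\<And>n. (\<Sum>j<n. \<integral>x. (b j x)\<^sup>2 \<partial>lborel) \<le> \<delta>" and l: "l > 0"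
  shows "emeasure lborel {x. \<exists>n. \<bar>\<Sum>j<n. rademacher j x * b j x\<bar> > l} \<le> ennreal (\<delta> / l\<^sup>2)"
proof -
  define T where "T n x = (\<Sum>j<n. rademacher j x * b j x)" for n x
  have Tad: "dyadic_adapted n (T n)" for n
    unfolding T_def[abs_def] by (rule dyadic_adapted_transform[OF b])
  have T[measurable]: "T n \<in> borel_measurable borel" for n
    by (rule dyadic_adapted_measurable[OF Tad])
  define c where "c j x = (if \<forall>k\<le>j. \<bar>T k x\<bar> \<le> l then b j x else 0)" for j x
  have c: "dyadic_adapted j (c j)" for j
    unfolding dyadic_adapted_def
  proof (intro allI impI)
    fix x y :: real assume eq: "\<lfloor>2 ^ j * x\<rfloor> = \<lfloor>2 ^ j * y\<rfloor>"
    have "T k x = T k y" if "k \<le> j" for k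
      by (rule dyadic_adaptedD[OF dyadic_adapted_mono[OF Tad that] eq])
    then show "c j x = c j y"
      using dyadic_adaptedD[OF b eq] by (auto simp: c_def)
  qed
  have csupp: "c j x = 0" if "x \<notin> {0..<1}" for j x
    using supp[OF that] by (simp add: c_def)
  define U where "U n x = (\<Sum>j<n. rademacher j x * c j x)" for n x
  have Uad: "dyadic_adapted n (U n)" for n
    unfolding U_def[abs_def] by (rule dyadic_adapted_transform[OF c])
  have sqad: "dyadic_adapted n (\<lambda>x. (h x)\<^sup>2)" if "dyadic_adapted n h" for h :: "real \<Rightarrow> real" and n
    by (rule dyadic_adapted_comp[OF that])
  have Uint: "integrable lborel (\<lambda>x. (U n x)\<^sup>2)" for n
    using csupp by (intro dyadic_adapted_integrable[OF sqad[OF Uad]]) (simp add: U_def)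
  have le: "(\<integral>x. (U n x)\<^sup>2 \<partial>lborel) \<le> \<delta>" for n
  proof -
    have "(\<integral>x. (U n x)\<^sup>2 \<partial>lborel) = (\<Sum>j<n. \<integral>x. (c j x)\<^sup>2 \<partial>lborel)"
      unfolding U_def by (rule integral_transform_square[OF c csupp])
    also have "\<dots> \<le> (\<Sum>j<n. \<integral>x. (b j x)\<^sup>2 \<partial>lborel)"
      using supp csupp
      by (intro sum_mono integral_mono dyadic_adapted_integrable[OF sqad[OF c]]
          dyadic_adapted_integrable[OF sqad[OF b]]) (auto simp: c_def)
    finally show ?thesis using \<delta>[of n] by simp
  qed
  define A where "A n = {x. \<exists>k\<le>n. \<bar>T k x\<bar> > l}" for n
  have Am[measurable]: "A n \<in> sets borel" for n unfolding A_def by measurable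
  have U_stop: "\<bar>U n x\<bar> > l" if xA: "x \<in> A n" for n x
  proof -
    have ex: "\<exists>k. \<bar>T k x\<bar> > l" using xA by (auto simp: A_def)
    define k where "k = (LEAST k. \<bar>T k x\<bar> > l)"
    have k: "\<bar>T k x\<bar> > l" unfolding k_def by (rule LeastI_ex[OF ex])
    have kmin: "\<bar>T i x\<bar> \<le> l" if "i < k" for i
      using not_less_Least[of i "\<lambda>k. \<bar>T k x\<bar> > l"] that unfolding k_def by simp
    obtain i where "i \<le> n" "\<bar>T i x\<bar> > l" using xA by (auto simp: A_def)
    then have "k \<le> n"
      unfolding k_def by (metis (mono_tags, lifting) Least_le order_trans)
    then have "U n x = (\<Sum>j<k. rademacher j x * c j x) + (\<Sum>j\<in>{k..<n}. rademacher j x * c j x)"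
      unfolding U_def using sum.atLeastLessThan_concat[of 0 k n "\<lambda>j. rademacher j x * c j x"]
      by (simp add: atLeast0LessThan)
    also have "(\<Sum>j\<in>{k..<n}. rademacher j x * c j x) = 0"
      using k not_le by (intro sum.neutral ballI) (simp add: c_def, blast)
    also have "(\<Sum>j<k. rademacher j x * c j x) = T k x"
      unfolding T_def using kmin by (intro sum.cong) (auto simp: c_def)
    finally show ?thesis using k by simp
  qed
  have "emeasure lborel (A n) \<le> ennreal (\<delta> / l\<^sup>2)" for n
  proof -
    have "A n \<subseteq> {0..<1}"
      using supp l by (force simp: A_def T_def)
    then have fin: "emeasure lborel (A n) \<noteq> \<infinity>"
      using emeasure_mono[of "A n" "{0..<1}" lborel] by (auto simp: top_unique)
    have iA: "integrable lborel (\<lambda>x. l\<^sup>2 * indicator (A n) x :: real)"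
      using fin by (intro integrable_mult_right integrable_real_indicator) (auto simp: less_top)
    have "l\<^sup>2 * measure lborel (A n) = (\<integral>x. l\<^sup>2 * indicator (A n) x \<partial>lborel)"
      by simp
    also have "\<dots> \<le> (\<integral>x. (U n x)\<^sup>2 \<partial>lborel)"
    proof (rule integral_mono[OF iA Uint])
      fix x
      have "l\<^sup>2 \<le> (U n x)\<^sup>2" if "x \<in> A n"
        using U_stop[OF that] l by (metis abs_le_square_iff abs_of_pos less_imp_le)
      then show "l\<^sup>2 * indicator (A n) x \<le> (U n x)\<^sup>2" by (auto simp: indicator_def)
    qed
    also note le
    finally have "measure lborel (A n) \<le> \<delta> / l\<^sup>2" using l by (simp add: field_simps)
    then show ?thesis using fin
      by (simp add: emeasure_eq_ennreal_measure ennreal_leI)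
  qed
  then have "(SUP n. emeasure lborel (A n)) \<le> ennreal (\<delta> / l\<^sup>2)"
    by (rule SUP_least)
  moreover have "(SUP n. emeasure lborel (A n)) = emeasure lborel (\<Union>n. A n)"
    by (rule SUP_emeasure_incseq) (auto simp: A_def incseq_def intro: order_trans)
  moreover have "(\<Union>n. A n) = {x. \<exists>n. \<bar>\<Sum>j<n. rademacher j x * b j x\<bar> > l}"
    unfolding A_def T_def by blast
  ultimately show ?thesis by simp
qed

text \<open>The bound on the square function makes the integrals \<open>\<beta>\<close> summable. By
  the maximal inequality the set where the sums oscillate noticeably beyond \<open>m\<close> has
  measure bounded by a multiple of a tail of that series, so almost every point escapes it for some
  \<open>m\<close>, whatever the tolerance.\<close>

lemma transform_convergent_bounded:
  fixes b :: "nat \<Rightarrow> real \<Rightarrow> real"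
  assumes b: "\<And>j. dyadic_adapted j (b j)" and supp: "\<And>j x. x \<notin> {0..<1} \<Longrightarrow> b j x = 0"
    and N: "\<And>n x. (\<Sum>j<n. (b j x)\<^sup>2) \<le> N"
  shows "AE x in lborel. convergent (\<lambda>n. \<Sum>j<n. rademacher j x * b j x)"
proof -
  define \<beta> where "\<beta> j = (\<integral>x. (b j x)\<^sup>2 \<partial>lborel)" for j
  define T where "T n x = (\<Sum>j<n. rademacher j x * b j x)" for n x
  have sqad: "dyadic_adapted n (\<lambda>x. (h x)\<^sup>2)" if "dyadic_adapted n h" for h :: "real \<Rightarrow> real" and n
    by (rule dyadic_adapted_comp[OF that])
  have bint: "integrable lborel (\<lambda>x. (b n x)\<^sup>2)" for n
    using supp by (intro dyadic_adapted_integrable[OF sqad[OF b]]) simp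
  have "(\<Sum>j<n. \<beta> j) \<le> N" for n
  proof -
    have "(\<Sum>j<n. \<beta> j) = (\<integral>x. (\<Sum>j<n. (b j x)\<^sup>2) \<partial>lborel)"
      unfolding \<beta>_def using bint by simp
    also have "\<dots> \<le> (\<integral>x. N * indicator {0..<1::real} x \<partial>lborel)"
    proof (rule integral_mono)
      show "integrable lborel (\<lambda>x::real. N * indicator {0..<1} x :: real)"
        by (intro integrable_mult_right integrable_real_indicator) auto
      show "(\<Sum>j<n. (b j x)\<^sup>2) \<le> N * indicator {0..<1} x" for x
        using N[where n=n and x=x] supp[of x] by (cases "x \<in> {0..<1}") auto
    qed (use bint in auto)
    finally show ?thesis by simp
  qed
  moreover have \<beta>0: "\<beta> j \<ge> 0" for j by (simp add: \<beta>_def)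
  ultimately have sm: "summable \<beta>"
    by (intro summableI_nonneg_bounded)
  \<comment> \<open>The part of the sum beyond \<open>m\<close> is expressed by coefficients set to
    0 below \<open>m\<close>. Each coefficient keeps its level, so \<open>transform_maximal\<close>
    applies without reindexing.\<close>
  define C where "C i m = {x. \<exists>n. \<bar>\<Sum>j<n. rademacher j x * (if m \<le> j then b j x else 0)\<bar> > 1 / Suc i}" for i m
  have ad: "dyadic_adapted j (\<lambda>x. if m \<le> j then b j x else 0)" for j m
    by (rule dyadic_adapted_comp[OF b])
  have Cm[measurable]: "C i m \<in> sets borel" for i m
  proof -
    have [measurable]: "(\<lambda>x. \<Sum>j<n. rademacher j x * (if m \<le> j then b j x else 0)) \<in> borel_measurable borel" for n
      by (rule dyadic_adapted_measurable[OF dyadic_adapted_transform[OF ad]])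
    show ?thesis unfolding C_def by measurable
  qed
  have "emeasure lborel (C i m) \<le> ennreal ((\<Sum>j. \<beta> (j + m)) / (1 / Suc i)\<^sup>2)" for i m
    unfolding C_def
  proof (rule transform_maximal[OF ad])
    fix n
    have "(\<Sum>j<n. \<integral>x. (if m \<le> j then b j x else 0)\<^sup>2 \<partial>lborel) = (\<Sum>j<n. if m \<le> j then \<beta> j else 0)"
      by (intro sum.cong) (auto simp: \<beta>_def)
    also have "\<dots> \<le> (\<Sum>j<m+n. if m \<le> j then \<beta> j else 0)"
      using \<beta>0 by (intro sum_mono2) auto
    also have "\<dots> = (\<Sum>j\<in>{m..<m+n}. \<beta> j)"
      by (rule sum.mono_neutral_cong_right) auto
    also have "\<dots> = (\<Sum>j<n. \<beta> (j + m))"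
      using sum.shift_bounds_nat_ivl[of \<beta> 0 m n] by (simp add: atLeast0LessThan add.commute)
    also have "\<dots> \<le> (\<Sum>j. \<beta> (j + m))"
      using sm \<beta>0 by (intro sum_le_suminf summable_ignore_initial_segment) auto
    finally show "(\<Sum>j<n. \<integral>x. (if m \<le> j then b j x else 0)\<^sup>2 \<partial>lborel) \<le> (\<Sum>j. \<beta> (j + m))" .
  qed (use supp in auto)
  note Cle = this
  have Cnull: "(\<Inter>m. C i m) \<in> null_sets lborel" for i
  proof -
    have "(\<lambda>m. (\<Sum>j. \<beta> (j + m)) / (1 / Suc i)\<^sup>2) \<longlonglongrightarrow> 0 / (1 / Suc i)\<^sup>2"
      by (intro tendsto_divide tendsto_const suminf_exist_split2[OF sm]) auto
    then have "(\<lambda>m. ennreal ((\<Sum>j. \<beta> (j + m)) / (1 / Suc i)\<^sup>2)) \<longlonglongrightarrow> ennreal 0"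
      by (intro tendsto_ennrealI) simp
    moreover have "emeasure lborel (\<Inter>m. C i m) \<le> ennreal ((\<Sum>j. \<beta> (j + m)) / (1 / Suc i)\<^sup>2)" for m
      by (rule order_trans[OF emeasure_mono Cle]) auto
    ultimately have "emeasure lborel (\<Inter>m. C i m) \<le> ennreal 0"
      by (intro tendsto_lowerbound[of _ "ennreal 0" sequentially]) (auto intro: always_eventually)
    then show ?thesis by (intro null_setsI) auto
  qed
  have "AE x in lborel. \<forall>i. x \<notin> (\<Inter>m. C i m)"
    unfolding AE_all_countable by (intro allI AE_not_in Cnull)
  then show ?thesis
  proof eventually_elim
    case (elim x)
    have "Cauchy (\<lambda>n. T n x)"
    proof (rule metric_CauchyI)
      fix e :: real assume "e > 0"
      then obtain i where i: "2 / Suc i < e"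
        using reals_Archimedean[of "e/2"] by (auto simp: field_simps)
      obtain m where "x \<notin> C i m" using elim by auto
      then have *: "\<bar>\<Sum>j<n. rademacher j x * (if m \<le> j then b j x else 0)\<bar> \<le> 1 / Suc i" for n
        by (auto simp: C_def not_less)
      have "\<bar>T n x - T m x\<bar> \<le> 1 / Suc i" if "n \<ge> m" for n
      proof -
        have "T n x = T m x + (\<Sum>j\<in>{m..<n}. rademacher j x * b j x)"
          unfolding T_def using sum.atLeastLessThan_concat[of 0 m n "\<lambda>j. rademacher j x * b j x"] that
          by (simp add: atLeast0LessThan)
        also have "(\<Sum>j\<in>{m..<n}. rademacher j x * b j x) = (\<Sum>j<n. rademacher j x * (if m \<le> j then b j x else 0))"
          by (rule sum.mono_neutral_cong_left) auto
        finally show ?thesis using *[of n] by simp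
      qed
      note ** = this
      show "\<exists>M. \<forall>k\<ge>M. \<forall>n\<ge>M. dist (T k x) (T n x) < e"
      proof (intro exI[of _ m] allI impI)
        fix k n assume "k \<ge> m" "n \<ge> m"
        have "dist (T k x) (T n x) \<le> dist (T k x) (T m x) + dist (T n x) (T m x)"
          by (rule dist_triangle2)
        also have "\<dots> \<le> 1 / Suc i + 1 / Suc i"
          unfolding dist_real_def by (intro add_mono ** \<open>k \<ge> m\<close> \<open>n \<ge> m\<close>)
        also have "\<dots> < e" using i by simp
        finally show "dist (T k x) (T n x) < e" .
      qed
    qed
    then show ?case unfolding T_def by (rule Cauchy_convergent)
  qed
qed

text \<open>A point with finite square sum is unaffected by truncation at a large enough integer
  \<open>N\<close>, so countably many applications of the bounded case cover all such
  points.\<close>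

proposition transform_convergent:
  fixes a :: "nat \<Rightarrow> real \<Rightarrow> real"
  assumes a: "\<And>j. dyadic_adapted j (a j)"
  shows "AE x in lborel. x \<in> {0..<1} \<longrightarrow> summable (\<lambda>j. (a j x)\<^sup>2) \<longrightarrow>
           convergent (\<lambda>n. \<Sum>j<n. rademacher j x * a j x)"
proof -
  \<comment> \<open>The threshold includes the current term \<open>i = j\<close>, which keeps the
    truncated square sum below \<open>N\<close> at every step. This is admissible because
    \<open>a j\<close> is already determined at level \<open>j\<close>, before the sign
    \<open>rademacher j\<close>.\<close>
  define b where "b N j x = (if x \<in> {0..<1} \<and> (\<Sum>i\<le>j. (a i x)\<^sup>2) \<le> real N then a j x else 0)" for N j x
  have bad: "dyadic_adapted j (b N j)" for N j
    unfolding dyadic_adapted_def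
  proof (intro allI impI)
    fix x y :: real assume eq: "\<lfloor>2 ^ j * x\<rfloor> = \<lfloor>2 ^ j * y\<rfloor>"
    have "a k x = a k y" if "k \<le> j" for k
      by (rule dyadic_adaptedD[OF dyadic_adapted_mono[OF a that] eq])
    then have "a j x = a j y" "(\<Sum>i\<le>j. (a i x)\<^sup>2) = (\<Sum>i\<le>j. (a i y)\<^sup>2)"
      by (auto intro!: sum.cong)
    moreover have "(x \<in> {0..<1}) = (y \<in> {0..<1})"
      by (rule dyadic_adaptedD[OF dyadic_adapted_unit_interval eq])
    ultimately show "b N j x = b N j y" by (simp add: b_def)
  qed
  have "(\<Sum>j<n. (b N j x)\<^sup>2) \<le> real N" for N n x
  proof -
    \<comment> \<open>The second conjunct carries the induction: while the threshold holds, the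
      truncated sum is dominated by the full one; once it fails, nothing more is added.\<close>
    have "(\<Sum>j<n. (b N j x)\<^sup>2) \<le> real N \<and> ((\<Sum>i<n. (a i x)\<^sup>2) \<le> N \<longrightarrow> (\<Sum>j<n. (b N j x)\<^sup>2) \<le> (\<Sum>i<n. (a i x)\<^sup>2))"
    proof (induction n)
      case (Suc n)
      show ?case
      proof (cases "(\<Sum>i<Suc n. (a i x)\<^sup>2) \<le> N")
        case True
        have "(\<Sum>i<n. (a i x)\<^sup>2) \<le> (\<Sum>i<Suc n. (a i x)\<^sup>2)" by simp
        then have "(\<Sum>j<n. (b N j x)\<^sup>2) \<le> (\<Sum>i<n. (a i x)\<^sup>2)" using Suc True by linarith
        moreover have "(b N n x)\<^sup>2 \<le> (a n x)\<^sup>2" by (simp add: b_def)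
        ultimately have "(\<Sum>j<Suc n. (b N j x)\<^sup>2) \<le> (\<Sum>i<Suc n. (a i x)\<^sup>2)" by simp
        then show ?thesis using True by linarith
      next
        case False
        then have "b N n x = 0" by (simp add: b_def lessThan_Suc_atMost)
        then show ?thesis using Suc False by simp
      qed
    qed simp
    then show ?thesis by simp
  qed
  then have "AE x in lborel. \<forall>N. convergent (\<lambda>n. \<Sum>j<n. rademacher j x * b N j x)"
    unfolding AE_all_countable by (intro allI transform_convergent_bounded[OF bad]) (auto simp: b_def)
  then show ?thesis
  proof eventually_elim
    case (elim x)
    show ?case
    proof (intro impI)
      assume x: "x \<in> {0..<1}" and s: "summable (\<lambda>j. (a j x)\<^sup>2)"
      obtain N :: nat where N: "(\<Sum>j. (a j x)\<^sup>2) \<le> N" using real_arch_simple[of "\<Sum>j. (a j x)\<^sup>2"] by auto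
      have "(\<Sum>i\<le>j. (a i x)\<^sup>2) \<le> N" for j
        by (rule order_trans[OF sum_le_suminf[OF s] N]) auto
      then have "b N j x = a j x" for j unfolding b_def using x by (intro if_P conjI)
      then have "(\<lambda>n. \<Sum>j<n. rademacher j x * a j x) = (\<lambda>n. \<Sum>j<n. rademacher j x * b N j x)"
        by (simp only:)
      then show "convergent (\<lambda>n. \<Sum>j<n. rademacher j x * a j x)"
        using elim by (simp only:)
    qed
  qed
qed

section \<open>Regularity of Zygmund functions\<close>

text \<open>The fourth powers are 8 and 2401/256. After halving, the rational bound leaves 1/8 of
  the constant for the Zygmund error in \<open>zygmund_holder\<close>.\<close>

lemma two_powr_three_quarters: "2 powr (3/4 :: real) \<le> 7/4"
proof -
  have "(2 powr (3/4 :: real)) ^ 4 = 2 powr 3"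
    by (simp add: powr_powr flip: powr_realpow)
  also have "\<dots> = 8" by (simp add: powr_numeral)
  also have "\<dots> \<le> (7/4 :: real) ^ 4" by (simp add: eval_nat_numeral)
  finally show ?thesis using power_mono_iff[of "2 powr (3/4 :: real)" "7/4" 4] by simp
qed

text \<open>The interval is doubled to the right if there is room, otherwise to the left; one of the
  two fits because its length is at most a third of \<open>b - a\<close>. The Zygmund bound at the
  midpoint of the doubled interval compares the increment over one half with half of the whole
  increment.\<close>

lemma zygmund_doubling:
  fixes g :: "real \<Rightarrow> real"
  assumes zyg: "\<And>x h. \<bar>g (x + h) + g (x - h) - 2 * g x\<bar> \<le> c * \<bar>h\<bar>"
    and xy: "a \<le> x" "x < y" "y \<le> b" "3 * (y - x) \<le> b - a"
  obtains u v where "a \<le> u" "u < v" "v \<le> b" "v - u = 2 * (y - x)"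
    "\<bar>g y - g x\<bar> \<le> \<bar>g v - g u\<bar> / 2 + c * (y - x) / 2"
proof -
  have aux: "\<bar>p - q\<bar> \<le> \<bar>r - q\<bar> / 2 + C / 2" if "\<bar>r + q - 2 * p\<bar> \<le> C" for p q r C :: real
    using that by argo
  have aux': "\<bar>p - q\<bar> \<le> \<bar>p - r\<bar> / 2 + C / 2" if "\<bar>p + r - 2 * q\<bar> \<le> C" for p q r C :: real
    using that by argo
  show ?thesis
  proof (cases "y + (y - x) \<le> b")
  case True
  have "\<bar>g y - g x\<bar> \<le> \<bar>g (y + (y - x)) - g x\<bar> / 2 + c * (y - x) / 2"
    using zyg[of y "y - x"] xy by (intro aux) auto
  then show ?thesis
    using that[of x "y + (y - x)"] xy True by simp
next
  case False
  have "\<bar>g y - g x\<bar> \<le> \<bar>g y - g (x - (y - x))\<bar> / 2 + c * (y - x) / 2"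
    using zyg[of x "y - x"] xy by (intro aux') auto
  then show ?thesis
    using that[of "x - (y - x)" y] xy False by simp
  qed
qed

text \<open>Doubling is repeated until the interval fills a third of \<open>{a..b}\<close>, where
  the trivial bound \<open>2 * B\<close> suffices; this accounts for \<open>6 * B\<close>. Each
  doubling preserves the constant: the main term takes 7/8 of it, and the summand
  \<open>4 * c * (b - a)\<close> makes the Zygmund error at most 1/8.\<close>

lemma zygmund_holder:
  fixes g :: "real \<Rightarrow> real"
  assumes zyg: "\<And>x h. \<bar>g (x + h) + g (x - h) - 2 * g x\<bar> \<le> c * \<bar>h\<bar>"
    and bnd: "\<And>x. x \<in> {a..b} \<Longrightarrow> \<bar>g x\<bar> \<le> B" and c: "c \<ge> 0" and ab: "a < b"
    and x: "x \<in> {a..b}" and y: "y \<in> {a..b}"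
  shows "\<bar>g x - g y\<bar> \<le> (6 * B + 4 * c * (b - a)) * (\<bar>x - y\<bar> / (b - a)) powr (3/4)"
proof -
  define L where "L = b - a"
  define A where "A = 6 * B + 4 * c * L"
  have L: "L > 0" using ab by (simp add: L_def)
  have B: "B \<ge> 0" using bnd[OF x] by linarith
  have A: "A \<ge> 0" "6 * B \<le> A" "4 * c * L \<le> A" using B c L by (auto simp: A_def)
  have base: "\<bar>g y - g x\<bar> \<le> A * ((y - x) / L) powr (3/4)"
    if xy: "a \<le> x" "x < y" "y \<le> b" "L \<le> 3 * (y - x)" for x y
  proof -
    have "((y - x) / L) powr 1 \<le> ((y - x) / L) powr (3/4)"
      using xy L by (intro powr_mono') (auto simp: L_def)
    moreover have "1/3 \<le> (y - x) / L" using xy L by (simp add: field_simps)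
    moreover have "((y - x) / L) powr 1 = (y - x) / L" using xy L by simp
    ultimately have *: "1/3 \<le> ((y - x) / L) powr (3/4)" by linarith
    have "\<bar>g y - g x\<bar> \<le> 2 * B" using bnd[of x] bnd[of y] xy by (auto simp: abs_le_iff)
    also have "\<dots> \<le> A * (1/3)" using A by simp
    also have "\<dots> \<le> A * ((y - x) / L) powr (3/4)" using * A by (intro mult_left_mono)
    finally show ?thesis .
  qed
  have main: "\<bar>g y - g x\<bar> \<le> A * ((y - x) / L) powr (3/4)"
    if "a \<le> x" "x < y" "y \<le> b" "L \<le> 2 ^ k * (3 * (y - x))" for x y and k :: nat
    using that
  proof (induction k arbitrary: x y)
    case 0
    then show ?case using base[of x y] by simp
  next
    case (Suc k)
    show ?case
    proof (cases "L \<le> 3 * (y - x)")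
      case True
      then show ?thesis using base[of x y] Suc.prems by simp
    next
      case False
      define h where "h = (y - x) / L"
      have h: "0 < h" "h \<le> 1" using Suc.prems L by (auto simp: h_def L_def)
      obtain u v where uv: "a \<le> u" "u < v" "v \<le> b" "v - u = 2 * (y - x)"
        and le: "\<bar>g y - g x\<bar> \<le> \<bar>g v - g u\<bar> / 2 + c * (y - x) / 2"
        using zygmund_doubling[of g c a x y b, OF zyg] Suc.prems False by (auto simp: L_def)
      have "\<bar>g v - g u\<bar> \<le> A * ((v - u) / L) powr (3/4)"
        by (intro Suc.IH uv) (use Suc.prems in \<open>simp add: uv(4) algebra_simps\<close>)
      also have "(v - u) / L = 2 * h" using uv by (simp add: h_def)
      also have "(2 * h) powr (3/4) = 2 powr (3/4) * h powr (3/4)"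
        using h by (simp add: powr_mult)
      also have "A * \<dots> \<le> A * (7/4 * h powr (3/4))"
        using A by (intro mult_left_mono mult_right_mono two_powr_three_quarters) auto
      finally have 1: "\<bar>g v - g u\<bar> \<le> A * (7/4) * h powr (3/4)" by simp
      have "h powr 1 \<le> h powr (3/4)" using h by (intro powr_mono') auto
      then have "h \<le> h powr (3/4)" using h by simp
      then have "c * L * h \<le> c * L * h powr (3/4)" using c L by (intro mult_left_mono) auto
      also have "\<dots> \<le> A / 4 * h powr (3/4)" using A by (intro mult_right_mono) auto
      finally have 2: "c * (y - x) \<le> A / 4 * h powr (3/4)" using L by (simp add: h_def)
      define Z where "Z = A * h powr (3/4)"
      have "\<bar>g v - g u\<bar> \<le> 7/4 * Z" "c * (y - x) \<le> 1/4 * Z"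
        using 1 2 by (simp_all add: Z_def)
      moreover have "\<bar>g y - g x\<bar> \<le> 7/8 * Z + 1/8 * Z"
        if "G \<le> 7/4 * Z" "D \<le> 1/4 * Z" "\<bar>g y - g x\<bar> \<le> G / 2 + D / 2" for G D
        using that by linarith
      ultimately have "\<bar>g y - g x\<bar> \<le> 7/8 * Z + 1/8 * Z" using le by blast
      then show ?thesis by (simp add: Z_def h_def)
    qed
  qed
  have all: "\<bar>g y - g x\<bar> \<le> A * ((y - x) / L) powr (3/4)"
    if "a \<le> x" "x < y" "y \<le> b" for x y
  proof -
    obtain k :: nat where "L / (3 * (y - x)) < 2 ^ k" using real_arch_pow[of 2 "L / (3 * (y - x))"] by auto
    then have "L \<le> 2 ^ k * (3 * (y - x))" using that by (simp add: field_simps)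
    then show ?thesis using main that by blast
  qed
  consider "x < y" | "y < x" | "x = y" by linarith
  then have "\<bar>g x - g y\<bar> \<le> A * (\<bar>x - y\<bar> / L) powr (3/4)"
    using all[of x y] all[of y x] x y by cases (auto simp: abs_minus_commute)
  then show ?thesis by (simp add: A_def L_def)
qed

text \<open>Continuity is not built into the class but follows from the local Hoelder bound.
  Boundedness is essential: a discontinuous additive function has vanishing second
  differences.\<close>

lemma zygmund_continuous:
  fixes g :: "real \<Rightarrow> real"
  assumes zyg: "\<And>x h. \<bar>g (x + h) + g (x - h) - 2 * g x\<bar> \<le> c * \<bar>h\<bar>"
    and bnd: "bounded (range g)"
  shows "continuous_on UNIV g"
proof -
  obtain B where B: "\<And>x. \<bar>g x\<bar> \<le> B" using bnd by (auto simp: bounded_iff)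
  have c: "c \<ge> 0" using zyg[of 0 1] by simp
  have "(g \<longlongrightarrow> g x) (at x)" for x
  proof (rule Lim_null_comparison[THEN LIM_zero_cancel])
    have "eventually (\<lambda>y. y \<in> {x - 1<..<x + 1}) (at x)"
      by (intro eventually_at_in_open') auto
    then show "\<forall>\<^sub>F y in at x. norm (g y - g x) \<le> (6 * B + 4 * c * 2) * (\<bar>y - x\<bar> / 2) powr (3/4)"
    proof eventually_elim
      case (elim y)
      then show ?case
        using zygmund_holder[of g c "x - 1" "x + 1" B y x, OF zyg B c] by auto
    qed
    have "((\<lambda>y. (\<bar>y - x\<bar> / 2) powr (3/4)) \<longlongrightarrow> 0) (at x)"
      by (rule tendsto_eq_intros refl | force)+
    then show "((\<lambda>y. (6 * B + 4 * c * 2) * (\<bar>y - x\<bar> / 2) powr (3/4)) \<longlongrightarrow> 0) (at x)"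
      by (rule tendsto_mult_right_zero)
  qed
  then show ?thesis by (simp add: continuous_on_def)
qed

text \<open>At a maximum \<open>u\<close> of \<open>\<bar>g\<bar>\<close> on \<open>{0..t}\<close>,
  the second difference centred at \<open>u\<close> and reaching to the nearer endpoint involves a
  zero and a value no larger than the maximum, so \<open>\<bar>g u\<bar> \<le> c * t / 2\<close>.
  Reflection at 0 extends the bound to negative \<open>s\<close> at the cost of another
  \<open>c * t\<close>.\<close>

lemma zygmund_two_zeros_bound:
  fixes g :: "real \<Rightarrow> real"
  assumes zyg: "\<And>x h. \<bar>g (x + h) + g (x - h) - 2 * g x\<bar> \<le> c * \<bar>h\<bar>"
    and cont: "continuous_on {0..t} g" and g0: "g 0 = 0" "g t = 0" and t: "t > 0" and s: "\<bar>s\<bar> \<le> t"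
  shows "\<bar>g s\<bar> \<le> 3/2 * c * t"
proof -
  have c: "c \<ge> 0" using zyg[of 0 1] by simp
  have "continuous_on {0..t} (\<lambda>x. \<bar>g x\<bar>)" using cont by (intro continuous_intros)
  then obtain u where u: "u \<in> {0..t}" and max: "\<And>y. y \<in> {0..t} \<Longrightarrow> \<bar>g y\<bar> \<le> \<bar>g u\<bar>"
    using continuous_attains_sup[of "{0..t}" "\<lambda>x. \<bar>g x\<bar>"] t by auto
  have "\<bar>g u\<bar> \<le> c * t / 2"
  proof (cases "u \<le> t / 2")
    case True
    then have "\<bar>g (u + u)\<bar> \<le> \<bar>g u\<bar>" using u by (intro max) auto
    moreover have "c * u \<le> c * (t / 2)" using c True by (intro mult_left_mono)
    ultimately show ?thesis using zyg[of u u] g0 u by (simp add: abs_if split: if_splits)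
  next
    case False
    then have "\<bar>g (u - (t - u))\<bar> \<le> \<bar>g u\<bar>" using u by (intro max) auto
    moreover have "c * (t - u) \<le> c * (t / 2)" using c False by (intro mult_left_mono) auto
    ultimately show ?thesis using zyg[of u "t - u"] g0 u by (simp add: abs_if split: if_splits)
  qed
  then have pos: "\<bar>g y\<bar> \<le> c * t / 2" if "y \<in> {0..t}" for y using max[OF that] by simp
  have ct: "c * t \<ge> 0" using c t by simp
  show ?thesis
  proof (cases "s \<ge> 0")
    case True
    then have "\<bar>g s\<bar> \<le> c * t / 2" using s by (intro pos) auto
    then show ?thesis using ct by simp
  next
    case False
    then have "\<bar>g (-s)\<bar> \<le> c * t / 2" using s by (intro pos) auto
    moreover have "c * \<bar>s\<bar> \<le> c * t" using c s by (intro mult_left_mono)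
    moreover have "\<bar>g s + g (- s)\<bar> \<le> c * \<bar>s\<bar>" using zyg[of 0 s] g0 by simp
    ultimately show ?thesis by (simp add: abs_if split: if_splits)
  qed
qed

section \<open>The energy of Lipschitz functions\<close>

lemma nn_integral_lborel_shift:
  fixes f :: "real \<Rightarrow> ennreal"
  assumes "f \<in> borel_measurable borel"
  shows "(\<integral>\<^sup>+x. f (t + x) \<partial>lborel) = (\<integral>\<^sup>+x. f x \<partial>lborel)"
  using nn_integral_real_affine[OF assms, of 1 t] by simp

definition second_dd :: "(real \<Rightarrow> real) \<Rightarrow> real \<Rightarrow> real \<Rightarrow> real \<Rightarrow> real" where
  "second_dd f x y z = ((f y - f x) / (y - x) - (f z - f x) / (z - x)) / (y - z)"

lemma second_dd_measurable [measurable (raw)]: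
  assumes [measurable]: "f \<in> borel_measurable borel" "x \<in> borel_measurable M"
    "y \<in> borel_measurable M" "z \<in> borel_measurable M"
  shows "(\<lambda>w. second_dd f (x w) (y w) (z w)) \<in> borel_measurable M"
  unfolding second_dd_def by measurable

text \<open>Exchanging \<open>y\<close> and \<open>z\<close> negates numerator and denominator,
  which is harmless even for division by 0. Exchanging \<open>x\<close> and \<open>y\<close> mixes
  the denominators, so \<open>second_dd_swap12\<close> asks for distinct points. The two generate
  all permutations.\<close>

lemma second_dd_swap23: "second_dd f x y z = second_dd f x z y"
  unfolding second_dd_def by (metis minus_diff_eq minus_divide_divide)

lemma second_dd_swap12:
  assumes "x \<noteq> y" "y \<noteq> z" "x \<noteq> z"
  shows "second_dd f x y z = second_dd f y x z"
  using assms unfolding second_dd_def by (simp add: divide_simps) (simp add: algebra_simps)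

lemma diff_quot_second_dd:
  "(diff_quot f x s - diff_quot f x t) / (s - t) = second_dd f x (x + s) (x + t)"
  by (simp add: diff_quot_def second_dd_def)

lemma quotient_energy_eq_shifted:
  assumes [measurable]: "f \<in> borel_measurable borel"
  shows "quotient_energy f x = (\<integral>\<^sup>+s. \<integral>\<^sup>+t. ennreal ((second_dd f x (x + s) (x + t))\<^sup>2)
           * indicator {t. \<bar>s\<bar> + \<bar>t\<bar> < 1} t \<partial>lborel \<partial>lborel)"
proof -
  have "quotient_energy f x = (\<integral>\<^sup>+p. ennreal ((second_dd f x (x + fst p) (x + snd p))\<^sup>2)
           * indicator {p. \<bar>fst p\<bar> + \<bar>snd p\<bar> < 1} p \<partial>(lborel \<Otimes>\<^sub>M lborel))"
    unfolding quotient_energy_def lborel_prod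
    by (intro nn_integral_cong)
      (auto simp: indicator_def power_divide diff_quot_second_dd[symmetric] split: prod.splits)
  also have "\<dots> = (\<integral>\<^sup>+s. \<integral>\<^sup>+t. ennreal ((second_dd f x (x + s) (x + t))\<^sup>2)
           * indicator {p. \<bar>fst p\<bar> + \<bar>snd p\<bar> < 1} (s, t) \<partial>lborel \<partial>lborel)"
    by (subst lborel.nn_integral_fst[symmetric]) simp_all
  finally show ?thesis by (simp add: indicator_def)
qed

lemma quotient_energy_eq:
  assumes [measurable]: "f \<in> borel_measurable borel"
  shows "quotient_energy f x = (\<integral>\<^sup>+y. \<integral>\<^sup>+z. ennreal ((second_dd f x y z)\<^sup>2)
           * indicator {z. \<bar>y - x\<bar> + \<bar>z - x\<bar> < 1} z \<partial>lborel \<partial>lborel)"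
proof -
  have "(\<integral>\<^sup>+y. \<integral>\<^sup>+z. ennreal ((second_dd f x y z)\<^sup>2)
           * indicator {z. \<bar>y - x\<bar> + \<bar>z - x\<bar> < 1} z \<partial>lborel \<partial>lborel)
      = (\<integral>\<^sup>+s. \<integral>\<^sup>+z. ennreal ((second_dd f x (x + s) z)\<^sup>2)
           * indicator {z. \<bar>(x + s) - x\<bar> + \<bar>z - x\<bar> < 1} z \<partial>lborel \<partial>lborel)"
    by (rule nn_integral_lborel_shift[symmetric]) measurable
  also have "\<dots> = (\<integral>\<^sup>+s. \<integral>\<^sup>+t. ennreal ((second_dd f x (x + s) (x + t))\<^sup>2)
           * indicator {z. \<bar>(x + s) - x\<bar> + \<bar>z - x\<bar> < 1} (x + t) \<partial>lborel \<partial>lborel)"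
    by (intro nn_integral_cong nn_integral_lborel_shift[symmetric]) measurable
  finally show ?thesis by (simp add: quotient_energy_eq_shifted indicator_def)
qed

lemma nn_integral_triple_swap12:
  fixes P :: "real \<times> real \<times> real \<Rightarrow> ennreal"
  assumes [measurable]: "P \<in> borel_measurable (borel \<Otimes>\<^sub>M borel \<Otimes>\<^sub>M borel)"
  shows "(\<integral>\<^sup>+x. \<integral>\<^sup>+y. \<integral>\<^sup>+z. P (y, x, z) \<partial>lborel \<partial>lborel \<partial>lborel)
       = (\<integral>\<^sup>+x. \<integral>\<^sup>+y. \<integral>\<^sup>+z. P (x, y, z) \<partial>lborel \<partial>lborel \<partial>lborel)"
  by (rule lborel_pair.Fubini') measurable

lemma nn_integral_triple_swap23:
  fixes P :: "real \<times> real \<times> real \<Rightarrow> ennreal"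
  assumes [measurable]: "P \<in> borel_measurable (borel \<Otimes>\<^sub>M borel \<Otimes>\<^sub>M borel)"
  shows "(\<integral>\<^sup>+x. \<integral>\<^sup>+y. \<integral>\<^sup>+z. P (x, z, y) \<partial>lborel \<partial>lborel \<partial>lborel)
       = (\<integral>\<^sup>+x. \<integral>\<^sup>+y. \<integral>\<^sup>+z. P (x, y, z) \<partial>lborel \<partial>lborel \<partial>lborel)"
  by (intro nn_integral_cong lborel_pair.Fubini') measurable

section \<open>Telescoping over scales\<close>

lemma nn_integral_powr_unit:
  assumes "a > -1"
  shows "(\<integral>\<^sup>+x. ennreal (x powr a) * indicator {0<..<1} x \<partial>lborel) < \<infinity>"
proof -
  have "((\<lambda>x::real. x powr a) has_integral (1 powr (a + 1) / (a + 1))) {0..1}"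
    by (rule has_integral_powr_from_0) (use assms in auto)
  from nn_integral_has_integral_lebesgue[OF _ this]
  have "(\<integral>\<^sup>+x. ennreal (indicator {0..1} x * x powr a) \<partial>lborel) < \<infinity>" by simp
  moreover have "(\<integral>\<^sup>+x. ennreal (x powr a) * indicator {0<..<1} x \<partial>lborel)
      \<le> (\<integral>\<^sup>+x. ennreal (indicator {0..1} x * x powr a) \<partial>lborel)"
    by (intro nn_integral_mono) (auto simp: indicator_def)
  ultimately show ?thesis by (rule le_less_trans[rotated])
qed

text \<open>The measure \<open>dr / r\<close> is invariant under dilation, so the factor \<mu> only
  moves the window to \<open>{\<mu> * \<epsilon><..<\<mu>}\<close>. What sticks out below \<epsilon>
  costs at most \<open>B * ln (1 / \<mu>)\<close>, uniformly in \<epsilon>.\<close>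

lemma nn_integral_dilated_average:
  fixes \<nu> :: "real \<Rightarrow> real"
  assumes [measurable]: "\<nu> \<in> borel_measurable borel"
    and \<nu>: "\<And>r. 0 < r \<Longrightarrow> r < 1 \<Longrightarrow> 0 \<le> \<nu> r \<and> \<nu> r \<le> B"
    and \<mu>: "0 < \<mu>" "\<mu> < 1" and \<epsilon>: "0 < \<epsilon>" "\<epsilon> < 1"
  shows "(\<integral>\<^sup>+r. ennreal (\<nu> (\<mu> * r) / r) * indicator {\<epsilon><..<1} r \<partial>lborel)
     \<le> ennreal (B * ln (1 / \<mu>)) + (\<integral>\<^sup>+r. ennreal (\<nu> r / r) * indicator {\<epsilon><..<1} r \<partial>lborel)"
proof -
  have B: "B \<ge> 0" using \<nu>[OF \<epsilon>] by linarith
  define g where "g \<rho> = ennreal (\<nu> \<rho> / \<rho>) * indicator {\<mu> * \<epsilon><..<\<mu>} \<rho>" for \<rho>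
  have [measurable]: "g \<in> borel_measurable borel" unfolding g_def by measurable
  have "(\<integral>\<^sup>+r. ennreal (\<nu> (\<mu> * r) / r) * indicator {\<epsilon><..<1} r \<partial>lborel)
      = (\<integral>\<^sup>+r. ennreal \<mu> * g (0 + \<mu> * r) \<partial>lborel)"
  proof (rule nn_integral_cong)
    fix r :: real
    have "(\<mu> * r \<in> {\<mu> * \<epsilon><..<\<mu>}) = (r \<in> {\<epsilon><..<1})" using \<mu> by auto
    moreover have "ennreal \<mu> * ennreal (\<nu> (\<mu> * r) / (\<mu> * r)) = ennreal (\<nu> (\<mu> * r) / r)"
      if "r \<in> {\<epsilon><..<1}"
      using that \<mu> \<epsilon> by (subst ennreal_mult'[symmetric]) auto
    ultimately show "ennreal (\<nu> (\<mu> * r) / r) * indicator {\<epsilon><..<1} r = ennreal \<mu> * g (0 + \<mu> * r)"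
      unfolding g_def by (auto simp: indicator_def)
  qed
  also have "\<dots> = (\<integral>\<^sup>+\<rho>. g \<rho> \<partial>lborel)"
    using nn_integral_real_affine[of g \<mu> 0] \<mu> by (simp add: nn_integral_cmult)
  also have "\<dots> \<le> (\<integral>\<^sup>+\<rho>. ennreal (B / \<rho>) * indicator {\<mu> * \<epsilon>..\<epsilon>} \<rho> + ennreal (\<nu> \<rho> / \<rho>) * indicator {\<epsilon><..<1} \<rho> \<partial>lborel)"
  proof (rule nn_integral_mono)
    fix \<rho> :: real
    have "\<mu> * \<epsilon> > 0" using \<mu> \<epsilon> by simp
    show "g \<rho> \<le> ennreal (B / \<rho>) * indicator {\<mu> * \<epsilon>..\<epsilon>} \<rho> + ennreal (\<nu> \<rho> / \<rho>) * indicator {\<epsilon><..<1} \<rho>"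
    proof (cases "\<rho> \<in> {\<mu> * \<epsilon><..<\<mu>}")
      case True
      then have \<rho>: "0 < \<rho>" "\<rho> < 1" using \<open>\<mu> * \<epsilon> > 0\<close> \<mu> by auto
      have "\<nu> \<rho> / \<rho> \<le> B / \<rho>" using \<rho> \<nu>[OF \<rho>] by (intro divide_right_mono) auto
      then show ?thesis using True \<rho> by (auto simp: g_def indicator_def ennreal_leI)
    qed (simp add: g_def)
  qed
  also have "\<dots> = (\<integral>\<^sup>+\<rho>. ennreal (B / \<rho>) * indicator {\<mu> * \<epsilon>..\<epsilon>} \<rho> \<partial>lborel) + (\<integral>\<^sup>+r. ennreal (\<nu> r / r) * indicator {\<epsilon><..<1} r \<partial>lborel)"
    by (rule nn_integral_add) measurable
  also have "(\<integral>\<^sup>+\<rho>. ennreal (B / \<rho>) * indicator {\<mu> * \<epsilon>..\<epsilon>} \<rho> \<partial>lborel) = ennreal (B * ln \<epsilon> - B * ln (\<mu> * \<epsilon>))"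
  proof (rule nn_integral_FTC_Icc[where F = "\<lambda>x. B * ln x"])
    fix x assume "x \<in> {\<mu> * \<epsilon>..\<epsilon>}"
    moreover have "\<mu> * \<epsilon> > 0" using \<mu> \<epsilon> by simp
    ultimately have "x > 0" by auto
    then show "((\<lambda>x. B * ln x) has_real_derivative B / x) (at x)" "0 \<le> B / x"
      using B by (auto intro!: derivative_eq_intros)
  qed (use \<mu> \<epsilon> in auto)
  also have "B * ln \<epsilon> - B * ln (\<mu> * \<epsilon>) = B * ln (1 / \<mu>)"
    using \<mu> \<epsilon> by (simp add: ln_mult ln_div algebra_simps)
  finally show ?thesis .
qed

text \<open>The integral of \<open>\<nu> r / r\<close> may diverge at 0, so the three terms cannot
  be separated on the whole interval. Above a cutoff \<epsilon> the integral \<open>N\<close> of the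
  subtracted term is finite; since the weights \<open>l\<close> and \<open>1 - l\<close> add up to
  1, it cancels exactly and only the overhangs remain. Their bound is uniform in \<epsilon>, so
  monotone convergence removes the cutoff.\<close>

lemma nn_integral_telescoping:
  fixes \<nu> :: "real \<Rightarrow> real"
  assumes [measurable]: "\<nu> \<in> borel_measurable borel"
    and \<nu>: "\<And>r. 0 < r \<Longrightarrow> r < 1 \<Longrightarrow> 0 \<le> \<nu> r \<and> \<nu> r \<le> B"
    and l: "0 < l" "l < 1"
    and sub: "\<And>r. 0 < r \<Longrightarrow> r < 1 \<Longrightarrow> \<nu> r \<le> l * \<nu> (l * r) + (1 - l) * \<nu> ((1 - l) * r)"
  shows "(\<integral>\<^sup>+r. ennreal ((l * \<nu> (l * r) + (1 - l) * \<nu> ((1 - l) * r) - \<nu> r) / r) * indicator {0<..<1} r \<partial>lborel)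
     \<le> ennreal (B * (l * ln (1 / l) + (1 - l) * ln (1 / (1 - l))))"
    (is "nn_integral _ ?h \<le> ?R")
proof -
  have B: "B \<ge> 0" using \<nu>[OF l] by linarith
  define A where "A r = (l * \<nu> (l * r) + (1 - l) * \<nu> ((1 - l) * r) - \<nu> r) / r" for r
  have [measurable]: "A \<in> borel_measurable borel" unfolding A_def by measurable
  have trunc: "(\<integral>\<^sup>+r. ennreal (A r) * indicator {\<epsilon><..<1} r \<partial>lborel) \<le> ?R" if \<epsilon>: "0 < \<epsilon>" "\<epsilon> < 1" for \<epsilon>
  proof -
    define N where "N = (\<integral>\<^sup>+r. ennreal (\<nu> r / r) * indicator {\<epsilon><..<1} r \<partial>lborel)"
    define X where "X \<mu> = (\<integral>\<^sup>+r. ennreal (\<nu> (\<mu> * r) / r) * indicator {\<epsilon><..<1} r \<partial>lborel)" for \<mu>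
    have X: "X \<mu> \<le> ennreal (B * ln (1 / \<mu>)) + N" if "0 < \<mu>" "\<mu> < 1" for \<mu>
      unfolding X_def N_def by (rule nn_integral_dilated_average) (use \<nu> that \<epsilon> in auto)
    have "N \<le> (\<integral>\<^sup>+r. ennreal (B / \<epsilon>) * indicator {\<epsilon><..<1} r \<partial>lborel)"
      unfolding N_def
    proof (rule nn_integral_mono)
      fix r :: real
      show "ennreal (\<nu> r / r) * indicator {\<epsilon><..<1} r \<le> ennreal (B / \<epsilon>) * indicator {\<epsilon><..<1} r"
      proof (cases "r \<in> {\<epsilon><..<1}")
        case True
        then have "\<nu> r / r \<le> B / \<epsilon>" using \<nu>[of r] \<epsilon> B by (intro frac_le) auto
        then show ?thesis by (simp add: ennreal_leI mult_right_mono)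
      qed simp
    qed
    also have "\<dots> < \<infinity>" using \<epsilon> by (simp add: nn_integral_cmult ennreal_mult_less_top)
    \<comment> \<open>Finiteness allows \<open>N\<close> to be added to both sides, in place of a
      subtraction in \<open>ennreal\<close>, and to be cancelled at the end.\<close>
    finally have N: "N < \<infinity>" .
    have "(\<integral>\<^sup>+r. ennreal (A r) * indicator {\<epsilon><..<1} r \<partial>lborel) + N
       = (\<integral>\<^sup>+r. ennreal (A r) * indicator {\<epsilon><..<1} r + ennreal (\<nu> r / r) * indicator {\<epsilon><..<1} r \<partial>lborel)"
      unfolding N_def by (rule nn_integral_add[symmetric]) measurable
    also have "\<dots> = (\<integral>\<^sup>+r. ennreal l * (ennreal (\<nu> (l * r) / r) * indicator {\<epsilon><..<1} r)
         + ennreal (1 - l) * (ennreal (\<nu> ((1 - l) * r) / r) * indicator {\<epsilon><..<1} r) \<partial>lborel)"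
    proof (rule nn_integral_cong)
      fix r :: real
      show "ennreal (A r) * indicator {\<epsilon><..<1} r + ennreal (\<nu> r / r) * indicator {\<epsilon><..<1} r
        = ennreal l * (ennreal (\<nu> (l * r) / r) * indicator {\<epsilon><..<1} r)
         + ennreal (1 - l) * (ennreal (\<nu> ((1 - l) * r) / r) * indicator {\<epsilon><..<1} r)"
      proof (cases "r \<in> {\<epsilon><..<1}")
        case True
        then have r: "0 < r" "r < 1" using \<epsilon> by auto
        have lr: "0 < l * r" "l * r < 1" "0 < (1 - l) * r" "(1 - l) * r < 1"
          using r l mult_strict_mono[of l 1 r 1] mult_strict_mono[of "1 - l" 1 r 1] by auto
        have nn: "0 \<le> A r" "0 \<le> \<nu> r / r" "0 \<le> \<nu> (l * r) / r" "0 \<le> \<nu> ((1 - l) * r) / r"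
          using sub[OF r] \<nu>[OF r] \<nu>[OF lr(1,2)] \<nu>[OF lr(3,4)] r by (auto simp: A_def)
        have eq: "A r + \<nu> r / r = l * (\<nu> (l * r) / r) + (1 - l) * (\<nu> ((1 - l) * r) / r)"
          using r by (simp add: A_def field_simps)
        have "ennreal (A r) + ennreal (\<nu> r / r)
            = ennreal (l * (\<nu> (l * r) / r)) + ennreal ((1 - l) * (\<nu> ((1 - l) * r) / r))"
          unfolding ennreal_plus[OF nn(1,2), symmetric] eq
          by (rule ennreal_plus) (use l nn in \<open>auto intro!: mult_nonneg_nonneg simp del: times_divide_eq_right\<close>)
        then show ?thesis using True l by (simp add: ennreal_mult' del: times_divide_eq_right)
      qed simp
    qed
    also have "\<dots> = ennreal l * X l + ennreal (1 - l) * X (1 - l)"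
      unfolding X_def by (simp add: nn_integral_add nn_integral_cmult)
    also have "\<dots> \<le> ennreal l * (ennreal (B * ln (1 / l)) + N) + ennreal (1 - l) * (ennreal (B * ln (1 / (1 - l))) + N)"
      using l by (intro add_mono mult_left_mono X) auto
    also have "\<dots> = (ennreal l * ennreal (B * ln (1 / l)) + ennreal (1 - l) * ennreal (B * ln (1 / (1 - l)))) + (ennreal l + ennreal (1 - l)) * N"
      by (simp add: algebra_simps)
    also have "ennreal l + ennreal (1 - l) = 1" using l by (simp flip: ennreal_plus)
    also have "ennreal l * ennreal (B * ln (1 / l)) + ennreal (1 - l) * ennreal (B * ln (1 / (1 - l))) = ?R"
    proof -
      have nn: "0 \<le> l * (B * ln (1 / l))" "0 \<le> (1 - l) * (B * ln (1 / (1 - l)))"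
        using l B by (auto intro!: mult_nonneg_nonneg)
      have "ennreal l * ennreal (B * ln (1 / l)) + ennreal (1 - l) * ennreal (B * ln (1 / (1 - l)))
          = ennreal (l * (B * ln (1 / l)) + (1 - l) * (B * ln (1 / (1 - l))))"
        unfolding ennreal_plus[OF nn] using l by (simp add: ennreal_mult')
      then show ?thesis by (simp add: algebra_simps)
    qed
    finally show ?thesis using N by (auto simp: add.commute ennreal_add_left_cancel_le)
  qed
  define \<epsilon> where "\<epsilon> m = 1 / real (m + 2)" for m
  have \<epsilon>: "0 < \<epsilon> m" "\<epsilon> m < 1" for m by (auto simp: \<epsilon>_def)
  have "(\<lambda>r. ennreal (A r) * indicator {0<..<1} r) = (\<lambda>r. SUP m. ennreal (A r) * indicator {\<epsilon> m<..<1} r)"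
  proof
    fix r :: real
    show "ennreal (A r) * indicator {0<..<1} r = (SUP m. ennreal (A r) * indicator {\<epsilon> m<..<1} r)"
    proof (cases "r \<in> {0<..<1}")
      case True
      then obtain m where "1 / real (Suc m) < r" using reals_Archimedean[of r] by (auto simp: inverse_eq_divide)
      moreover have "\<epsilon> m < 1 / real (Suc m)" by (simp add: \<epsilon>_def field_simps)
      ultimately have "r \<in> {\<epsilon> m<..<1}" using True by auto
      then have "ennreal (A r) \<le> (SUP m. ennreal (A r) * indicator {\<epsilon> m<..<1} r)"
        by (intro SUP_upper2[of m]) auto
      moreover have "(SUP m. ennreal (A r) * indicator {\<epsilon> m<..<1} r) \<le> ennreal (A r)"
        by (intro SUP_least) (auto simp: indicator_def)
      ultimately show ?thesis using True by simp
    next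
      case False
      then have "r \<notin> {\<epsilon> m<..<1}" for m using \<epsilon>[of m] by auto
      then show ?thesis using False by simp
    qed
  qed
  then have "nn_integral lborel ?h = (\<integral>\<^sup>+r. (SUP m. ennreal (A r) * indicator {\<epsilon> m<..<1} r) \<partial>lborel)"
    by (simp add: A_def)
  also have "\<dots> = (SUP m. \<integral>\<^sup>+r. ennreal (A r) * indicator {\<epsilon> m<..<1} r \<partial>lborel)"
  proof (rule nn_integral_monotone_convergence_SUP)
    show "incseq (\<lambda>m r. ennreal (A r) * indicator {\<epsilon> m<..<1} r)"
    proof (intro incseq_SucI le_funI mult_left_mono)
      fix m r
      have "\<epsilon> (Suc m) \<le> \<epsilon> m" by (simp add: \<epsilon>_def field_simps)
      then show "indicator {\<epsilon> m<..<1} r \<le> (indicator {\<epsilon> (Suc m)<..<1} r :: ennreal)"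
        by (auto simp: indicator_def)
    qed auto
  qed measurable
  also have "\<dots> \<le> ?R"
    by (intro SUP_least trunc \<epsilon>)
  finally show ?thesis .
qed

text \<open>The inequality ln y <= y - 1 is used at 1 / sqrt l. At 1 / l it would leave the
  non-integrable singularity 1 / l; the square root makes it integrable, and the factor
  \<open>1 - l\<close> will cancel a pole at \<open>l = 1\<close>.\<close>

lemma ln_inverse_le:
  fixes l :: real
  assumes "0 < l" "l < 1"
  shows "ln (1 / l) \<le> 2 * (1 - l) * l powr (-1/2)"
proof -
  have s: "0 < sqrt l" "l \<le> sqrt l" using assms by (auto simp: real_le_rsqrt power2_eq_square mult_le_one)
  have "ln (1 / l) = 2 * ln (1 / sqrt l)"
    using assms by (simp add: ln_div ln_sqrt)
  also have "\<dots> \<le> 2 * (1 / sqrt l - 1)"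
    using s ln_le_minus_one[of "1 / sqrt l"] by simp
  also have "\<dots> = 2 * (1 - sqrt l) * (1 / sqrt l)" using s by (simp add: field_simps)
  also have "\<dots> \<le> 2 * (1 - l) * (1 / sqrt l)" using s by (intro mult_right_mono) auto
  also have "1 / sqrt l = l powr (-1/2)"
    using assms by (simp add: powr_minus_divide powr_half_sqrt)
  finally show ?thesis .
qed


section \<open>Squared increments and ordered triples\<close>

definition incr_sq :: "(real \<Rightarrow> real) \<Rightarrow> real \<Rightarrow> real" where
  "incr_sq F u = (\<integral>x. (F (x + u) - F x)\<^sup>2 \<partial>lborel)"

lemma incr_sq_nonneg: "0 \<le> incr_sq F u"
  by (simp add: incr_sq_def)

lemma incr_sq_measurable [measurable]:
  assumes [measurable]: "F \<in> borel_measurable borel"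
  shows "incr_sq F \<in> borel_measurable borel"
  unfolding incr_sq_def[abs_def] by measurable

lemma lipschitz_borel_measurable:
  fixes F :: "real \<Rightarrow> real"
  assumes "\<And>x y. \<bar>F x - F y\<bar> \<le> L * \<bar>x - y\<bar>"
  shows "F \<in> borel_measurable borel"
proof -
  have "L \<ge> 0" using assms[of 0 1] by simp
  then have "L-lipschitz_on UNIV F"
    using assms by (intro lipschitz_onI) (auto simp: dist_real_def)
  then show ?thesis
    by (intro borel_measurable_continuous_onI lipschitz_on_continuous_on)
qed

lemma lipschitz_incr_integrable:
  fixes F :: "real \<Rightarrow> real"
  assumes lip: "\<And>x y. \<bar>F x - F y\<bar> \<le> L * \<bar>x - y\<bar>"
    and supp: "\<And>x. \<bar>x\<bar> > P \<Longrightarrow> F x = 0" and P: "P \<ge> 0" and u: "0 \<le> u" "u \<le> 1"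
  shows "integrable lborel (\<lambda>x. (F (x + u) - F x)\<^sup>2)"
    and "incr_sq F u \<le> (L * u)\<^sup>2 * (2 * P + 2)"
proof -
  note [measurable] = lipschitz_borel_measurable[OF lip]
  have bnd: "(F (x + u) - F x)\<^sup>2 \<le> (L * u)\<^sup>2 * indicator {-P-1..P+1} x" for x
  proof (cases "x \<in> {-P-1..P+1}")
    case True
    have "\<bar>F (x + u) - F x\<bar> \<le> \<bar>L * u\<bar>" using lip[of "x + u" x] u by simp
    then show ?thesis using True by (simp add: abs_le_square_iff)
  next
    case False
    then have "F (x + u) = 0" "F x = 0" using u by (auto intro!: supp)
    then show ?thesis by simp
  qed
  have int: "integrable lborel (\<lambda>x. (L * u)\<^sup>2 * indicator {-P-1..P+1::real} x :: real)"
    by (intro integrable_mult_right integrable_real_indicator) (auto simp: emeasure_lborel_Icc_eq)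
  show i: "integrable lborel (\<lambda>x. (F (x + u) - F x)\<^sup>2)"
    by (rule Bochner_Integration.integrable_bound[OF int]) (use bnd in auto)
  have "incr_sq F u \<le> (\<integral>x. (L * u)\<^sup>2 * indicator {-P-1..P+1::real} x \<partial>lborel)"
    unfolding incr_sq_def by (rule integral_mono[OF i int bnd])
  also have "\<dots> = (L * u)\<^sup>2 * (2 * P + 2)" using P by simp
  finally show "incr_sq F u \<le> (L * u)\<^sup>2 * (2 * P + 2)" .
qed

text \<open>For increments \<open>a\<close> and \<open>b\<close> over gaps \<open>u\<close> and
  \<open>v\<close>, the bracket is \<open>u + v\<close> times the variance of the slopes
  \<open>a / u\<close> and \<open>b / v\<close> under weights proportional to \<open>u\<close> and
  \<open>v\<close>. The square thus becomes a combination of squared increments alone, without mixed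
  products.\<close>

lemma second_dd_square_identity:
  assumes "u > 0" "v > 0"
  shows "(second_dd F x (x + u) (x + (u + v)))\<^sup>2
    = ((F (x + u) - F x)\<^sup>2 / u + (F (x + u + v) - F (x + u))\<^sup>2 / v - (F (x + (u + v)) - F x)\<^sup>2 / (u + v))
       / (u * v * (u + v))"
proof -
  define a b where "a = F (x + u) - F x" and "b = F (x + u + v) - F (x + u)"
  have ab: "F (x + (u + v)) - F x = a + b" by (simp add: a_def b_def add.assoc)
  have "second_dd F x (x + u) (x + (u + v)) = (a / u - (a + b) / (u + v)) / (- v)"
    unfolding second_dd_def ab by (simp add: a_def)
  also have "\<dots> = (b * u - a * v) / (u * v * (u + v))"
    using assms by (simp add: divide_simps) (simp add: algebra_simps)
  finally have "(second_dd F x (x + u) (x + (u + v)))\<^sup>2 = (b * u - a * v)\<^sup>2 / (u * v * (u + v))\<^sup>2"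
    by (simp add: power_divide)
  also have "\<dots> = (a\<^sup>2 / u + b\<^sup>2 / v - (a + b)\<^sup>2 / (u + v)) / (u * v * (u + v))"
  proof -
    have "(a\<^sup>2 / u + b\<^sup>2 / v - (a + b)\<^sup>2 / w) * (u * v * w) = a\<^sup>2 * v * w + b\<^sup>2 * u * w - (a + b)\<^sup>2 * u * v"
      if "w > 0" for w
      using assms that by (simp add: field_simps)
    from this[of "u + v"]
    have "(b * u - a * v)\<^sup>2 = (a\<^sup>2 / u + b\<^sup>2 / v - (a + b)\<^sup>2 / (u + v)) * (u * v * (u + v))"
      using assms by (simp add: algebra_simps power2_eq_square)
    then show ?thesis using assms by (simp add: power2_eq_square)
  qed
  finally show ?thesis unfolding ab a_def b_def .
qed

text \<open>By translation invariance the increment over the second gap integrates to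
  \<open>incr_sq F v\<close>. The second claim, which will make the telescoped integrand
  nonnegative, comes for free from the integral of a square.\<close>

lemma nn_integral_second_dd_square:
  fixes F :: "real \<Rightarrow> real"
  assumes lip: "\<And>x y. \<bar>F x - F y\<bar> \<le> L * \<bar>x - y\<bar>"
    and supp: "\<And>x. \<bar>x\<bar> > P \<Longrightarrow> F x = 0" and P: "P \<ge> 0" and uv: "0 < u" "0 < v" "u + v \<le> 1"
  shows "(\<integral>\<^sup>+x. ennreal ((second_dd F x (x + u) (x + (u + v)))\<^sup>2) \<partial>lborel)
    = ennreal ((incr_sq F u / u + incr_sq F v / v - incr_sq F (u + v) / (u + v)) / (u * v * (u + v)))"
    and "0 \<le> incr_sq F u / u + incr_sq F v / v - incr_sq F (u + v) / (u + v)"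
proof -
  note int = lipschitz_incr_integrable(1)[OF lip supp P]
  have iu: "integrable lborel (\<lambda>x. (F (x + u) - F x)\<^sup>2)" and iv: "integrable lborel (\<lambda>x. (F (x + v) - F x)\<^sup>2)"
    and iuv: "integrable lborel (\<lambda>x. (F (x + (u + v)) - F x)\<^sup>2)"
    using uv by (auto intro!: int)
  have iv': "integrable lborel (\<lambda>x. (F (x + u + v) - F (x + u))\<^sup>2)"
    using lborel_integrable_real_affine[OF iv, of 1 u] by (simp add: ac_simps)
  have eqv: "(\<integral>x. (F (x + u + v) - F (x + u))\<^sup>2 \<partial>lborel) = incr_sq F v"
    using lborel_integral_real_affine[of 1 "\<lambda>x. (F (x + v) - F x)\<^sup>2" u] by (simp add: incr_sq_def ac_simps)
  let ?D = "\<lambda>x. (second_dd F x (x + u) (x + (u + v)))\<^sup>2"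
  have D: "?D = (\<lambda>x. ((F (x + u) - F x)\<^sup>2 / u + (F (x + u + v) - F (x + u))\<^sup>2 / v - (F (x + (u + v)) - F x)\<^sup>2 / (u + v))
       / (u * v * (u + v)))"
    using second_dd_square_identity[OF uv(1,2)] by blast
  have i: "integrable lborel ?D"
    unfolding D using iu iv' iuv by auto
  have I: "(\<integral>x. ?D x \<partial>lborel) = (incr_sq F u / u + incr_sq F v / v - incr_sq F (u + v) / (u + v)) / (u * v * (u + v))"
    unfolding D using iu iv' iuv by (simp add: eqv) (simp add: incr_sq_def)
  show "(\<integral>\<^sup>+x. ennreal (?D x) \<partial>lborel)
    = ennreal ((incr_sq F u / u + incr_sq F v / v - incr_sq F (u + v) / (u + v)) / (u * v * (u + v)))"
    unfolding I[symmetric] by (rule nn_integral_eq_integral[OF i]) simp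
  have "0 \<le> (\<integral>x. ?D x \<partial>lborel)" by simp
  then show "0 \<le> incr_sq F u / u + incr_sq F v / v - incr_sq F (u + v) / (u + v)"
    unfolding I using uv pos_le_divide_eq[of "u * v * (u + v)" 0] by simp
qed


lemma nn_integral_lborel_scale:
  fixes f :: "real \<Rightarrow> ennreal"
  assumes [measurable]: "f \<in> borel_measurable borel" and r: "r > 0"
  shows "(\<integral>\<^sup>+u. f u \<partial>lborel) = (\<integral>\<^sup>+l. ennreal r * f (r * l) \<partial>lborel)"
  using nn_integral_real_affine[of f r 0] r by (simp add: nn_integral_cmult)

text \<open>The gaps \<open>u = y - x\<close> and \<open>v = z - y\<close> replace \<open>y\<close>
  and \<open>z\<close>, then \<open>x\<close> is integrated out, and finally the diameter
  \<open>r = u + v\<close> and the ratio \<open>l = u / r\<close> become the variables. The separate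
  factor \<open>r\<close> is the Jacobian.\<close>

lemma nn_integral_ordered_triples:
  fixes F :: "real \<Rightarrow> real"
  assumes lip: "\<And>x y. \<bar>F x - F y\<bar> \<le> L * \<bar>x - y\<bar>"
    and supp: "\<And>x. \<bar>x\<bar> > P \<Longrightarrow> F x = 0" and P: "P \<ge> 0"
  defines "H \<equiv> \<lambda>u v. (incr_sq F u / u + incr_sq F v / v - incr_sq F (u + v) / (u + v)) / (u * v * (u + v))"
  shows "(\<integral>\<^sup>+x. \<integral>\<^sup>+y. \<integral>\<^sup>+z. (if x < y \<and> y < z \<and> z < x + 1 then ennreal ((second_dd F x y z)\<^sup>2) else 0)
            \<partial>lborel \<partial>lborel \<partial>lborel)
       = (\<integral>\<^sup>+l. \<integral>\<^sup>+r. (if 0 < l \<and> l < 1 \<and> 0 < r \<and> r < 1 then ennreal r * ennreal (H (r * l) (r - r * l)) else 0) \<partial>lborel \<partial>lborel)"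
proof -
  note [measurable] = lipschitz_borel_measurable[OF lip]
  have [measurable (raw)]: "(\<lambda>p. H (f p) (g p)) \<in> borel_measurable M"
    if [measurable]: "f \<in> borel_measurable M" "g \<in> borel_measurable M" for f g and M :: "'b measure"
    unfolding H_def by measurable
  define Q :: "real \<times> real \<times> real \<Rightarrow> ennreal" where
    "Q = (\<lambda>(x, u, v). if 0 < u \<and> 0 < v \<and> u + v < 1 then ennreal ((second_dd F x (x + u) (x + (u + v)))\<^sup>2) else 0)"
  have Q[measurable]: "Q \<in> borel_measurable (borel \<Otimes>\<^sub>M borel \<Otimes>\<^sub>M borel)"
    unfolding Q_def by measurable
  define R :: "real \<times> real \<times> real \<Rightarrow> ennreal" where "R = (\<lambda>p. Q (fst (snd p), fst p, snd (snd p)))"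
  have R[measurable]: "R \<in> borel_measurable (borel \<Otimes>\<^sub>M borel \<Otimes>\<^sub>M borel)"
    unfolding R_def
    by (intro measurable_compose[OF _ Q] measurable_Pair measurable_compose[OF measurable_snd measurable_fst]
        measurable_fst measurable_compose[OF measurable_snd measurable_snd])
  have 1: "(\<integral>\<^sup>+y. \<integral>\<^sup>+z. (if x < y \<and> y < z \<and> z < x + 1 then ennreal ((second_dd F x y z)\<^sup>2) else 0) \<partial>lborel \<partial>lborel)
      = (\<integral>\<^sup>+u. \<integral>\<^sup>+v. Q (x, u, v) \<partial>lborel \<partial>lborel)" for x
  proof -
    have "(\<integral>\<^sup>+y. \<integral>\<^sup>+z. (if x < y \<and> y < z \<and> z < x + 1 then ennreal ((second_dd F x y z)\<^sup>2) else 0) \<partial>lborel \<partial>lborel)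
      = (\<integral>\<^sup>+u. \<integral>\<^sup>+z. (if x < x + u \<and> x + u < z \<and> z < x + 1 then ennreal ((second_dd F x (x + u) z)\<^sup>2) else 0) \<partial>lborel \<partial>lborel)"
      by (rule nn_integral_lborel_shift[symmetric]) measurable
    also have "\<dots> = (\<integral>\<^sup>+u. \<integral>\<^sup>+v. (if x < x + u \<and> x + u < (x + u) + v \<and> (x + u) + v < x + 1 then ennreal ((second_dd F x (x + u) ((x + u) + v))\<^sup>2) else 0) \<partial>lborel \<partial>lborel)"
      by (intro nn_integral_cong nn_integral_lborel_shift[symmetric]) measurable
    also have "\<dots> = (\<integral>\<^sup>+u. \<integral>\<^sup>+v. Q (x, u, v) \<partial>lborel \<partial>lborel)"
      by (intro nn_integral_cong) (auto simp: Q_def indicator_def add.assoc)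
    finally show ?thesis .
  qed
  define W where "W u v = (if 0 < u \<and> 0 < v \<and> u + v < 1 then ennreal (H u v) else 0)" for u v
  have [measurable (raw)]: "(\<lambda>p. W (f p) (g p)) \<in> borel_measurable M"
    if [measurable]: "f \<in> borel_measurable M" "g \<in> borel_measurable M" for f g and M :: "'b measure"
    unfolding W_def by measurable
  have 2: "(\<integral>\<^sup>+x. Q (x, u, v) \<partial>lborel) = W u v" for u v
  proof (cases "0 < u \<and> 0 < v \<and> u + v < 1")
    case True
    then show ?thesis
      using nn_integral_second_dd_square(1)[OF lip supp P, of u v] by (simp add: Q_def W_def H_def)
  next
    case False
    then show ?thesis unfolding Q_def W_def prod.case if_not_P[OF False] by simp
  qed
  have "(\<integral>\<^sup>+x. \<integral>\<^sup>+u. \<integral>\<^sup>+v. Q (x, u, v) \<partial>lborel \<partial>lborel \<partial>lborel) = (\<integral>\<^sup>+u. \<integral>\<^sup>+x. \<integral>\<^sup>+v. R (u, x, v) \<partial>lborel \<partial>lborel \<partial>lborel)"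
    using nn_integral_triple_swap12[OF Q] by (simp add: R_def)
  also have "\<dots> = (\<integral>\<^sup>+u. \<integral>\<^sup>+v. \<integral>\<^sup>+x. R (u, x, v) \<partial>lborel \<partial>lborel \<partial>lborel)"
    using nn_integral_triple_swap23[OF R] by simp
  also have "\<dots> = (\<integral>\<^sup>+u. \<integral>\<^sup>+v. W u v \<partial>lborel \<partial>lborel)"
    by (simp add: R_def 2)
  also have "\<dots> = (\<integral>\<^sup>+u. \<integral>\<^sup>+r. W u (- u + r) \<partial>lborel \<partial>lborel)"
    by (rule nn_integral_cong, rule nn_integral_lborel_shift[symmetric]) measurable
  also have "\<dots> = (\<integral>\<^sup>+r. \<integral>\<^sup>+u. W u (- u + r) \<partial>lborel \<partial>lborel)"
    by (rule lborel_pair.Fubini') measurable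
  also have "\<dots> = (\<integral>\<^sup>+r. \<integral>\<^sup>+l. (if 0 < l \<and> l < 1 \<and> 0 < r \<and> r < 1 then ennreal r * ennreal (H (r * l) (r - r * l)) else 0) \<partial>lborel \<partial>lborel)"
  proof (rule nn_integral_cong)
    fix r :: real
    show "(\<integral>\<^sup>+u. W u (- u + r) \<partial>lborel) = (\<integral>\<^sup>+l. (if 0 < l \<and> l < 1 \<and> 0 < r \<and> r < 1 then ennreal r * ennreal (H (r * l) (r - r * l)) else 0) \<partial>lborel)"
    proof (cases "0 < r")
      case True
      have "(\<integral>\<^sup>+u. W u (- u + r) \<partial>lborel) = (\<integral>\<^sup>+l. ennreal r * W (r * l) (- (r * l) + r) \<partial>lborel)"
        by (rule nn_integral_lborel_scale[OF _ True]) measurable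
      also have "\<dots> = (\<integral>\<^sup>+l. (if 0 < l \<and> l < 1 \<and> 0 < r \<and> r < 1 then ennreal r * ennreal (H (r * l) (r - r * l)) else 0) \<partial>lborel)"
        using True by (intro nn_integral_cong) (auto simp: W_def indicator_def zero_less_mult_iff)
      finally show ?thesis .
    next
      case False
      then have "W u (- u + r) = 0" for u by (simp add: W_def)
      then show ?thesis using False by simp
    qed
  qed
  also have "\<dots> = (\<integral>\<^sup>+l. \<integral>\<^sup>+r. (if 0 < l \<and> l < 1 \<and> 0 < r \<and> r < 1 then ennreal r * ennreal (H (r * l) (r - r * l)) else 0) \<partial>lborel \<partial>lborel)"
    by (rule lborel_pair.Fubini') measurable
  finally show ?thesis by (simp only: 1)
qed

text \<open>The weight \<open>1 / (l * (1 - l))\<close> produced by the divided differences is not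
  integrable in \<open>l\<close>. The bound of \<open>nn_integral_telescoping\<close>, an entropy in
  \<open>l\<close>, vanishes at both ends and compensates for it, leaving inverse square
  roots.\<close>

lemma lipschitz_ordered_triples_finite:
  fixes F :: "real \<Rightarrow> real"
  assumes lip: "\<And>x y. \<bar>F x - F y\<bar> \<le> L * \<bar>x - y\<bar>"
    and supp: "\<And>x. \<bar>x\<bar> > P \<Longrightarrow> F x = 0" and P: "P \<ge> 0"
  shows "(\<integral>\<^sup>+x. \<integral>\<^sup>+y. \<integral>\<^sup>+z. (if x < y \<and> y < z \<and> z < x + 1 then ennreal ((second_dd F x y z)\<^sup>2) else 0)
            \<partial>lborel \<partial>lborel \<partial>lborel) < \<infinity>"
proof -
  note [measurable] = lipschitz_borel_measurable[OF lip]
  define \<nu> where "\<nu> r = incr_sq F r / r\<^sup>2" for r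
  define B where "B = L\<^sup>2 * (2 * P + 2)"
  have [measurable]: "\<nu> \<in> borel_measurable borel" unfolding \<nu>_def by measurable
  have B: "B \<ge> 0" using P by (simp add: B_def)
  have \<nu>: "0 \<le> \<nu> r \<and> \<nu> r \<le> B" if "0 < r" "r < 1" for r
    using lipschitz_incr_integrable(2)[OF lip supp P, of r] that incr_sq_nonneg[of F r]
    by (simp add: \<nu>_def B_def field_simps)
  define A where "A l r = (l * \<nu> (l * r) + (1 - l) * \<nu> ((1 - l) * r) - \<nu> r) / r" for l r
  let ?H = "\<lambda>u v. (incr_sq F u / u + incr_sq F v / v - incr_sq F (u + v) / (u + v)) / (u * v * (u + v))"
  have inner: "(\<integral>\<^sup>+r. (if 0 < l \<and> l < 1 \<and> 0 < r \<and> r < 1 then ennreal r * ennreal (?H (r * l) (r - r * l)) else 0) \<partial>lborel)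
     \<le> ennreal (2 * B) * (ennreal (l powr (-1/2)) * indicator {0<..<1} l) + ennreal (2 * B) * (ennreal ((1 - l) powr (-1/2)) * indicator {0<..<1} (1 - l))" for l
  proof (cases "0 < l \<and> l < 1")
    case True
    then have l: "0 < l" "l < 1" by auto
    have num: "incr_sq F (r * l) / (r * l) + incr_sq F (r - r * l) / (r - r * l) - incr_sq F r / r = r * (l * \<nu> (l * r) + (1 - l) * \<nu> ((1 - l) * r) - \<nu> r)"
      if "0 < r" for r
    proof -
      have *: "incr_sq F s / s = s * \<nu> s" for s by (simp add: \<nu>_def power2_eq_square)
      have "r - r * l = (1 - l) * r" by (simp add: algebra_simps)
      then show ?thesis unfolding * by (simp add: algebra_simps)
    qed
    \<comment> \<open>The powers of the diameter combine to 1 / r: one factor from the Jacobian and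
      one from the numerator, against three in the denominator.\<close>
    have pt: "r * ?H (r * l) (r - r * l) = (1 / (l * (1 - l))) * A l r" if "0 < r" for r
    proof -
      have "r * l + (r - r * l) = r" by simp
      moreover have "r * l * (r - r * l) * r = r ^ 3 * (l * (1 - l))" by (simp add: algebra_simps power3_eq_cube)
      ultimately have "?H (r * l) (r - r * l) = r * (l * \<nu> (l * r) + (1 - l) * \<nu> ((1 - l) * r) - \<nu> r) / (r ^ 3 * (l * (1 - l)))"
        by (simp only: num[OF that])
      then show ?thesis using that l by (simp add: A_def power3_eq_cube)
    qed
    have sub: "\<nu> r \<le> l * \<nu> (l * r) + (1 - l) * \<nu> ((1 - l) * r)" if r: "0 < r" "r < 1" for r
    proof -
      have "r * l < r * 1" using r l by (intro mult_strict_left_mono) auto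
      then have "0 \<le> incr_sq F (r * l) / (r * l) + incr_sq F (r - r * l) / (r - r * l) - incr_sq F (r * l + (r - r * l)) / (r * l + (r - r * l))"
        using r l by (intro nn_integral_second_dd_square(2)[OF lip supp P]) auto
      then have "0 \<le> r * (l * \<nu> (l * r) + (1 - l) * \<nu> ((1 - l) * r) - \<nu> r)"
        using num[OF r(1)] by simp
      then show ?thesis using r by (simp add: zero_le_mult_iff)
    qed
    have "(\<integral>\<^sup>+r. (if 0 < l \<and> l < 1 \<and> 0 < r \<and> r < 1 then ennreal r * ennreal (?H (r * l) (r - r * l)) else 0) \<partial>lborel)
       = (\<integral>\<^sup>+r. ennreal (1 / (l * (1 - l))) * (ennreal (A l r) * indicator {0<..<1} r) \<partial>lborel)"
    proof (rule nn_integral_cong)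
      fix r :: real
      have "ennreal r * ennreal (?H (r * l) (r - r * l)) = ennreal (1 / (l * (1 - l))) * ennreal (A l r)" if "0 < r"
        using l that by (simp only: ennreal_mult'[symmetric] pt less_imp_le zero_le_divide_1_iff zero_le_mult_iff diff_ge_0_iff_ge simp_thms)
      then show "(if 0 < l \<and> l < 1 \<and> 0 < r \<and> r < 1 then ennreal r * ennreal (?H (r * l) (r - r * l)) else 0)
          = ennreal (1 / (l * (1 - l))) * (ennreal (A l r) * indicator {0<..<1} r)"
        using l by (auto simp: indicator_def)
    qed
    also have "\<dots> = ennreal (1 / (l * (1 - l))) * (\<integral>\<^sup>+r. ennreal (A l r) * indicator {0<..<1} r \<partial>lborel)"
      by (rule nn_integral_cmult) (unfold A_def, measurable)
    also have "\<dots> \<le> ennreal (1 / (l * (1 - l))) * ennreal (B * (l * ln (1 / l) + (1 - l) * ln (1 / (1 - l))))"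
      unfolding A_def by (intro mult_left_mono nn_integral_telescoping \<nu> l sub) auto
    also have "\<dots> = ennreal (B * (ln (1 / l) / (1 - l) + ln (1 / (1 - l)) / l))"
    proof -
      have "1 / (l * (1 - l)) * (B * (l * ln (1 / l) + (1 - l) * ln (1 / (1 - l)))) = B * (ln (1 / l) / (1 - l) + ln (1 / (1 - l)) / l)"
        using l by (simp add: field_simps)
      then show ?thesis using l by (simp add: ennreal_mult'[symmetric])
    qed
    also have "\<dots> \<le> ennreal (B * (2 * l powr (-1/2) + 2 * (1 - l) powr (-1/2)))"
    proof -
      have "ln (1 / l) \<le> 2 * l powr (-1/2) * (1 - l)"
        using ln_inverse_le[OF l] by (simp only: mult_ac)
      then have "ln (1 / l) / (1 - l) \<le> 2 * l powr (-1/2)"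
        using l by (subst pos_divide_le_eq) simp_all
      moreover have "ln (1 / (1 - l)) \<le> 2 * (1 - l) powr (-1/2) * l"
        using ln_inverse_le[of "1 - l"] l by (simp add: mult_ac)
      then have "ln (1 / (1 - l)) / l \<le> 2 * (1 - l) powr (-1/2)"
        using l by (subst pos_divide_le_eq) simp_all
      ultimately show ?thesis using B by (intro ennreal_leI mult_left_mono add_mono)
    qed
    also have "\<dots> = ennreal (2 * B) * ennreal (l powr (-1/2)) + ennreal (2 * B) * ennreal ((1 - l) powr (-1/2))"
      using B by (simp add: ennreal_mult'[symmetric] distrib_left ac_simps flip: ennreal_plus)
    finally show ?thesis using l by (simp add: mult.assoc)
  next
    case False
    then have "(0 < l \<and> l < 1 \<and> 0 < r \<and> r < 1) = False" for r :: real by auto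
    then show ?thesis by (simp only: if_False nn_integral_const mult_zero_left zero_le)
  qed
  have fin: "(\<integral>\<^sup>+l. ennreal (l powr (-1/2)) * indicator {0<..<1} l \<partial>lborel) < \<infinity>"
    by (rule nn_integral_powr_unit) simp
  have fin': "(\<integral>\<^sup>+l. ennreal ((1 - l) powr (-1/2)) * indicator {0<..<1} (1 - l) \<partial>lborel) < \<infinity>"
    using fin nn_integral_real_affine[of "\<lambda>l. ennreal (l powr (-1/2)) * indicator {0<..<1} l" "-1" 1] by simp
  have "(\<integral>\<^sup>+x. \<integral>\<^sup>+y. \<integral>\<^sup>+z. (if x < y \<and> y < z \<and> z < x + 1 then ennreal ((second_dd F x y z)\<^sup>2) else 0)
            \<partial>lborel \<partial>lborel \<partial>lborel)
     \<le> (\<integral>\<^sup>+l. ennreal (2 * B) * (ennreal (l powr (-1/2)) * indicator {0<..<1} l) + ennreal (2 * B) * (ennreal ((1 - l) powr (-1/2)) * indicator {0<..<1} (1 - l)) \<partial>lborel)"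
    by (rule order_trans[OF eq_refl[OF nn_integral_ordered_triples[OF lip supp P]]], assumption) (intro nn_integral_mono inner)
  also have "\<dots> = ennreal (2 * B) * (\<integral>\<^sup>+l. ennreal (l powr (-1/2)) * indicator {0<..<1} l \<partial>lborel)
       + ennreal (2 * B) * (\<integral>\<^sup>+l. ennreal ((1 - l) powr (-1/2)) * indicator {0<..<1} (1 - l) \<partial>lborel)"
    by (simp add: nn_integral_add nn_integral_cmult)
  also have "\<dots> < \<infinity>"
    using fin fin' by (simp add: ennreal_mult_less_top)
  finally show ?thesis .
qed

text \<open>\<open>S\<close> carries the energy of increasing triples and \<open>S2\<close> to
  \<open>S6\<close> are its five rearrangements, all with the same integral. A triple with
  \<open>\<bar>y - x\<bar> + \<bar>z - x\<bar> < 1\<close> has diameter below 1, so one of the six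
  catches it; triples with coinciding points are negligible.\<close>

proposition lipschitz_energy_integrable:
  fixes F :: "real \<Rightarrow> real"
  assumes lip: "\<And>x y. \<bar>F x - F y\<bar> \<le> L * \<bar>x - y\<bar>"
    and supp: "\<And>x. \<bar>x\<bar> > P \<Longrightarrow> F x = 0" and P: "P \<ge> 0"
  shows "(\<integral>\<^sup>+x. quotient_energy F x \<partial>lborel) < \<infinity>"
proof -
  note [measurable] = lipschitz_borel_measurable[OF lip]
  let ?I = "\<lambda>P :: real \<times> real \<times> real \<Rightarrow> ennreal. \<integral>\<^sup>+x. \<integral>\<^sup>+y. \<integral>\<^sup>+z. P (x, y, z) \<partial>lborel \<partial>lborel \<partial>lborel"
  define S where "S = (\<lambda>(x, y, z). (if x < y \<and> y < z \<and> z < x + 1 then ennreal ((second_dd F x y z)\<^sup>2) else 0))"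
  define S2 where "S2 = (\<lambda>p. S (fst p, snd (snd p), fst (snd p)))"
  define S3 where "S3 = (\<lambda>p. S (fst (snd p), fst p, snd (snd p)))"
  define S4 where "S4 = (\<lambda>p. S3 (fst p, snd (snd p), fst (snd p)))"
  define S5 where "S5 = (\<lambda>p. S2 (fst (snd p), fst p, snd (snd p)))"
  define S6 where "S6 = (\<lambda>p. S5 (fst p, snd (snd p), fst (snd p)))"
  have S[measurable]: "S \<in> borel_measurable (borel \<Otimes>\<^sub>M borel \<Otimes>\<^sub>M borel)" unfolding S_def by measurable
  have S2[measurable]: "S2 \<in> borel_measurable (borel \<Otimes>\<^sub>M borel \<Otimes>\<^sub>M borel)" unfolding S2_def by (rule measurable_compose[OF _ S]) measurable
  have S3[measurable]: "S3 \<in> borel_measurable (borel \<Otimes>\<^sub>M borel \<Otimes>\<^sub>M borel)" unfolding S3_def by (rule measurable_compose[OF _ S]) measurable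
  have S4[measurable]: "S4 \<in> borel_measurable (borel \<Otimes>\<^sub>M borel \<Otimes>\<^sub>M borel)" unfolding S4_def by (rule measurable_compose[OF _ S3]) measurable
  have S5[measurable]: "S5 \<in> borel_measurable (borel \<Otimes>\<^sub>M borel \<Otimes>\<^sub>M borel)" unfolding S5_def by (rule measurable_compose[OF _ S2]) measurable
  have S6[measurable]: "S6 \<in> borel_measurable (borel \<Otimes>\<^sub>M borel \<Otimes>\<^sub>M borel)" unfolding S6_def by (rule measurable_compose[OF _ S5]) measurable
  have fin: "?I S < \<infinity>"
    using lipschitz_ordered_triples_finite[OF lip supp P] by (simp add: S_def)
  have eqs: "?I S2 = ?I S" "?I S3 = ?I S" "?I S4 = ?I S3" "?I S5 = ?I S2" "?I S6 = ?I S5"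
    using nn_integral_triple_swap23[OF S] nn_integral_triple_swap12[OF S]
      nn_integral_triple_swap23[OF S3] nn_integral_triple_swap12[OF S2] nn_integral_triple_swap23[OF S5]
    by (simp_all add: S2_def S3_def S4_def S5_def S6_def)
  have le: "ennreal ((second_dd F x y z)\<^sup>2) * indicator {z. \<bar>y - x\<bar> + \<bar>z - x\<bar> < 1} z
     \<le> S (x, y, z) + S2 (x, y, z) + S3 (x, y, z) + S4 (x, y, z) + S5 (x, y, z) + S6 (x, y, z)"
    if "x \<noteq> y" "y \<noteq> z" "x \<noteq> z" for x y z
  proof (cases "\<bar>y - x\<bar> + \<bar>z - x\<bar> < 1")
    case True
    let ?e = "ennreal ((second_dd F x y z)\<^sup>2)"
    have perms: "second_dd F x z y = second_dd F x y z" "second_dd F y x z = second_dd F x y z"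
      "second_dd F z x y = second_dd F x y z" "second_dd F y z x = second_dd F x y z" "second_dd F z y x = second_dd F x y z"
      using second_dd_swap12[of x y z F] second_dd_swap12[of x z y F] that
        second_dd_swap23[of F x y z] second_dd_swap23[of F y x z] second_dd_swap23[of F z x y] by auto
    have "x < y \<or> y < x" "y < z \<or> z < y" "x < z \<or> z < x" using that by auto
    then consider "x < y" "y < z" | "x < z" "z < y" | "y < x" "x < z" | "y < z" "z < x" | "z < x" "x < y" | "z < y" "y < x"
      by blast
    then have "S (x, y, z) = ?e \<or> S2 (x, y, z) = ?e \<or> S3 (x, y, z) = ?e \<or> S4 (x, y, z) = ?e \<or> S5 (x, y, z) = ?e \<or> S6 (x, y, z) = ?e"
      using True by cases (auto simp: S_def S2_def S3_def S4_def S5_def S6_def perms)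
    then have "?e \<le> S (x, y, z) + S2 (x, y, z) + S3 (x, y, z) + S4 (x, y, z) + S5 (x, y, z) + S6 (x, y, z)"
      by (auto intro: add_increasing add_increasing2)
    then show ?thesis using True by simp
  qed simp
  have "(\<integral>\<^sup>+x. quotient_energy F x \<partial>lborel) \<le> ?I (\<lambda>p. S p + S2 p + S3 p + S4 p + S5 p + S6 p)"
  proof (rule nn_integral_mono)
    fix x :: real
    show "quotient_energy F x \<le> (\<integral>\<^sup>+y. \<integral>\<^sup>+z. S (x, y, z) + S2 (x, y, z) + S3 (x, y, z) + S4 (x, y, z) + S5 (x, y, z) + S6 (x, y, z) \<partial>lborel \<partial>lborel)"
      unfolding quotient_energy_eq[OF lipschitz_borel_measurable[OF lip]]
    proof (rule nn_integral_mono_AE)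
      show "AE y in lborel. (\<integral>\<^sup>+z. ennreal ((second_dd F x y z)\<^sup>2) * indicator {z. \<bar>y - x\<bar> + \<bar>z - x\<bar> < 1} z \<partial>lborel)
        \<le> (\<integral>\<^sup>+z. S (x, y, z) + S2 (x, y, z) + S3 (x, y, z) + S4 (x, y, z) + S5 (x, y, z) + S6 (x, y, z) \<partial>lborel)"
        using AE_lborel_singleton[of x]
      proof eventually_elim
        case (elim y)
        show ?case
        proof (rule nn_integral_mono_AE)
          show "AE z in lborel. ennreal ((second_dd F x y z)\<^sup>2) * indicator {z. \<bar>y - x\<bar> + \<bar>z - x\<bar> < 1} z
            \<le> S (x, y, z) + S2 (x, y, z) + S3 (x, y, z) + S4 (x, y, z) + S5 (x, y, z) + S6 (x, y, z)"
            using AE_lborel_singleton[of x] AE_lborel_singleton[of y]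
            by eventually_elim (use elim in \<open>auto intro!: le\<close>)
        qed
      qed
    qed
  qed
  also have "\<dots> = ?I S + ?I S2 + ?I S3 + ?I S4 + ?I S5 + ?I S6"
    by (simp add: nn_integral_add)
  also have "\<dots> < \<infinity>" using fin by (simp add: eqs)
  finally show ?thesis .
qed

section \<open>Finite energy at points of differentiability\<close>

lemma nn_integral_inverse_square_tail:
  fixes a :: real
  assumes a: "a > 0"
  shows "(\<integral>\<^sup>+v. ennreal (1 / v\<^sup>2) * indicator {v. a \<le> \<bar>v\<bar>} v \<partial>lborel) = ennreal (2 / a)"
proof -
  have half: "(\<integral>\<^sup>+v. ennreal (1 / v\<^sup>2) * indicator {a..} v \<partial>lborel) = ennreal (0 - (- 1 / a))"
  proof (rule nn_integral_FTC_atLeast)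
    fix x :: real assume "a \<le> x"
    then have "x > 0" using a by simp
    then show "((\<lambda>x. - 1 / x) has_real_derivative 1 / x\<^sup>2) (at x)"
      by (auto intro!: derivative_eq_intros simp: power2_eq_square)
  next
    show "((\<lambda>x. - 1 / x :: real) \<longlongrightarrow> 0) at_top"
      by (intro tendsto_divide_0[OF tendsto_const] filterlim_at_top_imp_at_infinity filterlim_ident)
  qed auto
  have "(\<integral>\<^sup>+v. ennreal (1 / v\<^sup>2) * indicator {v. a \<le> \<bar>v\<bar>} v \<partial>lborel)
      = (\<integral>\<^sup>+v. ennreal (1 / v\<^sup>2) * indicator {a..} v + ennreal (1 / (- v)\<^sup>2) * indicator {a..} (- v) \<partial>lborel)"
    using a by (intro nn_integral_cong) (auto simp: indicator_def)
  also have "\<dots> = (\<integral>\<^sup>+v. ennreal (1 / v\<^sup>2) * indicator {a..} v \<partial>lborel) + (\<integral>\<^sup>+v. ennreal (1 / (- v)\<^sup>2) * indicator {a..} (- v) \<partial>lborel)"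
    by (rule nn_integral_add) measurable
  also have "(\<integral>\<^sup>+v. ennreal (1 / (- v)\<^sup>2) * indicator {a..} (- v) \<partial>lborel) = (\<integral>\<^sup>+v. ennreal (1 / v\<^sup>2) * indicator {a..} v \<partial>lborel)"
    using nn_integral_real_affine[of "\<lambda>v. ennreal (1 / v\<^sup>2) * indicator {a..} v" "-1" 0] by simp
  finally show ?thesis using a unfolding half by (simp flip: ennreal_plus)
qed

text \<open>The near part is a squared Hoelder quotient,
  \<open>(\<bar>v\<bar> powr (3/4 - 1))\<^sup>2\<close>; the far part comes from bounding two values
  separately. In the application \<open>v\<close> is \<open>(y - z) / d y\<close> with
  \<open>d y\<close> the distance to \<open>K\<close>, and integration over \<open>z\<close> yields
  a constant times \<open>d y\<close>, the numerator of a Marcinkiewicz integral. The value 0 at 0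
  matters: for \<open>d y = 0\<close> the argument is 0 by the convention for division.\<close>

definition marcinkiewicz_kernel :: "real \<Rightarrow> real" where
  "marcinkiewicz_kernel v = (if 1/2 \<le> \<bar>v\<bar> then 1 / v\<^sup>2 else \<bar>v\<bar> powr (-1/2))"

lemma marcinkiewicz_kernel_nonneg: "0 \<le> marcinkiewicz_kernel v"
  by (simp add: marcinkiewicz_kernel_def)

lemma marcinkiewicz_kernel_0 [simp]: "marcinkiewicz_kernel 0 = 0"
  by (simp add: marcinkiewicz_kernel_def)

lemma marcinkiewicz_kernel_measurable [measurable]: "marcinkiewicz_kernel \<in> borel_measurable borel"
  unfolding marcinkiewicz_kernel_def[abs_def] by measurable

lemma nn_integral_marcinkiewicz_kernel: "(\<integral>\<^sup>+v. ennreal (marcinkiewicz_kernel v) \<partial>lborel) < \<infinity>"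
proof -
  let ?p = "\<lambda>v::real. ennreal (v powr (-1/2)) * indicator {0<..<1} v"
  have fin: "(\<integral>\<^sup>+v. ?p v \<partial>lborel) < \<infinity>" by (rule nn_integral_powr_unit) simp
  have refl: "(\<integral>\<^sup>+v. ?p (- v) \<partial>lborel) = (\<integral>\<^sup>+v. ?p v \<partial>lborel)"
    using nn_integral_real_affine[of ?p "-1" 0] by simp
  have "(\<integral>\<^sup>+v. ennreal (marcinkiewicz_kernel v) \<partial>lborel)
    \<le> (\<integral>\<^sup>+v. ennreal (1 / v\<^sup>2) * indicator {v. 1/2 \<le> \<bar>v\<bar>} v + ?p v + ?p (- v) \<partial>lborel)"
  proof (rule nn_integral_mono)
    fix v :: real
    consider "1/2 \<le> \<bar>v\<bar>" | "0 < v" "v < 1/2" | "v < 0" "-1/2 < v" | "v = 0" by linarith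
    then show "ennreal (marcinkiewicz_kernel v) \<le> ennreal (1 / v\<^sup>2) * indicator {v. 1/2 \<le> \<bar>v\<bar>} v + ?p v + ?p (- v)"
      by cases (auto simp: marcinkiewicz_kernel_def add_increasing2)
  qed
  also have "\<dots> = (\<integral>\<^sup>+v. ennreal (1 / v\<^sup>2) * indicator {v. 1/2 \<le> \<bar>v\<bar>} v \<partial>lborel) + (\<integral>\<^sup>+v. ?p v \<partial>lborel) + (\<integral>\<^sup>+v. ?p (- v) \<partial>lborel)"
    by (simp add: nn_integral_add)
  also have "\<dots> < \<infinity>" unfolding refl using fin nn_integral_inverse_square_tail[of "1/2"] by simp
  finally show ?thesis .
qed

lemma nn_integral_marcinkiewicz_kernel_scaled:
  assumes "d \<ge> 0"
  shows "(\<integral>\<^sup>+z. ennreal (marcinkiewicz_kernel ((y - z) / d)) \<partial>lborel)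
    = ennreal d * (\<integral>\<^sup>+v. ennreal (marcinkiewicz_kernel v) \<partial>lborel)"
proof (cases "d = 0")
  case False
  then show ?thesis
    using assms nn_integral_real_affine[of "\<lambda>z. ennreal (marcinkiewicz_kernel ((y - z) / d))" "- d" y] by simp
qed simp

section \<open>Energy of a function dominated by the distance to a closed set\<close>

lemma power2_diff_le: "(a - b)\<^sup>2 \<le> 2 * a\<^sup>2 + 2 * b\<^sup>2" for a b :: real
  using zero_le_power2[of "a + b"] by (simp add: power2_eq_square algebra_simps)

text \<open>The gap between \<open>y\<close> and \<open>z\<close> is measured against
  \<open>d y\<close>, the larger of the two distances. If it is at least \<open>d y / 2\<close>,
  each value is bounded by \<open>A\<close> times its own distance. If it is smaller,
  \<open>zygmund_holder\<close> on the interval of length \<open>d y\<close> around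
  \<open>y\<close>, where \<open>\<bar>g\<bar> \<le> A * (3/2 * d y)\<close>, gives
  \<open>9 * A + 4 * c\<close>; the remaining \<open>A\<close> in the constant comes from
  \<open>g z / (z - x)\<close>.\<close>

lemma second_dd_whitney_bound:
  fixes g d :: "real \<Rightarrow> real"
  assumes zyg: "\<And>x h. \<bar>g (x + h) + g (x - h) - 2 * g x\<bar> \<le> c * \<bar>h\<bar>"
    and gd: "\<And>y. \<bar>g y\<bar> \<le> A * d y" and d0: "\<And>y. 0 \<le> d y" and dlip: "\<And>y z. d z \<le> d y + \<bar>y - z\<bar>"
    and A: "A \<ge> 0" and c: "c \<ge> 0"
    and gx: "g x = 0" and dx: "\<And>y. d y \<le> \<bar>y - x\<bar>"
    and ne: "x \<noteq> y" "x \<noteq> z" "y \<noteq> z" and le: "d z \<le> d y"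
  shows "(second_dd g x y z)\<^sup>2 \<le> 2 * (10 * A + 4 * c)\<^sup>2 *
     (marcinkiewicz_kernel ((y - z) / d y) / (y - x)\<^sup>2 + marcinkiewicz_kernel ((z - y) / d z) / (z - x)\<^sup>2)"
proof -
  define C where "C = 10 * A + 4 * c"
  have C: "0 \<le> C" "A \<le> C" using A c by (auto simp: C_def)
  let ?k = marcinkiewicz_kernel
  have rhs0: "0 \<le> 2 * C\<^sup>2 * (?k ((z - y) / d z) / (z - x)\<^sup>2)"
    by (intro mult_nonneg_nonneg divide_nonneg_nonneg marcinkiewicz_kernel_nonneg) auto
  have rhs1: "0 \<le> 2 * C\<^sup>2 * (?k ((y - z) / d y) / (y - x)\<^sup>2)"
    by (intro mult_nonneg_nonneg divide_nonneg_nonneg marcinkiewicz_kernel_nonneg) auto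
  have dd: "second_dd g x y z = (g y / (y - x) - g z / (z - x)) / (y - z)"
    by (simp add: second_dd_def gx)
  consider "d y = 0" | "d y > 0" "d y / 2 \<le> \<bar>y - z\<bar>" | "d y > 0" "\<bar>y - z\<bar> < d y / 2"
    using d0[of y] by linarith
  then have "(second_dd g x y z)\<^sup>2 \<le> 2 * C\<^sup>2 * (?k ((y - z) / d y) / (y - x)\<^sup>2 + ?k ((z - y) / d z) / (z - x)\<^sup>2)"
  proof cases
    case 1
    then have "d z = 0" using le d0[of z] by simp
    then have "g y = 0" "g z = 0" using 1 gd[of y] gd[of z] by auto
    then show ?thesis using rhs0 rhs1 by (simp add: dd distrib_left)
  next
    case 2
    \<comment> \<open>Stated once for both points: \<open>w\<close> stands for \<open>y\<close> or
      \<open>z\<close>, and \<open>u\<close> for the difference with the matching sign.\<close>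
    have far: "(g w / ((w - x) * (y - z)))\<^sup>2 \<le> C\<^sup>2 * (?k (u / d w) / (w - x)\<^sup>2)"
      if "\<bar>u\<bar> = \<bar>y - z\<bar>" "d w \<le> d y" "w \<noteq> x" for w u
    proof (cases "d w = 0")
      case True
      then show ?thesis using gd[of w] by simp
    next
      case False
      then have dw: "d w > 0" using d0[of w] by simp
      have u: "u \<noteq> 0" using that ne by auto
      have "1/2 \<le> \<bar>u / d w\<bar>" using that 2 dw by (simp add: field_simps)
      then have k: "?k (u / d w) = (d w)\<^sup>2 / u\<^sup>2" by (simp add: marcinkiewicz_kernel_def power_divide)
      have u2: "(y - z)\<^sup>2 = u\<^sup>2" using that(1) by (metis power2_abs)
      have "\<bar>g w\<bar> \<le> C * d w" using gd[of w] C d0[of w] by (meson mult_right_mono order_trans)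
      then have "(g w)\<^sup>2 \<le> (C * d w)\<^sup>2" using abs_le_square_iff[of "g w" "C * d w"] C dw by simp
      then have "(g w)\<^sup>2 / ((w - x)\<^sup>2 * u\<^sup>2) \<le> (C * d w)\<^sup>2 / ((w - x)\<^sup>2 * u\<^sup>2)"
        by (intro divide_right_mono) auto
      then show ?thesis unfolding k by (simp add: power_divide power_mult_distrib u2 mult.commute)
    qed
    have "second_dd g x y z = g y / ((y - x) * (y - z)) - g z / ((z - x) * (y - z))"
      by (simp add: dd diff_divide_distrib)
    then have "(second_dd g x y z)\<^sup>2 \<le> 2 * (g y / ((y - x) * (y - z)))\<^sup>2 + 2 * (g z / ((z - x) * (y - z)))\<^sup>2"
      by (simp only: power2_diff_le)
    also have "\<dots> \<le> 2 * (C\<^sup>2 * (?k ((y - z) / d y) / (y - x)\<^sup>2)) + 2 * (C\<^sup>2 * (?k ((z - y) / d z) / (z - x)\<^sup>2))"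
      using ne le by (intro add_mono mult_left_mono far) auto
    finally show ?thesis by (simp add: distrib_left)
  next
    case 3
    define \<rho> where "\<rho> = d y"
    define t where "t = \<bar>y - z\<bar> / \<rho>"
    have \<rho>: "\<rho> > 0" and t: "0 < t" "t < 1/2" using 3 ne by (auto simp: \<rho>_def t_def)
    have "\<bar>g y - g z\<bar> \<le> (6 * (A * (3/2 * \<rho>)) + 4 * c * ((y + \<rho>/2) - (y - \<rho>/2))) * (\<bar>y - z\<bar> / ((y + \<rho>/2) - (y - \<rho>/2))) powr (3/4)"
    proof (rule zygmund_holder[of g c, OF zyg])
      fix w assume "w \<in> {y - \<rho>/2..y + \<rho>/2}"
      then have "d w \<le> 3/2 * \<rho>" using dlip[of w y] by (auto simp: \<rho>_def abs_if split: if_splits)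
      then show "\<bar>g w\<bar> \<le> A * (3/2 * \<rho>)" using gd[of w] A by (meson mult_left_mono order_trans)
    qed (use c \<rho> 3 in \<open>auto simp: \<rho>_def abs_if split: if_splits\<close>)
    also have "(6 * (A * (3/2 * \<rho>)) + 4 * c * ((y + \<rho>/2) - (y - \<rho>/2))) = (9 * A + 4 * c) * \<rho>"
      by (simp add: algebra_simps)
    also have "\<bar>y - z\<bar> / ((y + \<rho>/2) - (y - \<rho>/2)) = t" by (simp add: t_def)
    finally have hol: "\<bar>g y - g z\<bar> \<le> (9 * A + 4 * c) * \<rho> * t powr (3/4)" .
    have tp: "t powr (3/4) = t * t powr (-1/4)"
      using t powr_add[of t 1 "-1/4"] by simp
    have "t powr 0 \<le> t powr (-1/4)" using t by (intro powr_mono') auto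
    then have t1: "1 \<le> t powr (-1/4)" using t by simp
    have "\<bar>(g y - g z) / (y - z)\<bar> \<le> ((9 * A + 4 * c) * \<rho> * t powr (3/4)) / \<bar>y - z\<bar>"
      unfolding abs_divide by (intro divide_right_mono hol) auto
    also have "\<dots> = (9 * A + 4 * c) * t powr (-1/4)"
      unfolding tp using \<rho> ne by (simp add: t_def)
    finally have 1: "\<bar>(g y - g z) / (y - z)\<bar> \<le> (9 * A + 4 * c) * t powr (-1/4)" .
    have "\<bar>g z\<bar> \<le> A * \<bar>z - x\<bar>" using gd[of z] dx[of z] A by (meson mult_left_mono order_trans)
    then have "\<bar>g z / (z - x)\<bar> \<le> A" using ne by (simp add: abs_divide pos_divide_le_eq)
    also have "A * 1 \<le> A * t powr (-1/4)" using A t1 by (intro mult_left_mono)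
    finally have 2: "\<bar>g z / (z - x)\<bar> \<le> A * t powr (-1/4)" by simp
    \<comment> \<open>Regrouped so that the small gap \<open>y - z\<close> divides only the
      increment of \<open>g\<close>, where the Hoelder bound can absorb it.\<close>
    have "second_dd g x y z = ((g y - g z) / (y - z) - g z / (z - x)) / (y - x)"
      unfolding dd using ne by (simp add: divide_simps) (simp add: algebra_simps)
    moreover have "\<bar>(g y - g z) / (y - z) - g z / (z - x)\<bar> \<le> C * t powr (-1/4)"
    proof -
      have "\<bar>(g y - g z) / (y - z) - g z / (z - x)\<bar> \<le> (9 * A + 4 * c) * t powr (-1/4) + A * t powr (-1/4)"
        by (rule order_trans[OF abs_triangle_ineq4 add_mono[OF 1 2]])
      then show ?thesis by (simp add: C_def algebra_simps)
    qed
    ultimately have "\<bar>second_dd g x y z\<bar> \<le> C * t powr (-1/4) / \<bar>y - x\<bar>"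
      by (simp add: abs_divide divide_right_mono)
    then have "(second_dd g x y z)\<^sup>2 \<le> (C * t powr (-1/4) / \<bar>y - x\<bar>)\<^sup>2"
      using abs_le_square_iff[of "second_dd g x y z" "C * t powr (-1/4) / \<bar>y - x\<bar>"] C by simp
    also have "\<dots> = C\<^sup>2 * ((t powr (-1/4))\<^sup>2 / (y - x)\<^sup>2)"
      by (simp add: power_divide power_mult_distrib)
    also have "(t powr (-1/4))\<^sup>2 = t powr (-1/2)"
      by (simp add: power2_eq_square flip: powr_add)
    also have "t powr (-1/2) = ?k ((y - z) / d y)"
      using t \<rho> by (simp add: marcinkiewicz_kernel_def t_def \<rho>_def abs_divide)
    finally have "(second_dd g x y z)\<^sup>2 \<le> C\<^sup>2 * (?k ((y - z) / d y) / (y - x)\<^sup>2)" .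
    then show ?thesis using rhs0 rhs1 by (simp add: distrib_left)
  qed
  then show ?thesis unfolding C_def .
qed


text \<open>Integrating over \<open>z\<close> first replaces the kernel by a multiple of
  \<open>d y\<close>. A point \<open>x \<in> K\<close> is at least \<open>d y\<close> away from
  \<open>y\<close>, so the integral of \<open>d y / (y - x)\<^sup>2\<close> over
  \<open>x \<in> K\<close> is at most 2 whatever \<open>y\<close> is. Only \<open>y\<close> within
  distance 1 of the bounded set \<open>K\<close> contribute.\<close>

lemma whitney_energy_integrable:
  fixes g :: "real \<Rightarrow> real"
  assumes zyg: "\<And>x h. \<bar>g (x + h) + g (x - h) - 2 * g x\<bar> \<le> c * \<bar>h\<bar>"
    and [measurable]: "g \<in> borel_measurable borel"
    and K: "closed K" "K \<noteq> {}" "K \<subseteq> {-R..R}"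
    and gd: "\<And>y. \<bar>g y\<bar> \<le> A * infdist y K" and A: "A \<ge> 0"
  shows "(\<integral>\<^sup>+x. (if x \<in> K then quotient_energy g x else 0) \<partial>lborel) < \<infinity>"
proof -
  define d where "d y = infdist y K" for y
  define C where "C = 2 * (10 * A + 4 * c)\<^sup>2"
  define \<kappa> where "\<kappa> = (\<integral>\<^sup>+v. ennreal (marcinkiewicz_kernel v) \<partial>lborel)"
  let ?k = marcinkiewicz_kernel
  have \<kappa>: "\<kappa> < \<infinity>" unfolding \<kappa>_def by (rule nn_integral_marcinkiewicz_kernel)
  have c: "c \<ge> 0" using zyg[of 0 1] by simp
  have C: "C \<ge> 0" by (simp add: C_def)
  have [measurable]: "K \<in> sets borel" using K by simp
  have [measurable]: "d \<in> borel_measurable borel"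
    unfolding d_def[abs_def] by (intro borel_measurable_continuous_onI continuous_intros)
  have d0: "0 \<le> d y" for y by (simp add: d_def infdist_nonneg)
  have dlip: "d z \<le> d y + \<bar>y - z\<bar>" for y z
    using infdist_triangle[of z K y] by (simp add: d_def dist_real_def abs_minus_commute)
  have dx: "d y \<le> \<bar>y - x\<bar>" if "x \<in> K" for x y
    using infdist_le[OF that, of y] by (simp add: d_def dist_real_def)
  define U where "U x y z = (if \<bar>y - x\<bar> < 1 then ennreal (?k ((y - z) / d y) / (y - x)\<^sup>2) else 0)" for x y z
  define V where "V x y = (if \<bar>y - x\<bar> < 1 then ennreal (1 / (y - x)\<^sup>2) * ennreal (d y) else 0)" for x y
  have pt: "quotient_energy g x \<le> ennreal (2 * C) * (\<kappa> * (\<integral>\<^sup>+y. V x y \<partial>lborel))" if x: "x \<in> K" for x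
  proof -
    have "d x = 0" using x by (simp add: d_def)
    then have gx: "g x = 0" using gd[of x] by (simp add: d_def)
    have Um[measurable]: "(\<lambda>p. U x (fst p) (snd p)) \<in> borel_measurable (borel \<Otimes>\<^sub>M borel)"
      unfolding U_def by measurable
    have le: "ennreal ((second_dd g x y z)\<^sup>2) * indicator {z. \<bar>y - x\<bar> + \<bar>z - x\<bar> < 1} z \<le> ennreal C * (U x y z + U x z y)"
      if ne: "x \<noteq> y" "x \<noteq> z" "y \<noteq> z" for y z
    proof (cases "\<bar>y - x\<bar> + \<bar>z - x\<bar> < 1")
      case True
      then have yz: "\<bar>y - x\<bar> < 1" "\<bar>z - x\<bar> < 1" by auto
      have "(second_dd g x y z)\<^sup>2 \<le> C * (?k ((y - z) / d y) / (y - x)\<^sup>2 + ?k ((z - y) / d z) / (z - x)\<^sup>2)"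
      \<comment> \<open>The pointwise bound assumes that \<open>y\<close> has the larger distance;
        otherwise \<open>y\<close> and \<open>z\<close> are exchanged, under which both sides are
        symmetric.\<close>
      proof (cases "d z \<le> d y")
        case True
        then show ?thesis unfolding C_def
          by (intro second_dd_whitney_bound[of g c A d x y z]) (use zyg gd d0 dlip A c gx dx[OF x] ne in \<open>auto simp: d_def\<close>)
      next
        case False
        then have "(second_dd g x z y)\<^sup>2 \<le> C * (?k ((z - y) / d z) / (z - x)\<^sup>2 + ?k ((y - z) / d y) / (y - x)\<^sup>2)"
          unfolding C_def
          by (intro second_dd_whitney_bound[of g c A d x z y]) (use zyg gd d0 dlip A c gx dx[OF x] ne in \<open>auto simp: d_def\<close>)
        then show ?thesis by (simp add: second_dd_swap23[of g x z y] add.commute)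
      qed
      then have "ennreal ((second_dd g x y z)\<^sup>2) \<le> ennreal (C * (?k ((y - z) / d y) / (y - x)\<^sup>2 + ?k ((z - y) / d z) / (z - x)\<^sup>2))"
        by (rule ennreal_leI)
      also have "\<dots> = ennreal C * (U x y z + U x z y)"
        using C yz by (simp add: U_def ennreal_mult' marcinkiewicz_kernel_nonneg)
      finally show ?thesis using True by simp
    qed simp
    have "quotient_energy g x \<le> (\<integral>\<^sup>+y. \<integral>\<^sup>+z. ennreal C * (U x y z + U x z y) \<partial>lborel \<partial>lborel)"
      unfolding quotient_energy_eq[OF \<open>g \<in> borel_measurable borel\<close>]
    proof (rule nn_integral_mono_AE)
      show "AE y in lborel. (\<integral>\<^sup>+z. ennreal ((second_dd g x y z)\<^sup>2) * indicator {z. \<bar>y - x\<bar> + \<bar>z - x\<bar> < 1} z \<partial>lborel)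
          \<le> (\<integral>\<^sup>+z. ennreal C * (U x y z + U x z y) \<partial>lborel)"
        using AE_lborel_singleton[of x]
      proof eventually_elim
        case (elim y)
        show ?case
        proof (rule nn_integral_mono_AE)
          show "AE z in lborel. ennreal ((second_dd g x y z)\<^sup>2) * indicator {z. \<bar>y - x\<bar> + \<bar>z - x\<bar> < 1} z \<le> ennreal C * (U x y z + U x z y)"
            using AE_lborel_singleton[of x] AE_lborel_singleton[of y]
            by eventually_elim (use elim in \<open>auto intro!: le\<close>)
        qed
      qed
    qed
    also have "\<dots> = ennreal C * ((\<integral>\<^sup>+y. \<integral>\<^sup>+z. U x y z \<partial>lborel \<partial>lborel) + (\<integral>\<^sup>+y. \<integral>\<^sup>+z. U x z y \<partial>lborel \<partial>lborel))"
      unfolding U_def by (simp add: nn_integral_cmult nn_integral_add)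
    also have "(\<integral>\<^sup>+y. \<integral>\<^sup>+z. U x z y \<partial>lborel \<partial>lborel) = (\<integral>\<^sup>+y. \<integral>\<^sup>+z. U x y z \<partial>lborel \<partial>lborel)"
      by (rule lborel_pair.Fubini') (simp add: case_prod_beta' Um)
    also have "(\<integral>\<^sup>+y. \<integral>\<^sup>+z. U x y z \<partial>lborel \<partial>lborel) = (\<integral>\<^sup>+y. \<kappa> * V x y \<partial>lborel)"
    proof (rule nn_integral_cong)
      fix y :: real
      show "(\<integral>\<^sup>+z. U x y z \<partial>lborel) = \<kappa> * V x y"
      proof (cases "\<bar>y - x\<bar> < 1")
        case True
        have "(\<integral>\<^sup>+z. U x y z \<partial>lborel) = (\<integral>\<^sup>+z. ennreal (1 / (y - x)\<^sup>2) * ennreal (?k ((y - z) / d y)) \<partial>lborel)"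
          using True by (intro nn_integral_cong) (simp add: U_def ennreal_mult'[symmetric])
        also have "\<dots> = ennreal (1 / (y - x)\<^sup>2) * (\<integral>\<^sup>+z. ennreal (?k ((y - z) / d y)) \<partial>lborel)"
          by (rule nn_integral_cmult) measurable
        also have "\<dots> = \<kappa> * V x y"
          unfolding nn_integral_marcinkiewicz_kernel_scaled[OF d0] \<kappa>_def[symmetric] using True by (simp add: V_def ac_simps)
        finally show ?thesis .
      qed (simp add: U_def V_def)
    qed
    also have "\<dots> = \<kappa> * (\<integral>\<^sup>+y. V x y \<partial>lborel)"
      unfolding V_def by (rule nn_integral_cmult) measurable
    also have "ennreal C * (\<kappa> * (\<integral>\<^sup>+y. V x y \<partial>lborel) + \<kappa> * (\<integral>\<^sup>+y. V x y \<partial>lborel)) = ennreal (2 * C) * (\<kappa> * (\<integral>\<^sup>+y. V x y \<partial>lborel))"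
      by (simp add: ennreal_mult' mult.assoc flip: mult_2) (simp add: ac_simps)
    finally show ?thesis .
  qed
  have Vm: "(\<lambda>p. if fst p \<in> K then V (fst p) (snd p) else 0) \<in> borel_measurable (borel \<Otimes>\<^sub>M borel)"
    unfolding V_def by measurable
  have inner: "(\<integral>\<^sup>+x. (if x \<in> K then V x y else 0) \<partial>lborel) \<le> 2 * indicator {-R-1..R+1} y" for y
  proof (cases "d y = 0 \<or> y \<notin> {-R-1..R+1}")
    case True
    have z: "(if x \<in> K then V x y else 0) = 0" for x
    proof (cases "x \<in> K \<and> \<bar>y - x\<bar> < 1")
      case xK: True
      then have "x \<in> {-R..R}" using K by auto
      then have "y \<in> {-R-1..R+1}" using xK by (auto simp: abs_less_iff)
      then show ?thesis using True by (simp add: V_def)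
    qed (auto simp: V_def)
    show ?thesis unfolding z by simp
  next
    case False
    then have dy: "d y > 0" using d0[of y] by simp
    have "(\<integral>\<^sup>+x. (if x \<in> K then V x y else 0) \<partial>lborel)
       \<le> (\<integral>\<^sup>+x. ennreal (d y) * (ennreal (1 / (y - x)\<^sup>2) * indicator {v. d y \<le> \<bar>v\<bar>} (y - x)) \<partial>lborel)"
      by (intro nn_integral_mono) (auto simp: V_def dx ac_simps)
    also have "\<dots> = ennreal (d y) * (\<integral>\<^sup>+x. ennreal (1 / (y - x)\<^sup>2) * indicator {v. d y \<le> \<bar>v\<bar>} (y - x) \<partial>lborel)"
      by (rule nn_integral_cmult) measurable
    also have "(\<integral>\<^sup>+x. ennreal (1 / (y - x)\<^sup>2) * indicator {v. d y \<le> \<bar>v\<bar>} (y - x) \<partial>lborel)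
        = (\<integral>\<^sup>+v. ennreal (1 / v\<^sup>2) * indicator {v. d y \<le> \<bar>v\<bar>} v \<partial>lborel)"
      using nn_integral_real_affine[of "\<lambda>v. ennreal (1 / v\<^sup>2) * indicator {v. d y \<le> \<bar>v\<bar>} v" "-1" y] by simp
    also have "\<dots> = ennreal (2 / d y)" by (rule nn_integral_inverse_square_tail[OF dy])
    also have "ennreal (d y) * ennreal (2 / d y) = 2"
      using dy by (simp add: ennreal_mult'[symmetric])
    finally show ?thesis using False by simp
  qed
  have "(\<integral>\<^sup>+x. (if x \<in> K then quotient_energy g x else 0) \<partial>lborel)
     \<le> (\<integral>\<^sup>+x. ennreal (2 * C) * (\<kappa> * (\<integral>\<^sup>+y. (if x \<in> K then V x y else 0) \<partial>lborel)) \<partial>lborel)"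
    by (intro nn_integral_mono) (auto intro: pt)
  also have "\<dots> = ennreal (2 * C) * (\<kappa> * (\<integral>\<^sup>+x. \<integral>\<^sup>+y. (if x \<in> K then V x y else 0) \<partial>lborel \<partial>lborel))"
    using Vm unfolding V_def by (simp add: nn_integral_cmult)
  finally have le: "(\<integral>\<^sup>+x. (if x \<in> K then quotient_energy g x else 0) \<partial>lborel)
     \<le> ennreal (2 * C) * (\<kappa> * (\<integral>\<^sup>+x. \<integral>\<^sup>+y. (if x \<in> K then V x y else 0) \<partial>lborel \<partial>lborel))" .
  have "(\<integral>\<^sup>+x. \<integral>\<^sup>+y. (if x \<in> K then V x y else 0) \<partial>lborel \<partial>lborel) = (\<integral>\<^sup>+y. \<integral>\<^sup>+x. (if x \<in> K then V x y else 0) \<partial>lborel \<partial>lborel)"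
    by (rule lborel_pair.Fubini'[symmetric]) (unfold V_def case_prod_beta', measurable)
  also have "\<dots> \<le> (\<integral>\<^sup>+y. 2 * indicator {-R-1..R+1} y \<partial>lborel)"
    by (intro nn_integral_mono inner)
  also have "\<dots> < \<infinity>" by (simp add: nn_integral_cmult emeasure_lborel_Icc_eq ennreal_mult_less_top)
  finally have "(\<integral>\<^sup>+x. \<integral>\<^sup>+y. (if x \<in> K then V x y else 0) \<partial>lborel \<partial>lborel) < \<infinity>" .
  then have "ennreal (2 * C) * (\<kappa> * (\<integral>\<^sup>+x. \<integral>\<^sup>+y. (if x \<in> K then V x y else 0) \<partial>lborel \<partial>lborel)) < \<infinity>"
    using \<kappa> by (simp add: ennreal_mult_less_top)
  with le show ?thesis by (rule le_less_trans)
qed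


section \<open>Splitting into a Lipschitz function and a remainder\<close>

lemma power2_add_le: "(a + b)\<^sup>2 \<le> 2 * a\<^sup>2 + 2 * b\<^sup>2" for a b :: real
  using zero_le_power2[of "a - b"] by (simp add: power2_eq_square algebra_simps)

lemma second_dd_add: "second_dd (\<lambda>x. F x + g x) x y z = second_dd F x y z + second_dd g x y z"
  by (simp add: second_dd_def add_divide_distrib diff_divide_distrib)

lemma quotient_energy_add_le:
  assumes [measurable]: "F \<in> borel_measurable borel" "g \<in> borel_measurable borel"
  shows "quotient_energy (\<lambda>x. F x + g x) x \<le> 2 * quotient_energy F x + 2 * quotient_energy g x"
proof -
  let ?i = "\<lambda>y z. indicator {z. \<bar>y - x\<bar> + \<bar>z - x\<bar> < 1} z :: ennreal"
  have "quotient_energy (\<lambda>x. F x + g x) x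
    \<le> (\<integral>\<^sup>+y. \<integral>\<^sup>+z. 2 * (ennreal ((second_dd F x y z)\<^sup>2) * ?i y z) + 2 * (ennreal ((second_dd g x y z)\<^sup>2) * ?i y z) \<partial>lborel \<partial>lborel)"
    unfolding quotient_energy_eq[OF borel_measurable_add[OF assms]]
  proof (intro nn_integral_mono)
    fix y z :: real
    have "ennreal ((second_dd (\<lambda>x. F x + g x) x y z)\<^sup>2) \<le> ennreal (2 * (second_dd F x y z)\<^sup>2 + 2 * (second_dd g x y z)\<^sup>2)"
      unfolding second_dd_add by (intro ennreal_leI power2_add_le)
    also have "\<dots> = 2 * ennreal ((second_dd F x y z)\<^sup>2) + 2 * ennreal ((second_dd g x y z)\<^sup>2)"
      by (simp add: ennreal_mult')
    finally show "ennreal ((second_dd (\<lambda>x. F x + g x) x y z)\<^sup>2) * ?i y z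
      \<le> 2 * (ennreal ((second_dd F x y z)\<^sup>2) * ?i y z) + 2 * (ennreal ((second_dd g x y z)\<^sup>2) * ?i y z)"
      by (auto simp: indicator_def)
  qed
  also have "\<dots> = 2 * quotient_energy F x + 2 * quotient_energy g x"
    unfolding quotient_energy_eq[OF assms(1)] quotient_energy_eq[OF assms(2)]
    by (simp add: nn_integral_add nn_integral_cmult)
  finally show ?thesis .
qed

text \<open>McShane's formula \<open>E\<close> extends the restriction to \<open>K\<close>, and
  clamping between \<open>- \<psi>\<close> and \<open>\<psi>\<close> makes the support compact. The
  tent \<open>\<psi>\<close> is at least \<open>B\<close> on \<open>{-R..R}\<close>, so the values
  on \<open>K\<close> survive; its slopes are at most 1, which \<open>M \<ge> 1\<close>
  accommodates.\<close>

lemma lipschitz_extension_compact_support: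
  fixes f :: "real \<Rightarrow> real"
  assumes K: "K \<noteq> {}" "K \<subseteq> {-R..R}" and B: "\<And>x. \<bar>f x\<bar> \<le> B" and M: "M \<ge> 1"
    and lip: "\<And>x y. x \<in> K \<Longrightarrow> y \<in> K \<Longrightarrow> \<bar>f y - f x\<bar> \<le> M * \<bar>y - x\<bar>"
  obtains F where "\<And>x y. \<bar>F x - F y\<bar> \<le> M * \<bar>x - y\<bar>" "\<And>x. x \<in> K \<Longrightarrow> F x = f x"
    "\<And>x. \<bar>x\<bar> > B + R \<Longrightarrow> F x = 0"
proof -
  define E where "E y = (INF x\<in>K. f x + M * \<bar>y - x\<bar>)" for y
  have bdd: "bdd_below ((\<lambda>x. f x + M * \<bar>y - x\<bar>) ` K)" for y
  proof (rule bdd_belowI2)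
    fix x
    have "0 \<le> M * \<bar>y - x\<bar>" using M by simp
    then show "- B \<le> f x + M * \<bar>y - x\<bar>" using B[of x] by (simp add: abs_le_iff)
  qed
  have E_half: "E y \<le> E y' + M * \<bar>y - y'\<bar>" for y y'
  proof -
    have "E y - M * \<bar>y - y'\<bar> \<le> E y'"
      unfolding E_def[of y']
    proof (rule cINF_greatest[OF K(1)])
      fix x assume x: "x \<in> K"
      have "E y \<le> f x + M * \<bar>y - x\<bar>" unfolding E_def by (rule cINF_lower[OF bdd x])
      also have "\<dots> \<le> f x + M * (\<bar>y' - x\<bar> + \<bar>y - y'\<bar>)"
        using M by (intro add_left_mono mult_left_mono) auto
      finally show "E y - M * \<bar>y - y'\<bar> \<le> f x + M * \<bar>y' - x\<bar>" by (simp add: algebra_simps)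
    qed
    then show ?thesis by simp
  qed
  have E_lip: "\<bar>E y - E y'\<bar> \<le> M * \<bar>y - y'\<bar>" for y y'
    using E_half[of y y'] E_half[of y' y] by (simp add: abs_le_iff abs_minus_commute)
  have E_K: "E x = f x" if x: "x \<in> K" for x
  proof (rule antisym)
    show "E x \<le> f x" using cINF_lower[OF bdd[of x] x] by (simp add: E_def)
    show "f x \<le> E x" unfolding E_def
    proof (rule cINF_greatest[OF K(1)])
      fix w assume "w \<in> K"
      then show "f x \<le> f w + M * \<bar>x - w\<bar>" using lip[of w x] x by (simp add: abs_le_iff)
    qed
  qed
  define \<psi> where "\<psi> y = max 0 (B + R - \<bar>y\<bar>)" for y
  have \<psi>_lip: "\<bar>\<psi> y - \<psi> y'\<bar> \<le> M * \<bar>y - y'\<bar>" for y y'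
  proof -
    have "\<bar>\<psi> y - \<psi> y'\<bar> \<le> 1 * \<bar>y - y'\<bar>" unfolding \<psi>_def by (simp add: max_def abs_if)
    also have "\<dots> \<le> M * \<bar>y - y'\<bar>" using M by (intro mult_right_mono) auto
    finally show ?thesis .
  qed
  define F where "F y = max (- \<psi> y) (min (\<psi> y) (E y))" for y
  show ?thesis
  proof (rule that[of F])
    \<comment> \<open>Clamping is 1-Lipschitz for the maximum of the changes in level and value, so
      the two Lipschitz constants are not added.\<close>
    have clamp: "\<bar>max (- p) (min p e) - max (- p') (min p' e')\<bar> \<le> D"
      if "\<bar>p - p'\<bar> \<le> D" "\<bar>e - e'\<bar> \<le> D" for p p' e e' D :: real
      using that by (simp add: max_def min_def abs_le_iff)
    show "\<bar>F x - F y\<bar> \<le> M * \<bar>x - y\<bar>" for x y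
      unfolding F_def by (rule clamp[OF \<psi>_lip E_lip])
    show "F x = f x" if x: "x \<in> K" for x
    proof -
      have "\<bar>x\<bar> \<le> R" using K x by (auto simp: abs_le_iff)
      then have "\<bar>f x\<bar> \<le> \<psi> x" using B[of x] by (simp add: \<psi>_def)
      then show ?thesis by (auto simp: F_def E_K[OF x] abs_le_iff)
    qed
    show "F x = 0" if "\<bar>x\<bar> > B + R" for x
      using that by (simp add: F_def \<psi>_def)
  qed
qed

text \<open>The estimate defining \<open>K\<close> runs over all \<open>y\<close>, not only
  \<open>y \<in> K\<close>. Hence \<open>f\<close>, like \<open>F\<close>, departs from the common
  value at a nearest point of \<open>K\<close> by at most \<open>M\<close> times the distance, which
  gives the bound on \<open>g\<close>. Second differences of \<open>F\<close> are at most
  \<open>2 * M * \<bar>h\<bar>\<close>, so \<open>g\<close> inherits a Zygmund bound.\<close>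

lemma energy_finite_AE_on_lipschitz_set:
  fixes f :: "real \<Rightarrow> real"
  assumes zyg: "\<And>x h. \<bar>f (x + h) + f (x - h) - 2 * f x\<bar> \<le> c * \<bar>h\<bar>"
    and B: "\<And>x. \<bar>f x\<bar> \<le> B" and M: "M \<ge> 1"
  shows "AE x in lborel. \<bar>x\<bar> \<le> R \<longrightarrow> (\<forall>y. \<bar>f y - f x\<bar> \<le> M * \<bar>y - x\<bar>) \<longrightarrow> quotient_energy f x < \<infinity>"
proof -
  have cont: "continuous_on UNIV f"
    using zygmund_continuous[of f c, OF zyg] B by (auto simp: bounded_iff)
  then have fm[measurable]: "f \<in> borel_measurable borel" by (rule borel_measurable_continuous_onI)
  define K where "K = {-R..R} \<inter> (\<Inter>y. {x. \<bar>f y - f x\<bar> \<le> M * \<bar>y - x\<bar>})"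
  have K: "closed K" "K \<subseteq> {-R..R}"
    unfolding K_def
    by (intro closed_Int closed_INT ballI closed_Collect_le continuous_intros closed_real_atLeastAtMost cont) auto
  have KD: "\<bar>f y - f x\<bar> \<le> M * \<bar>y - x\<bar>" if "x \<in> K" for x y using that by (auto simp: K_def)
  show ?thesis
  proof (cases "K = {}")
    case True
    have "x \<in> K" if "\<bar>x\<bar> \<le> R" "\<forall>y. \<bar>f y - f x\<bar> \<le> M * \<bar>y - x\<bar>" for x
      using that unfolding K_def by auto
    then show ?thesis using True by (intro AE_I2) blast
  next
    case False
    obtain F where F: "\<And>x y. \<bar>F x - F y\<bar> \<le> M * \<bar>x - y\<bar>" and FK: "\<And>x. x \<in> K \<Longrightarrow> F x = f x"
      and Fs: "\<And>x. \<bar>x\<bar> > B + R \<Longrightarrow> F x = 0"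
      using lipschitz_extension_compact_support[OF False K(2) B M KD] by metis
    have Fm[measurable]: "F \<in> borel_measurable borel" by (rule lipschitz_borel_measurable[OF F])
    define g where "g x = f x - F x" for x
    have gm[measurable]: "g \<in> borel_measurable borel" unfolding g_def by measurable
    obtain x0 where "x0 \<in> K" using False by auto
    then have "R \<ge> 0" using K by force
    then have BR: "B + R \<ge> 0" using B[of 0] by linarith
    have EF: "(\<integral>\<^sup>+x. quotient_energy F x \<partial>lborel) < \<infinity>"
      by (rule lipschitz_energy_integrable[OF F Fs BR])
    have gz: "\<bar>g (x + h) + g (x - h) - 2 * g x\<bar> \<le> (c + 2 * M) * \<bar>h\<bar>" for x h
    proof -
      have "\<bar>(f (x + h) + f (x - h) - 2 * f x) - ((F (x + h) - F x) + (F (x - h) - F x))\<bar>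
        \<le> c * \<bar>h\<bar> + (M * \<bar>h\<bar> + M * \<bar>h\<bar>)"
        using F[of "x + h" x] F[of "x - h" x]
        by (intro order_trans[OF abs_triangle_ineq4 add_mono] zyg order_trans[OF abs_triangle_ineq add_mono]) auto
      then show ?thesis by (simp add: g_def algebra_simps)
    qed
    have gd: "\<bar>g y\<bar> \<le> (2 * M) * infdist y K" for y
    proof -
      obtain x where x: "x \<in> K" "infdist y K = dist y x"
        using infdist_attains_inf[OF K(1) False] by blast
      have "g y = (f y - f x) - (F y - F x)" using FK[OF x(1)] by (simp add: g_def)
      also have "\<bar>\<dots>\<bar> \<le> M * \<bar>y - x\<bar> + M * \<bar>y - x\<bar>"
        by (intro order_trans[OF abs_triangle_ineq4 add_mono] KD x F)
      finally show ?thesis using x by (simp add: dist_real_def)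
    qed
    have Eg: "(\<integral>\<^sup>+x. (if x \<in> K then quotient_energy g x else 0) \<partial>lborel) < \<infinity>"
      using M by (intro whitney_energy_integrable[OF gz gm K(1) False K(2) gd]) auto
    have Em: "quotient_energy h \<in> borel_measurable borel" if [measurable]: "h \<in> borel_measurable borel" for h
      unfolding quotient_energy_eq_shifted[OF that, abs_def] by measurable
    have "AE x in lborel. quotient_energy F x \<noteq> \<infinity>"
      using EF Em[OF Fm] by (intro nn_integral_PInf_AE) auto
    moreover have "AE x in lborel. (if x \<in> K then quotient_energy g x else 0) \<noteq> \<infinity>"
    proof (intro nn_integral_PInf_AE)
      note [measurable] = Em[OF gm]
      have [measurable]: "K \<in> sets borel" using K by simp
      show "(\<lambda>x. if x \<in> K then quotient_energy g x else 0) \<in> borel_measurable lborel" by measurable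
    qed (use Eg in auto)
    ultimately show ?thesis
    proof eventually_elim
      case (elim x)
      show ?case
      proof (intro impI)
        assume "\<bar>x\<bar> \<le> R" "\<forall>y. \<bar>f y - f x\<bar> \<le> M * \<bar>y - x\<bar>"
        then have "x \<in> K" by (auto simp: K_def abs_le_iff)
        have "quotient_energy f x = quotient_energy (\<lambda>x. F x + g x) x" by (simp add: g_def)
        also have "\<dots> \<le> 2 * quotient_energy F x + 2 * quotient_energy g x"
          by (rule quotient_energy_add_le[OF Fm gm])
        also have "\<dots> < \<infinity>" using elim \<open>x \<in> K\<close> by (simp add: ennreal_mult_less_top less_top)
        finally show "quotient_energy f x < \<infinity>" .
      qed
    qed
  qed
qed

text \<open>Near \<open>x\<close> the difference quotient is controlled by the derivative, away from
  \<open>x\<close> by the boundedness of \<open>f\<close>. An integer \<open>M\<close> lets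
  countably many exceptional sets suffice.\<close>

lemma differentiable_imp_lipschitz_at:
  fixes f :: "real \<Rightarrow> real" and x :: real
  assumes diff: "f differentiable (at x)" and B: "\<And>x. \<bar>f x\<bar> \<le> B"
  obtains M :: nat where "M \<ge> 1" "\<And>y::real. \<bar>f y - f x\<bar> \<le> real M * \<bar>y - x\<bar>"
proof -
  obtain D where "(f has_real_derivative D) (at x)"
    using diff by (auto simp: real_differentiable_def)
  then have "((\<lambda>y. (f y - f x) / (y - x)) \<longlongrightarrow> D) (at x)"
    by (simp add: has_field_derivative_iff)
  then have "eventually (\<lambda>y. dist ((f y - f x) / (y - x)) D < 1) (at x)"
    by (rule tendstoD) simp
  then obtain e where e: "e > 0" and E: "\<And>y. y \<noteq> x \<Longrightarrow> dist y x < e \<Longrightarrow> dist ((f y - f x) / (y - x)) D < 1"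
    by (auto simp: eventually_at)
  obtain M :: nat where M: "max 1 (max (\<bar>D\<bar> + 1) (2 * B / e)) \<le> real M" using real_arch_simple by blast
  show ?thesis
  proof (rule that[of M])
    have "1 \<le> real M" using M by linarith
    then show "1 \<le> M" by simp
    fix y
    show "\<bar>f y - f x\<bar> \<le> M * \<bar>y - x\<bar>"
    proof (cases "y = x")
      case False
      show ?thesis
      proof (cases "\<bar>y - x\<bar> < e")
        case True
        then have "\<bar>(f y - f x) / (y - x) - D\<bar> < 1" using E[OF False] by (simp add: dist_real_def)
        then have "\<bar>(f y - f x) / (y - x)\<bar> \<le> \<bar>D\<bar> + 1" by argo
        also have "\<dots> \<le> M" using M by simp
        finally show ?thesis using False by (simp add: abs_divide pos_divide_le_eq)
      next
        case ne: False
        have "\<bar>f y - f x\<bar> \<le> 2 * B" using B[of x] B[of y] by argo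
        also have "\<dots> = 2 * B / e * e" using e by simp
        also have "\<dots> \<le> M * \<bar>y - x\<bar>" using ne e M B[of x] by (intro mult_mono) auto
        finally show ?thesis .
      qed
    qed simp
  qed
qed

proposition differentiable_AE_energy_finite:
  fixes f :: "real \<Rightarrow> real"
  assumes zyg: "\<And>x h. \<bar>f (x + h) + f (x - h) - 2 * f x\<bar> \<le> c * \<bar>h\<bar>" and B: "\<And>x. \<bar>f x\<bar> \<le> B"
  shows "AE x in lborel. f differentiable (at x) \<longrightarrow> quotient_energy f x < \<infinity>"
proof -
  have "AE x in lborel. \<forall>M R :: nat. 1 \<le> real M \<longrightarrow> \<bar>x\<bar> \<le> R \<longrightarrow> (\<forall>y. \<bar>f y - f x\<bar> \<le> M * \<bar>y - x\<bar>) \<longrightarrow> quotient_energy f x < \<infinity>"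
    unfolding AE_all_countable using energy_finite_AE_on_lipschitz_set[OF zyg B] by auto
  then show ?thesis
  proof eventually_elim
    case (elim x)
    show ?case
    proof
      assume "f differentiable (at x)"
      then obtain M :: nat where "M \<ge> 1" "\<And>y. \<bar>f y - f x\<bar> \<le> real M * \<bar>y - x\<bar>"
        using differentiable_imp_lipschitz_at[of f x B, OF _ B] by blast
      moreover obtain R :: nat where "\<bar>x\<bar> \<le> R" using real_arch_simple by blast
      ultimately show "quotient_energy f x < \<infinity>" using elim by auto
    qed
  qed
qed

section \<open>Differentiability at points of finite energy\<close>

text \<open>The parameter \<theta> shifts the grid and \<open>w\<close> is a position relative to
  it: the interval is the one containing \<open>\<theta> + w\<close>. With
  \<open>\<theta> = p - w\<close> it contains the fixed point \<open>p\<close> while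
  \<open>w\<close> varies the grid.\<close>

definition dyadic_slope :: "(real \<Rightarrow> real) \<Rightarrow> real \<Rightarrow> nat \<Rightarrow> real \<Rightarrow> real" where
  "dyadic_slope f \<theta> n w =
     2 ^ n * (f (\<theta> + (real_of_int \<lfloor>2 ^ n * w\<rfloor> + 1) / 2 ^ n) - f (\<theta> + real_of_int \<lfloor>2 ^ n * w\<rfloor> / 2 ^ n))"

text \<open>Half the difference between the slopes over the right and the left half of the interval.
  Passing to the half that contains \<open>w\<close> changes the slope by exactly this amount up to
  sign, and it depends only on the cell of level \<open>n\<close>, so the slopes form a sign
  transform.\<close>

definition dyadic_bend :: "(real \<Rightarrow> real) \<Rightarrow> real \<Rightarrow> nat \<Rightarrow> real \<Rightarrow> real" where
  "dyadic_bend f \<theta> n w =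
     2 ^ n * (f (\<theta> + (real_of_int \<lfloor>2 ^ n * w\<rfloor> + 1) / 2 ^ n)
       - 2 * f (\<theta> + (real_of_int \<lfloor>2 ^ n * w\<rfloor> + 1/2) / 2 ^ n) + f (\<theta> + real_of_int \<lfloor>2 ^ n * w\<rfloor> / 2 ^ n))"

lemma dyadic_slope_Suc:
  "dyadic_slope f \<theta> (Suc n) w = dyadic_slope f \<theta> n w + rademacher n w * dyadic_bend f \<theta> n w"
proof -
  define j where "j = \<lfloor>2 ^ Suc n * w\<rfloor>"
  define k where "k = \<lfloor>2 ^ n * w\<rfloor>"
  have kj: "k = j div 2" using floor_dyadic_div[of n "Suc n" w] by (simp add: k_def j_def)
  show ?thesis
  proof (cases "even j")
    case True
    then have j: "j = 2 * k" using kj by simp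
    have e1: "(real_of_int j + 1) / 2 ^ Suc n = (real_of_int k + 1/2) / 2 ^ n"
      and e2: "real_of_int j / 2 ^ Suc n = real_of_int k / 2 ^ n"
      unfolding j by (simp_all add: field_simps)
    have r: "rademacher n w = - 1" using True by (simp add: rademacher_def j_def)
    show ?thesis
      unfolding dyadic_slope_def dyadic_bend_def j_def[symmetric] k_def[symmetric] e1 e2 r
      by (simp add: algebra_simps)
  next
    case False
    then have j: "j = 2 * k + 1" using kj by (metis odd_two_times_div_two_succ)
    have e1: "(real_of_int j + 1) / 2 ^ Suc n = (real_of_int k + 1) / 2 ^ n"
      and e2: "real_of_int j / 2 ^ Suc n = (real_of_int k + 1/2) / 2 ^ n"
      unfolding j by (simp_all add: field_simps)
    have r: "rademacher n w = 1" using False by (simp add: rademacher_def j_def)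
    show ?thesis
      unfolding dyadic_slope_def dyadic_bend_def j_def[symmetric] k_def[symmetric] e1 e2 r
      by (simp add: algebra_simps)
  qed
qed

lemma dyadic_slope_convergent:
  "AE w in lborel. w \<in> {0..<1} \<longrightarrow> summable (\<lambda>n. (dyadic_bend f \<theta> n w)\<^sup>2) \<longrightarrow> convergent (\<lambda>n. dyadic_slope f \<theta> n w)"
proof -
  have ad: "dyadic_adapted n (dyadic_bend f \<theta> n)" for n
    unfolding dyadic_adapted_def dyadic_bend_def by simp
  have eq: "dyadic_slope f \<theta> n w = dyadic_slope f \<theta> 0 w + (\<Sum>j<n. rademacher j w * dyadic_bend f \<theta> j w)" for n w
    by (induction n) (simp_all add: dyadic_slope_Suc)
  from transform_convergent[of "dyadic_bend f \<theta>", OF ad] show ?thesis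
    by eventually_elim (subst eq, auto intro!: convergent_add convergent_const)
qed

text \<open>The doubling map preserves Lebesgue measure on the unit interval. Consequently a point
  is uniformly distributed inside its cell at every level when the shift is uniformly
  distributed.\<close>

lemma nn_integral_frac_dyadic:
  fixes \<phi> :: "real \<Rightarrow> ennreal"
  assumes "\<phi> \<in> borel_measurable borel"
  shows "(\<integral>\<^sup>+w. \<phi> (frac (2 ^ n * w)) * indicator {0..<1} w \<partial>lborel) = (\<integral>\<^sup>+u. \<phi> u * indicator {0..<1} u \<partial>lborel)"
  using assms
proof (induction n arbitrary: \<phi>)
  case 0
  show ?case by (intro nn_integral_cong) (auto simp: indicator_def frac_eq)
next
  case (Suc n)
  note [measurable] = Suc.prems
  have frac2: "frac (2 ^ Suc n * w) = frac (2 * frac (2 ^ n * w))" for w :: real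
  proof -
    have "2 * frac (2 ^ n * w) = 2 ^ Suc n * w - real_of_int (2 * \<lfloor>2 ^ n * w\<rfloor>)"
      by (simp add: frac_def)
    then have "frac (2 * frac (2 ^ n * w)) = frac (2 ^ Suc n * w - real_of_int (2 * \<lfloor>2 ^ n * w\<rfloor>))"
      by (simp only:)
    also have "\<dots> = frac (2 ^ Suc n * w)"
      unfolding frac_def floor_diff_of_int by simp
    finally show ?thesis ..
  qed
  have fm[measurable]: "frac \<in> borel_measurable (borel :: real measure)" unfolding frac_def[abs_def] by measurable
  have "(\<integral>\<^sup>+w. \<phi> (frac (2 ^ Suc n * w)) * indicator {0..<1} w \<partial>lborel) = (\<integral>\<^sup>+u. \<phi> (frac (2 * u)) * indicator {0..<1} u \<partial>lborel)"
    unfolding frac2 by (rule Suc.IH[of "\<lambda>u. \<phi> (frac (2 * u))"]) measurable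
  also have "\<dots> = (\<integral>\<^sup>+u. \<phi> (2 * u) * indicator {0..<1} (2 * u) + \<phi> (- 1 + 2 * u) * indicator {0..<1} (- 1 + 2 * u) \<partial>lborel)"
  proof (rule nn_integral_cong)
    fix u :: real
    consider "u < 0 \<or> 1 \<le> u" | "0 \<le> u" "u < 1/2" | "1/2 \<le> u" "u < 1" by linarith
    then show "\<phi> (frac (2 * u)) * indicator {0..<1} u
      = \<phi> (2 * u) * indicator {0..<1} (2 * u) + \<phi> (- 1 + 2 * u) * indicator {0..<1} (- 1 + 2 * u)"
    proof cases
      case 2
      then have "frac (2 * u) = 2 * u" by (simp add: frac_eq)
      then show ?thesis using 2 by simp
    next
      case 3
      then have "frac (2 * u) = - 1 + 2 * u" by (simp add: frac_unique_iff)
      then show ?thesis using 3 by simp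
    qed (auto simp: indicator_def)
  qed
  also have "\<dots> = (\<integral>\<^sup>+u. \<phi> (2 * u) * indicator {0..<1} (2 * u) \<partial>lborel) + (\<integral>\<^sup>+u. \<phi> (- 1 + 2 * u) * indicator {0..<1} (- 1 + 2 * u) \<partial>lborel)"
    by (rule nn_integral_add) measurable
  finally have "(\<integral>\<^sup>+w. \<phi> (frac (2 ^ Suc n * w)) * indicator {0..<1} w \<partial>lborel)
     = (\<integral>\<^sup>+u. \<phi> (0 + 2 * u) * indicator {0..<1} (0 + 2 * u) \<partial>lborel) + (\<integral>\<^sup>+u. \<phi> (- 1 + 2 * u) * indicator {0..<1} (- 1 + 2 * u) \<partial>lborel)"
    by simp
  also have "\<dots> = 2 * (\<integral>\<^sup>+u. \<phi> (0 + 2 * u) * indicator {0..<1} (0 + 2 * u) \<partial>lborel)"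
  proof -
    have "ennreal 2 * (\<integral>\<^sup>+u. \<phi> (- 1 + 2 * u) * indicator {0..<1} (- 1 + 2 * u) \<partial>lborel)
        = ennreal 2 * (\<integral>\<^sup>+u. \<phi> (0 + 2 * u) * indicator {0..<1} (0 + 2 * u) \<partial>lborel)"
      using nn_integral_real_affine[of "\<lambda>u. \<phi> u * indicator {0..<1} u" 2 0] nn_integral_real_affine[of "\<lambda>u. \<phi> u * indicator {0..<1} u" 2 "-1"]
      by simp
    then have "(\<integral>\<^sup>+u. \<phi> (- 1 + 2 * u) * indicator {0..<1} (- 1 + 2 * u) \<partial>lborel)
        = (\<integral>\<^sup>+u. \<phi> (0 + 2 * u) * indicator {0..<1} (0 + 2 * u) \<partial>lborel)"
      by (subst (asm) ennreal_mult_cancel_left) auto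
    then show ?thesis by (simp only: mult_2)
  qed
  also have "\<dots> = (\<integral>\<^sup>+u. \<phi> u * indicator {0..<1} u \<partial>lborel)"
    using nn_integral_real_affine[of "\<lambda>u. \<phi> u * indicator {0..<1} u" 2 0] by simp
  finally show ?case .
qed

section \<open>Second differences controlled by the energy\<close>

definition annulus_energy :: "(real \<Rightarrow> real) \<Rightarrow> real \<Rightarrow> real \<Rightarrow> ennreal" where
  "annulus_energy f p r = (\<integral>\<^sup>+t. (\<integral>\<^sup>+s. ennreal ((second_dd f p (p + s) (p + t))\<^sup>2) * indicator {-r..r} s \<partial>lborel)
      * indicator {r<..<2 * r} t \<partial>lborel)"

text \<open>The deviation of \<open>f\<close> at \<open>p + s\<close> from the line through
  \<open>(p, f p)\<close> with slope \<open>q\<close>. For \<open>q = diff_quot f p t\<close> with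
  \<open>t \<noteq> 0\<close> it vanishes at \<open>s = 0\<close> and at
  \<open>s = t\<close>.\<close>

definition residual :: "(real \<Rightarrow> real) \<Rightarrow> real \<Rightarrow> real \<Rightarrow> real \<Rightarrow> real" where
  "residual f p q s = f (p + s) - f p - s * q"

lemma residual_measurable [measurable (raw)]:
  assumes [measurable]: "f \<in> borel_measurable borel" "s \<in> borel_measurable M"
  shows "(\<lambda>x. residual f p q (s x)) \<in> borel_measurable M"
  unfolding residual_def by measurable

text \<open>The residual is the error of linear interpolation at 0 and \<open>t\<close>, namely
  \<open>s * (s - t)\<close> times the second divided difference. Here
  \<open>\<bar>s\<bar> \<le> r\<close> and \<open>\<bar>s - t\<bar> \<le> 3 * r\<close>.\<close>

lemma residual_square_le:
  assumes t: "r < t" "t < 2 * r" and s: "s \<in> {-r..r}"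
  shows "(residual f p (diff_quot f p t) s)\<^sup>2 \<le> 9 * r ^ 4 * (second_dd f p (p + s) (p + t))\<^sup>2"
proof -
  have r: "r > 0" using t by simp
  have "residual f p (diff_quot f p t) s = s * (s - t) * second_dd f p (p + s) (p + t)"
  proof (cases "s = 0")
    case False
    have "s * (s - t) * ((X / s - Y / t) / (s - t)) = X - s * (Y / t)" for X Y
    proof -
      have "s * (s - t) * ((X / s - Y / t) / (s - t)) = s * (X / s - Y / t)" using s t by simp
      also have "\<dots> = X - s * (Y / t)" using False by (simp add: right_diff_distrib)
      finally show ?thesis .
    qed
    from this[of "f (p + s) - f p" "f (p + t) - f p"] show ?thesis
      by (simp add: residual_def second_dd_def diff_quot_def)
  qed (simp add: residual_def)
  then have "(residual f p (diff_quot f p t) s)\<^sup>2 = (s\<^sup>2 * (s - t)\<^sup>2) * (second_dd f p (p + s) (p + t))\<^sup>2"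
    by (simp add: power_mult_distrib)
  also have "\<dots> \<le> (r\<^sup>2 * (3 * r)\<^sup>2) * (second_dd f p (p + s) (p + t))\<^sup>2"
  proof (intro mult_right_mono mult_mono)
    show "s\<^sup>2 \<le> r\<^sup>2" using s r by (intro abs_le_square_iff[THEN iffD1]) auto
    show "(s - t)\<^sup>2 \<le> (3 * r)\<^sup>2" using s r t by (intro abs_le_square_iff[THEN iffD1]) auto
  qed auto
  also have "r\<^sup>2 * (3 * r)\<^sup>2 = 9 * r ^ 4" by (simp add: power2_eq_square power4_eq_xxxx)
  finally show ?thesis .
qed

text \<open>A second difference ignores affine functions, so \<open>f\<close> may be replaced by its
  residual for any slope \<open>q\<close>; all three points lie within \<open>r\<close> of
  \<open>p\<close>. Cauchy-Schwarz for the coefficients 1, -2, 1 gives the factor 6, and each of the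
  three substitutions gives \<open>1 / r\<close>.\<close>

lemma nn_integral_bend_le_residual:
  fixes f :: "real \<Rightarrow> real"
  assumes [measurable]: "f \<in> borel_measurable borel" and r: "r > 0"
  shows "(\<integral>\<^sup>+u. ennreal (((f (p - r * u + r) - 2 * f (p - r * u + r / 2) + f (p - r * u)) / r)\<^sup>2) * indicator {0..<1} u \<partial>lborel)
     \<le> ennreal (18 / r ^ 3) * (\<integral>\<^sup>+s. ennreal ((residual f p q s)\<^sup>2) * indicator {-r..r} s \<partial>lborel)"
proof -
  define Q where "Q s = ennreal ((residual f p q s)\<^sup>2) * indicator {-r..r} s" for s
  have [measurable]: "Q \<in> borel_measurable borel" unfolding Q_def by measurable
  have scale: "(\<integral>\<^sup>+u. Q (\<alpha> + - r * u) \<partial>lborel) = ennreal (1 / r) * (\<integral>\<^sup>+s. Q s \<partial>lborel)" for \<alpha>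
  proof -
    have "(\<integral>\<^sup>+s. Q s \<partial>lborel) = ennreal r * (\<integral>\<^sup>+u. Q (\<alpha> + - r * u) \<partial>lborel)"
      using nn_integral_real_affine[of Q "- r" \<alpha>] r by simp
    then show ?thesis using r by (simp add: ennreal_mult'[symmetric] flip: mult.assoc)
  qed
  have "(\<integral>\<^sup>+u. ennreal (((f (p - r * u + r) - 2 * f (p - r * u + r / 2) + f (p - r * u)) / r)\<^sup>2) * indicator {0..<1} u \<partial>lborel)
     \<le> (\<integral>\<^sup>+u. ennreal (6 / r\<^sup>2) * (Q (r + - r * u) + Q (r / 2 + - r * u) + Q (0 + - r * u)) \<partial>lborel)"
  proof (rule nn_integral_mono)
    fix u :: real
    show "ennreal (((f (p - r * u + r) - 2 * f (p - r * u + r / 2) + f (p - r * u)) / r)\<^sup>2) * indicator {0..<1} u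
      \<le> ennreal (6 / r\<^sup>2) * (Q (r + - r * u) + Q (r / 2 + - r * u) + Q (0 + - r * u))"
    proof (cases "u \<in> {0..<1}")
      case True
      then have u: "0 \<le> u" "u < 1" by auto
      have ru: "0 \<le> r * u" "r * u \<le> r" using u r by (auto simp: mult_left_le)
      define a b e where "a = residual f p q (r + - r * u)" and "b = residual f p q (r / 2 + - r * u)" and "e = residual f p q (0 + - r * u)"
      have eq: "f (p - r * u + r) - 2 * f (p - r * u + r / 2) + f (p - r * u) = a - 2 * b + e"
        unfolding a_def b_def e_def residual_def by (simp add: algebra_simps)
      \<comment> \<open>The gap in Cauchy-Schwarz, \<open>6 * (a\<^sup>2 + b\<^sup>2 + e\<^sup>2) -
        (a - 2 * b + e)\<^sup>2\<close>, written as a sum of squares by Lagrange's identity.\<close>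
      have "0 \<le> (2 * a + b)\<^sup>2 + (2 * e + b)\<^sup>2 + (a - e)\<^sup>2" by simp
      then have "(a - 2 * b + e)\<^sup>2 \<le> 6 * (a\<^sup>2 + b\<^sup>2 + e\<^sup>2)"
        by (simp add: power2_eq_square algebra_simps)
      then have "((a - 2 * b + e) / r)\<^sup>2 \<le> 6 / r\<^sup>2 * (a\<^sup>2 + b\<^sup>2 + e\<^sup>2)"
        using r by (simp add: power_divide divide_right_mono)
      then have "ennreal (((a - 2 * b + e) / r)\<^sup>2) \<le> ennreal (6 / r\<^sup>2 * (a\<^sup>2 + b\<^sup>2 + e\<^sup>2))"
        by (rule ennreal_leI)
      also have "\<dots> = ennreal (6 / r\<^sup>2) * (ennreal (a\<^sup>2) + ennreal (b\<^sup>2) + ennreal (e\<^sup>2))"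
        by (subst ennreal_mult') simp_all
      also have "\<dots> = ennreal (6 / r\<^sup>2) * (Q (r + - r * u) + Q (r / 2 + - r * u) + Q (0 + - r * u))"
      proof -
        have "r + - r * u \<in> {-r..r}" "r / 2 + - r * u \<in> {-r..r}" "0 + - r * u \<in> {-r..r}"
          using ru r unfolding atLeastAtMost_iff mult_minus_left by linarith+
        then show ?thesis by (simp only: Q_def a_def b_def e_def indicator_simps mult_1_right)
      qed
      finally show ?thesis using True eq by simp
    qed simp
  qed
  also have "\<dots> = ennreal (6 / r\<^sup>2) * ((\<integral>\<^sup>+u. Q (r + - r * u) \<partial>lborel) + (\<integral>\<^sup>+u. Q (r / 2 + - r * u) \<partial>lborel) + (\<integral>\<^sup>+u. Q (0 + - r * u) \<partial>lborel))"
    by (simp add: nn_integral_add nn_integral_cmult del: add_0)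
  also have "\<dots> = ennreal (6 / r\<^sup>2) * (ennreal (1 / r) * (\<integral>\<^sup>+s. Q s \<partial>lborel) + ennreal (1 / r) * (\<integral>\<^sup>+s. Q s \<partial>lborel) + ennreal (1 / r) * (\<integral>\<^sup>+s. Q s \<partial>lborel))"
    unfolding scale ..
  also have "\<dots>
      = (ennreal (6 / r\<^sup>2) * (ennreal (1 / r) * 3)) * (\<integral>\<^sup>+s. Q s \<partial>lborel)"
  proof -
    have "X + X + X = 3 * X" for X :: ennreal
    proof -
      have "(3 :: ennreal) = 1 + 1 + 1" by simp
      then show ?thesis by (simp only: distrib_right mult_1_left)
    qed
    then show ?thesis by (simp only: mult_ac)
  qed
  also have "ennreal (6 / r\<^sup>2) * (ennreal (1 / r) * 3) = ennreal (18 / r ^ 3)"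
  proof -
    have "ennreal (6 / r\<^sup>2 * (1 / r * 3)) = ennreal (6 / r\<^sup>2) * ennreal (1 / r * 3)"
      by (rule ennreal_mult') simp
    also have "ennreal (1 / r * 3) = ennreal (1 / r) * ennreal 3"
      by (rule ennreal_mult') (use r in simp)
    finally have "ennreal (6 / r\<^sup>2) * (ennreal (1 / r) * 3) = ennreal (6 / r\<^sup>2 * (1 / r * 3))" by simp
    then show ?thesis by (simp add: power2_eq_square power3_eq_cube)
  qed
  finally show ?thesis unfolding Q_def .
qed

text \<open>The left-hand side does not involve the reference point \<open>t\<close>, so the
  residual bound with slope \<open>diff_quot f p t\<close> can be integrated over
  \<open>r < t < 2 * r\<close>. The length of this range cancels the remaining factor
  \<open>r\<close>, and 162 is 18 times 9.\<close>

lemma nn_integral_bend_le_energy: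
  fixes f :: "real \<Rightarrow> real"
  assumes fm[measurable]: "f \<in> borel_measurable borel" and r: "r > 0"
  shows "(\<integral>\<^sup>+u. ennreal (((f (p - r * u + r) - 2 * f (p - r * u + r / 2) + f (p - r * u)) / r)\<^sup>2) * indicator {0..<1} u \<partial>lborel)
     \<le> 162 * annulus_energy f p r"
    (is "?I \<le> _")
proof -
  define J where "J t = (\<integral>\<^sup>+s. ennreal ((second_dd f p (p + s) (p + t))\<^sup>2) * indicator {-r..r} s \<partial>lborel)" for t
  have [measurable]: "J \<in> borel_measurable borel" unfolding J_def[abs_def] by measurable
  have le: "?I * indicator {r<..<2 * r} t \<le> ennreal (162 * r) * (J t * indicator {r<..<2 * r} t)" for t
  proof (cases "t \<in> {r<..<2 * r}")
    case True
    have "?I \<le> ennreal (18 / r ^ 3) * (\<integral>\<^sup>+s. ennreal ((residual f p (diff_quot f p t) s)\<^sup>2) * indicator {-r..r} s \<partial>lborel)"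
      by (rule nn_integral_bend_le_residual[OF fm r])
    also have "\<dots> \<le> ennreal (18 / r ^ 3) * (\<integral>\<^sup>+s. ennreal (9 * r ^ 4) * (ennreal ((second_dd f p (p + s) (p + t))\<^sup>2) * indicator {-r..r} s) \<partial>lborel)"
    proof (intro mult_left_mono nn_integral_mono)
      fix s
      have "ennreal ((residual f p (diff_quot f p t) s)\<^sup>2) \<le> ennreal (9 * r ^ 4) * ennreal ((second_dd f p (p + s) (p + t))\<^sup>2)" if "s \<in> {-r..r}"
        using residual_square_le[OF _ _ that, of t f p] True r by (subst ennreal_mult'[symmetric]) (auto intro!: ennreal_leI)
      then show "ennreal ((residual f p (diff_quot f p t) s)\<^sup>2) * indicator {-r..r} s
        \<le> ennreal (9 * r ^ 4) * (ennreal ((second_dd f p (p + s) (p + t))\<^sup>2) * indicator {-r..r} s)"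
        by (auto simp: indicator_def)
    qed simp
    also have "\<dots> = ennreal (18 / r ^ 3) * (ennreal (9 * r ^ 4) * J t)"
      unfolding J_def by (subst nn_integral_cmult) measurable
    also have "\<dots> = ennreal (162 * r) * J t"
    proof -
      have "ennreal (18 / r ^ 3) * ennreal (9 * r ^ 4) = ennreal (162 * r)"
        using r by (subst ennreal_mult'[symmetric]) (auto simp: eval_nat_numeral)
      then show ?thesis by (simp add: mult.assoc[symmetric])
    qed
    finally show ?thesis using True by simp
  qed simp
  have "ennreal r * ?I = (\<integral>\<^sup>+t. ?I * indicator {r<..<2 * r} t \<partial>lborel)"
    using r by (subst nn_integral_cmult_indicator) (simp_all add: mult.commute)
  also have "\<dots> \<le> (\<integral>\<^sup>+t. ennreal (162 * r) * (J t * indicator {r<..<2 * r} t) \<partial>lborel)"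
    by (intro nn_integral_mono le)
  also have "\<dots> = ennreal (162 * r) * annulus_energy f p r"
    unfolding annulus_energy_def J_def[symmetric] by (rule nn_integral_cmult) measurable
  also have "\<dots> = ennreal r * (162 * annulus_energy f p r)"
    using r by (simp add: ennreal_mult' ac_simps)
  finally show ?thesis using r by (subst (asm) ennreal_mult_le_mult_iff) auto
qed

text \<open>The ranges of \<open>t\<close> at different scales are disjoint, so no part of the
  energy is counted twice. The offset \<open>n + 2\<close> makes 1/4 the largest scale; then
  \<open>\<bar>t\<bar> + \<bar>s\<bar> < 3/4\<close>, inside the domain of the energy.\<close>

lemma suminf_annulus_energy_le:
  assumes fm[measurable]: "f \<in> borel_measurable borel"
  shows "(\<Sum>n. annulus_energy f p (1 / 2 ^ (n + 2))) \<le> quotient_energy f p"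
proof -
  define r :: "nat \<Rightarrow> real" where "r n = 1 / 2 ^ (n + 2)" for n
  define h where "h t = (\<integral>\<^sup>+s. ennreal ((second_dd f p (p + t) (p + s))\<^sup>2) * indicator {s. \<bar>t\<bar> + \<bar>s\<bar> < 1} s \<partial>lborel)" for t
  have [measurable]: "h \<in> borel_measurable borel" unfolding h_def[abs_def] by measurable
  have r: "0 < r n" "r n \<le> 1/4" for n by (auto simp: r_def field_simps)
  have "annulus_energy f p (r n) \<le> (\<integral>\<^sup>+t. h t * indicator {r n<..<2 * r n} t \<partial>lborel)" for n
    unfolding annulus_energy_def
  proof (rule nn_integral_mono)
    fix t
    show "(\<integral>\<^sup>+s. ennreal ((second_dd f p (p + s) (p + t))\<^sup>2) * indicator {- r n..r n} s \<partial>lborel) * indicator {r n<..<2 * r n} t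
      \<le> h t * indicator {r n<..<2 * r n} t"
    proof (cases "t \<in> {r n<..<2 * r n}")
      case True
      have "(\<integral>\<^sup>+s. ennreal ((second_dd f p (p + s) (p + t))\<^sup>2) * indicator {- r n..r n} s \<partial>lborel) \<le> h t"
        unfolding h_def
      proof (rule nn_integral_mono)
        fix s
        have "\<bar>t\<bar> + \<bar>s\<bar> < 1" if "s \<in> {- r n..r n}" using that True r[of n] by auto
        then show "ennreal ((second_dd f p (p + s) (p + t))\<^sup>2) * indicator {- r n..r n} s
          \<le> ennreal ((second_dd f p (p + t) (p + s))\<^sup>2) * indicator {s. \<bar>t\<bar> + \<bar>s\<bar> < 1} s"
          by (auto simp: indicator_def second_dd_swap23[of f p "p + s"])
      qed
      then show ?thesis using True by simp
    qed simp
  qed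
  then have "(\<Sum>n. annulus_energy f p (r n)) \<le> (\<Sum>n. \<integral>\<^sup>+t. h t * indicator {r n<..<2 * r n} t \<partial>lborel)"
    by (intro suminf_le) auto
  also have "\<dots> = (\<integral>\<^sup>+t. (\<Sum>n. h t * indicator {r n<..<2 * r n} t) \<partial>lborel)"
    by (rule nn_integral_suminf[symmetric]) measurable
  also have "\<dots> \<le> (\<integral>\<^sup>+t. h t \<partial>lborel)"
  proof (rule nn_integral_mono)
    fix t
    have disj: "disjoint_family (\<lambda>n. {r n<..<2 * r n})"
      unfolding disjoint_family_on_def
    proof (intro ballI impI)
      have *: "{r m<..<2 * r m} \<inter> {r n<..<2 * r n} = {}" if "m < n" for m n
      proof -
        have "2 * r n \<le> r m"
          using that power_increasing[of "Suc m + 2" "n + 2" "2::real"] by (simp add: r_def field_simps)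
        then show ?thesis by auto
      qed
      fix m n :: nat assume "m \<noteq> n"
      then show "{r m<..<2 * r m} \<inter> {r n<..<2 * r n} = {}" using *[of m n] *[of n m] by (cases m n rule: linorder_cases) auto
    qed
    have "(\<Sum>n. h t * indicator {r n<..<2 * r n} t) = h t * (\<Sum>n. indicator {r n<..<2 * r n} t)"
      by (rule ennreal_suminf_cmult)
    also have "(\<Sum>n. indicator {r n<..<2 * r n} t) = (indicator (\<Union>n. {r n<..<2 * r n}) t :: ennreal)"
      by (rule suminf_indicator[OF disj])
    also have "h t * indicator (\<Union>n. {r n<..<2 * r n}) t \<le> h t * 1"
      by (intro mult_left_mono) (auto simp: indicator_def)
    finally show "(\<Sum>n. h t * indicator {r n<..<2 * r n} t) \<le> h t" by simp
  qed
  also have "\<dots> = quotient_energy f p"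
    unfolding quotient_energy_eq_shifted[OF fm] h_def ..
  finally show ?thesis unfolding r_def .
qed


lemma nn_integral_bend_sum:
  assumes fm[measurable]: "f \<in> borel_measurable borel"
  shows "(\<integral>\<^sup>+w. (\<Sum>n. ennreal ((dyadic_bend f (p - w) (n + 2) w)\<^sup>2)) * indicator {0..<1} w \<partial>lborel)
    \<le> 162 * quotient_energy f p"
proof -
  have [measurable]: "(\<lambda>w. dyadic_bend f (p - w) n w) \<in> borel_measurable borel" for n
    unfolding dyadic_bend_def by measurable
  have bend_le: "(\<integral>\<^sup>+w. ennreal ((dyadic_bend f (p - w) n w)\<^sup>2) * indicator {0..<1} w \<partial>lborel) \<le> 162 * annulus_energy f p (1 / 2 ^ n)" for n
  proof -
    define r :: real where "r = 1 / 2 ^ n"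
    have r: "r > 0" by (simp add: r_def)
    define \<phi> where "\<phi> u = ennreal (((f (p - r * u + r) - 2 * f (p - r * u + r / 2) + f (p - r * u)) / r)\<^sup>2)" for u
    have [measurable]: "\<phi> \<in> borel_measurable borel" unfolding \<phi>_def by measurable
    have "ennreal ((dyadic_bend f (p - w) n w)\<^sup>2) = \<phi> (frac (2 ^ n * w))" for w
    proof -
      \<comment> \<open>The cell of the shifted grid that contains \<open>p\<close> begins at
        distance \<open>r * frac (2 ^ n * w)\<close> to the left of \<open>p\<close>.\<close>
      have e: "p - r * frac (2 ^ n * w) = p - w + real_of_int \<lfloor>2 ^ n * w\<rfloor> / 2 ^ n"
        by (simp add: frac_def r_def field_simps)
      have e': "p - r * frac (2 ^ n * w) + r = p - w + (real_of_int \<lfloor>2 ^ n * w\<rfloor> + 1) / 2 ^ n"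
        "p - r * frac (2 ^ n * w) + r / 2 = p - w + (real_of_int \<lfloor>2 ^ n * w\<rfloor> + 1/2) / 2 ^ n"
        unfolding e by (simp_all add: r_def add_divide_distrib)
      show ?thesis unfolding \<phi>_def dyadic_bend_def unfolding e' unfolding e by (simp add: r_def mult.commute)
    qed
    then have "(\<integral>\<^sup>+w. ennreal ((dyadic_bend f (p - w) n w)\<^sup>2) * indicator {0..<1} w \<partial>lborel) = (\<integral>\<^sup>+u. \<phi> u * indicator {0..<1} u \<partial>lborel)"
      by (simp add: nn_integral_frac_dyadic)
    also have "\<dots> \<le> 162 * annulus_energy f p r"
      unfolding \<phi>_def by (rule nn_integral_bend_le_energy[OF fm r])
    finally show ?thesis by (simp add: r_def)
  qed
  have "(\<integral>\<^sup>+w. (\<Sum>n. ennreal ((dyadic_bend f (p - w) (n + 2) w)\<^sup>2)) * indicator {0..<1} w \<partial>lborel)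
     = (\<Sum>n. \<integral>\<^sup>+w. ennreal ((dyadic_bend f (p - w) (n + 2) w)\<^sup>2) * indicator {0..<1} w \<partial>lborel)"
    by (subst nn_integral_suminf[symmetric]) simp_all
  also have "\<dots> \<le> (\<Sum>n. 162 * annulus_energy f p (1 / 2 ^ (n + 2)))"
    by (intro suminf_le bend_le) auto
  also have "\<dots> = 162 * (\<Sum>n. annulus_energy f p (1 / 2 ^ (n + 2)))"
    by (rule ennreal_suminf_cmult)
  also have "\<dots> \<le> 162 * quotient_energy f p"
    by (intro mult_left_mono suminf_annulus_energy_le fm) simp
  finally show ?thesis .
qed

section \<open>Uniform approximation by lines at small scales\<close>

lemma annulus_energy_tendsto_0:
  assumes "f \<in> borel_measurable borel" "quotient_energy f p < \<infinity>" "e > 0"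
  shows "eventually (\<lambda>n. annulus_energy f p (1 / 2 ^ n) < ennreal e) sequentially"
proof -
  have fin: "(\<Sum>n. annulus_energy f p (1 / 2 ^ (n + 2))) < \<infinity>"
    using suminf_annulus_energy_le[OF assms(1)] assms(2) by (rule le_less_trans)
  define x where "x n = enn2real (annulus_energy f p (1 / 2 ^ (n + 2)))" for n
  have "annulus_energy f p (1 / 2 ^ (n + 2)) < \<infinity>" for n
    using fin ennreal_suminf_lessD[of "\<lambda>n. annulus_energy f p (1 / 2 ^ (n + 2))"] by auto
  then have x: "annulus_energy f p (1 / 2 ^ (n + 2)) = ennreal (x n)" for n
    by (simp add: x_def)
  have "(\<Sum>n. ennreal (x n)) < \<infinity>" using fin by (simp only: x)
  then have "summable x"
    by (intro summable_suminf_not_top) (auto simp: x_def)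
  then have "x \<longlonglongrightarrow> 0" by (rule summable_LIMSEQ_zero)
  then have "eventually (\<lambda>n. x n < e) sequentially" using assms(3) by (rule order_tendstoD)
  then have "eventually (\<lambda>n. annulus_energy f p (1 / 2 ^ (n + 2)) < ennreal e) sequentially"
    by eventually_elim (simp only: x, rule ennreal_lessI[OF assms(3)])
  then show ?thesis by (rule eventually_sequentially_seg[THEN iffD1])
qed

text \<open>Smallness of the energy only gives an \<open>L\<^sup>2\<close> bound for the residual; the Hoelder bound turns
  it into a uniform one.\<close>

lemma residual_uniformly_small:
  fixes f :: "real \<Rightarrow> real"
  assumes zyg: "\<And>x h. \<bar>f (x + h) + f (x - h) - 2 * f x\<bar> \<le> c * \<bar>h\<bar>"
    and cont: "continuous_on UNIV f" and r: "r > 0" and \<eta>: "\<eta> > 0"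
    and \<delta>: "0 < \<delta>" "\<delta> \<le> 1" "26 * c * (\<delta> / 2) powr (3/4) \<le> \<eta> / 2"
    and small: "annulus_energy f p r < ennreal (\<delta> * \<eta>\<^sup>2 / 36)"
  obtains q where "\<And>s. \<bar>s\<bar> \<le> r \<Longrightarrow> \<bar>residual f p q s\<bar> \<le> \<eta> * r"
proof -
  have c: "c \<ge> 0" using zyg[of 0 1] by simp
  have fm[measurable]: "f \<in> borel_measurable borel" by (rule borel_measurable_continuous_onI[OF cont])
  define J where "J t = (\<integral>\<^sup>+s. ennreal ((second_dd f p (p + s) (p + t))\<^sup>2) * indicator {-r..r} s \<partial>lborel)" for t
  \<comment> \<open>Chosen so that \<open>9 * r ^ 3 * \<epsilon>\<close> equals
    \<open>(\<eta> * r / 2)\<^sup>2 * (\<delta> * r)\<close>, the squared norm of a function of size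
    \<open>\<eta> * r / 2\<close> on an interval of length \<open>\<delta> * r\<close>.\<close>
  define \<epsilon> where "\<epsilon> = \<delta> * \<eta>\<^sup>2 / 36"
  have \<epsilon>: "\<epsilon> > 0" using \<delta> \<eta> by (simp add: \<epsilon>_def)
  have "\<exists>t\<in>{r<..<2 * r}. J t < ennreal (\<epsilon> / r)"
  proof (rule ccontr)
    assume "\<not> ?thesis"
    then have ge: "ennreal (\<epsilon> / r) \<le> J t" if "t \<in> {r<..<2 * r}" for t using that by (auto simp: not_less)
    have "ennreal \<epsilon> = ennreal (\<epsilon> / r) * ennreal r" using \<epsilon> r by (subst ennreal_mult'[symmetric]) auto
    also have "\<dots> = (\<integral>\<^sup>+t. ennreal (\<epsilon> / r) * indicator {r<..<2 * r} t \<partial>lborel)"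
      using r by (subst nn_integral_cmult_indicator) simp_all
    also have "\<dots> \<le> (\<integral>\<^sup>+t. J t * indicator {r<..<2 * r} t \<partial>lborel)"
      by (intro nn_integral_mono) (use ge in \<open>auto simp: indicator_def\<close>)
    also have "\<dots> = annulus_energy f p r" by (simp add: annulus_energy_def J_def)
    finally show False using small by (simp add: \<epsilon>_def)
  qed
  then obtain t where t: "r < t" "t < 2 * r" and Jt: "J t < ennreal (\<epsilon> / r)" by auto
  define q where "q = diff_quot f p t"
  let ?R = "residual f p q"
  have Rzyg: "\<bar>?R (x + h) + ?R (x - h) - 2 * ?R x\<bar> \<le> c * \<bar>h\<bar>" for x h
    using zyg[of "p + x" h] by (simp add: residual_def algebra_simps)
  have Rcont: "continuous_on S ?R" for S
    unfolding residual_def by (intro continuous_intros continuous_on_compose2[OF cont]) auto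
  have Rt: "?R t = 0" using t r by (simp add: residual_def q_def diff_quot_def)
  \<comment> \<open>The zeros of the residual at 0 and \<open>t\<close> turn the Zygmund condition
    into a bound proportional to \<open>r\<close>, independent of the size of
    \<open>f\<close>.\<close>
  have Rbnd: "\<bar>?R s\<bar> \<le> 3 * c * r" if "\<bar>s\<bar> \<le> r" for s
  proof -
    have "\<bar>?R s\<bar> \<le> 3/2 * c * t"
      by (rule zygmund_two_zeros_bound[of ?R, OF Rzyg Rcont _ Rt]) (use that t r in \<open>auto simp: residual_def\<close>)
    also have "\<dots> \<le> 3/2 * c * (2 * r)" using c t by (intro mult_left_mono) auto
    finally show ?thesis by simp
  qed
  \<comment> \<open>Hoelder on \<open>{-r..r}\<close> with the bound \<open>3 * c * r\<close>
    produces the 26 in the condition on \<delta>, as 6 * 3 + 4 * 2.\<close>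
  have hol: "\<bar>?R x - ?R y\<bar> \<le> \<eta> * r / 2" if xy: "\<bar>x\<bar> \<le> r" "\<bar>y\<bar> \<le> r" "\<bar>x - y\<bar> \<le> \<delta> * r" for x y
  proof -
    have "\<bar>?R x - ?R y\<bar> \<le> (6 * (3 * c * r) + 4 * c * (r - (- r))) * (\<bar>x - y\<bar> / (r - (- r))) powr (3/4)"
      by (rule zygmund_holder[of ?R c, OF Rzyg Rbnd c]) (use xy r in \<open>auto simp: abs_le_iff\<close>)
    also have "\<dots> = r * (26 * c * (\<bar>x - y\<bar> / (2 * r)) powr (3/4))" by (simp add: algebra_simps)
    also have "\<dots> \<le> r * (26 * c * (\<delta> / 2) powr (3/4))"
      using xy r c by (intro mult_left_mono powr_mono2) (auto simp: field_simps)
    also have "\<dots> \<le> r * (\<eta> / 2)" using r \<delta> by (intro mult_left_mono) auto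
    finally show ?thesis by (simp add: mult.commute)
  qed
  have L2: "(\<integral>\<^sup>+s. ennreal ((?R s)\<^sup>2) * indicator {-r..r} s \<partial>lborel) < ennreal (9 * r ^ 3 * \<epsilon>)"
  proof -
    have "(\<integral>\<^sup>+s. ennreal ((?R s)\<^sup>2) * indicator {-r..r} s \<partial>lborel)
      \<le> (\<integral>\<^sup>+s. ennreal (9 * r ^ 4) * (ennreal ((second_dd f p (p + s) (p + t))\<^sup>2) * indicator {-r..r} s) \<partial>lborel)"
    proof (intro nn_integral_mono)
      fix s
      have "ennreal ((?R s)\<^sup>2) \<le> ennreal (9 * r ^ 4) * ennreal ((second_dd f p (p + s) (p + t))\<^sup>2)" if "s \<in> {-r..r}"
        using residual_square_le[OF t that, of f p] r unfolding q_def by (subst ennreal_mult'[symmetric]) (auto intro!: ennreal_leI)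
      then show "ennreal ((?R s)\<^sup>2) * indicator {-r..r} s
        \<le> ennreal (9 * r ^ 4) * (ennreal ((second_dd f p (p + s) (p + t))\<^sup>2) * indicator {-r..r} s)"
        by (auto simp: indicator_def)
    qed
    also have "\<dots> = ennreal (9 * r ^ 4) * J t"
      unfolding J_def by (rule nn_integral_cmult) measurable
    also have "\<dots> < ennreal (9 * r ^ 4) * ennreal (\<epsilon> / r)"
      using Jt r by (intro ennreal_mult_strict_left_mono) auto
    also have "\<dots> = ennreal (9 * r ^ 3 * \<epsilon>)"
      using r \<epsilon> by (subst ennreal_mult'[symmetric]) (auto simp: eval_nat_numeral)
    finally show ?thesis .
  qed
  have "\<bar>?R s0\<bar> \<le> \<eta> * r" if s0: "\<bar>s0\<bar> \<le> r" for s0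
  proof (rule ccontr)
    assume big: "\<not> \<bar>?R s0\<bar> \<le> \<eta> * r"
    \<comment> \<open>The interval of length \<open>\<delta> * r\<close> has \<open>s0\<close> as an
      endpoint and extends in the direction of the other half of \<open>{-r..r}\<close>, so that it
      does not leave this range.\<close>
    define l where "l = (if s0 \<le> 0 then s0 else s0 - \<delta> * r)"
    have \<delta>r: "0 < \<delta> * r" "\<delta> * r \<le> r" using \<delta> r by (auto simp: mult_left_le_one_le)
    have sub: "{l..l + \<delta> * r} \<subseteq> {-r..r}" using s0 \<delta>r by (auto simp: l_def abs_le_iff split: if_splits)
    have R_ge: "(\<eta> * r / 2)\<^sup>2 \<le> (?R s)\<^sup>2" if s: "s \<in> {l..l + \<delta> * r}" for s
    proof -
      have "\<bar>s\<bar> \<le> r" using s sub by (auto simp: abs_le_iff)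
      moreover have "\<bar>s0 - s\<bar> \<le> \<delta> * r" using s by (auto simp: l_def abs_le_iff split: if_splits)
      ultimately have "\<bar>?R s0 - ?R s\<bar> \<le> \<eta> * r / 2" using hol[OF s0] by blast
      then have "\<eta> * r / 2 \<le> \<bar>?R s\<bar>" using big by argo
      then show ?thesis using \<eta> r by (intro abs_le_square_iff[THEN iffD1]) auto
    qed
    have "ennreal (9 * r ^ 3 * \<epsilon>) = ennreal ((\<eta> * r / 2)\<^sup>2) * ennreal (\<delta> * r)"
      using \<delta>r by (subst ennreal_mult'[symmetric]) (use \<eta> r in \<open>auto simp: \<epsilon>_def power2_eq_square power3_eq_cube mult_ac intro!: mult_nonneg_nonneg\<close>)
    also have "\<dots> = (\<integral>\<^sup>+s. ennreal ((\<eta> * r / 2)\<^sup>2) * indicator {l..l + \<delta> * r} s \<partial>lborel)"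
      using \<delta>r by (subst nn_integral_cmult_indicator) simp_all
    also have "\<dots> \<le> (\<integral>\<^sup>+s. ennreal ((?R s)\<^sup>2) * indicator {-r..r} s \<partial>lborel)"
      by (intro nn_integral_mono) (use R_ge sub in \<open>auto simp: indicator_def intro!: ennreal_leI\<close>)
    finally show False using L2 by simp
  qed
  then show ?thesis by (rule that)
qed


section \<open>From dyadic slopes to the derivative\<close>

lemma exists_dyadic_scale:
  fixes s :: real
  assumes "0 < \<bar>s\<bar>" "\<bar>s\<bar> \<le> 1 / 2 ^ N"
  obtains n where "n \<ge> N" "1 / 2 ^ n / 2 < \<bar>s\<bar>" "\<bar>s\<bar> \<le> 1 / 2 ^ n"
proof -
  have ex: "\<exists>m. (1/2 :: real) ^ m < \<bar>s\<bar>" using assms(1) by (intro real_arch_pow_inv) auto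
  define m where "m = (LEAST m. (1/2 :: real) ^ m < \<bar>s\<bar>)"
  have m: "(1/2) ^ m < \<bar>s\<bar>" unfolding m_def by (rule LeastI_ex[OF ex])
  have min: "\<bar>s\<bar> \<le> (1/2) ^ k" if "k < m" for k
    using not_less_Least[of k "\<lambda>m. (1/2 :: real) ^ m < \<bar>s\<bar>"] that unfolding m_def by simp
  have "(1/2 :: real) ^ m < (1/2) ^ N" using m assms(2) by (simp add: power_divide)
  then have "N < m" by (subst (asm) power_strict_decreasing_iff) auto
  then obtain n where n: "m = Suc n" "n \<ge> N" by (cases m) auto
  show ?thesis
    by (rule that[of n]) (use n m min[of n] in \<open>simp_all add: power_divide field_simps\<close>)
qed

text \<open>At each small scale the dyadic slope and the difference quotients at comparable
  distances are all close to one auxiliary slope \<open>q\<close>, which may vary with the scale and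
  only mediates. The dyadic interval contains \<open>p\<close> and has length \<open>r\<close>, so
  both its endpoints are within reach of the residual bound.\<close>

lemma differentiable_of_dyadic_slopes:
  fixes f :: "real \<Rightarrow> real"
  assumes zyg: "\<And>x h. \<bar>f (x + h) + f (x - h) - 2 * f x\<bar> \<le> c * \<bar>h\<bar>"
    and cont: "continuous_on UNIV f" and fin: "quotient_energy f p < \<infinity>"
    and conv: "convergent (\<lambda>n. dyadic_slope f (p - w) n w)"
  shows "f differentiable (at p)"
proof -
  have c: "c \<ge> 0" using zyg[of 0 1] by simp
  have fm: "f \<in> borel_measurable borel" by (rule borel_measurable_continuous_onI[OF cont])
  define S where "S n = dyadic_slope f (p - w) n w" for n
  obtain l where l: "S \<longlonglongrightarrow> l" using conv by (auto simp: convergent_def S_def[abs_def])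
  have "((\<lambda>s. (f (p + s) - f p) / s) \<longlongrightarrow> l) (at 0)"
  proof (rule tendstoI)
    fix e :: real assume e: "e > 0"
    \<comment> \<open>Two comparisons with \<open>q\<close> cost \<open>2 * \<eta>\<close> each, and
      the distance of \<open>S n\<close> from its limit costs one more \<eta>.\<close>
    define \<eta> where "\<eta> = e / 5"
    have \<eta>: "\<eta> > 0" using e by (simp add: \<eta>_def)
    have "((\<lambda>\<delta>::real. 26 * c * (\<delta> / 2) powr (3/4)) \<longlongrightarrow> 26 * c * (0 / 2) powr (3/4)) (at_right 0)"
      by (intro tendsto_intros) (auto intro: eventually_mono[OF eventually_at_right_less])
    then have "eventually (\<lambda>\<delta>. 26 * c * (\<delta> / 2) powr (3/4) < \<eta> / 2) (at_right 0)"
      by (rule order_tendstoD) (use \<eta> in simp)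
    moreover have "eventually (\<lambda>\<delta>. \<delta> \<in> {0<..<1}) (at_right (0::real))"
      by (rule eventually_at_right_real) simp
    ultimately have "eventually (\<lambda>\<delta>. 26 * c * (\<delta> / 2) powr (3/4) < \<eta> / 2 \<and> \<delta> \<in> {0<..<1}) (at_right (0::real))"
      by (rule eventually_conj)
    then obtain \<delta> where "26 * c * (\<delta> / 2) powr (3/4) < \<eta> / 2 \<and> \<delta> \<in> {0<..<1}"
      using eventually_happens'[OF trivial_limit_at_right_real] by blast
    then have \<delta>: "0 < \<delta>" "\<delta> \<le> 1" "26 * c * (\<delta> / 2) powr (3/4) \<le> \<eta> / 2"
      by (auto intro: less_imp_le)
    have "eventually (\<lambda>n. annulus_energy f p (1 / 2 ^ n) < ennreal (\<delta> * \<eta>\<^sup>2 / 36)) sequentially"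
      using \<delta> \<eta> by (intro annulus_energy_tendsto_0[OF fm fin]) auto
    moreover have "eventually (\<lambda>n. \<bar>S n - l\<bar> < \<eta>) sequentially"
      using tendstoD[OF l \<eta>] by (simp add: dist_real_def)
    ultimately have "eventually (\<lambda>n. annulus_energy f p (1 / 2 ^ n) < ennreal (\<delta> * \<eta>\<^sup>2 / 36) \<and> \<bar>S n - l\<bar> < \<eta>) sequentially"
      by (rule eventually_conj)
    then obtain N where N: "\<And>n. n \<ge> N \<Longrightarrow> annulus_energy f p (1 / 2 ^ n) < ennreal (\<delta> * \<eta>\<^sup>2 / 36)"
      "\<And>n. n \<ge> N \<Longrightarrow> \<bar>S n - l\<bar> < \<eta>"
      unfolding eventually_sequentially by blast
    have main: "\<bar>(f (p + s) - f p) / s - l\<bar> < e" if s: "s \<noteq> 0" "\<bar>s\<bar> < 1 / 2 ^ N" for s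
    proof -
      obtain n where n: "n \<ge> N" "1 / 2 ^ n / 2 < \<bar>s\<bar>" "\<bar>s\<bar> \<le> 1 / 2 ^ n"
        using exists_dyadic_scale[of s N] s by auto
      define r :: real where "r = 1 / 2 ^ n"
      have r: "r > 0" by (simp add: r_def)
      obtain q where q: "\<And>s. \<bar>s\<bar> \<le> r \<Longrightarrow> \<bar>residual f p q s\<bar> \<le> \<eta> * r"
        using residual_uniformly_small[OF zyg cont r \<eta> \<delta>] N(1)[OF n(1)] unfolding r_def by blast
      have "(f (p + s) - f p) / s - q = residual f p q s / s"
        using s by (simp add: residual_def field_simps)
      also have "\<bar>\<dots>\<bar> \<le> \<eta> * r / (r / 2)"
        unfolding abs_divide using q[of s] n r \<eta> by (intro frac_le) (auto simp: r_def)
      also have "\<dots> = 2 * \<eta>" using r by simp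
      finally have 1: "\<bar>(f (p + s) - f p) / s - q\<bar> \<le> 2 * \<eta>" .
      define a where "a = real_of_int \<lfloor>2 ^ n * w\<rfloor> / 2 ^ n - w"
      have w: "real_of_int \<lfloor>2 ^ n * w\<rfloor> \<le> 2 ^ n * w" "2 ^ n * w < real_of_int \<lfloor>2 ^ n * w\<rfloor> + 1" by linarith+
      have a: "- r \<le> a" "a \<le> 0"
        using w by (simp_all add: a_def r_def field_simps)
      have Sn: "S n - q = (residual f p q (a + r) - residual f p q a) / r"
      proof -
        have "p - w + (real_of_int \<lfloor>2 ^ n * w\<rfloor> + 1) / 2 ^ n = p + (a + r)" "p - w + real_of_int \<lfloor>2 ^ n * w\<rfloor> / 2 ^ n = p + a"
          by (simp_all add: a_def r_def add_divide_distrib)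
        then have "S n = 2 ^ n * (f (p + (a + r)) - f (p + a))"
          by (simp only: S_def dyadic_slope_def)
        also have "\<dots> = (f (p + (a + r)) - f (p + a)) / r" by (simp add: r_def)
        finally have "S n = (f (p + (a + r)) - f (p + a)) / r" .
        then show ?thesis using r by (simp add: residual_def field_simps)
      qed
      also have "\<bar>\<dots>\<bar> \<le> (\<eta> * r + \<eta> * r) / r"
        unfolding abs_divide using q[of a] q[of "a + r"] a r
        by (intro frac_le order_trans[OF abs_triangle_ineq4 add_mono]) (use \<eta> in auto)
      also have "\<dots> = 2 * \<eta>" using r by simp
      finally have 2: "\<bar>S n - q\<bar> \<le> 2 * \<eta>" .
      have "\<bar>(f (p + s) - f p) / s - l\<bar> < 5 * \<eta>"
        using 1 2 N(2)[OF n(1)] by argo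
      then show ?thesis by (simp add: \<eta>_def)
    qed
    show "\<forall>\<^sub>F s in at 0. dist ((f (p + s) - f p) / s) l < e"
      unfolding eventually_at dist_real_def by (intro exI[of _ "1 / 2 ^ N"]) (use main in auto)
  qed
  then have "(f has_real_derivative l) (at p)"
    by (simp add: DERIV_def)
  then show ?thesis by (auto simp: real_differentiable_def)
qed

text \<open>The exceptional set is null on almost every line, in fact on every line, of constant
  \<theta>, but is needed on lines of constant \<open>p = \<theta> + w\<close>. The shear
  \<open>(\<theta>, w) \<mapsto> (\<theta> + w, w)\<close> preserves measure, so Tonelli transfers
  nullity to almost every such line.\<close>

proposition energy_finite_AE_differentiable:
  fixes f :: "real \<Rightarrow> real"
  assumes zyg: "\<And>x h. \<bar>f (x + h) + f (x - h) - 2 * f x\<bar> \<le> c * \<bar>h\<bar>" and cont: "continuous_on UNIV f"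
  shows "AE p in lborel. quotient_energy f p < \<infinity> \<longrightarrow> f differentiable (at p)"
proof -
  have fm[measurable]: "f \<in> borel_measurable borel" by (rule borel_measurable_continuous_onI[OF cont])
  define Z where "Z \<theta> w = (\<Sum>n. ennreal ((dyadic_bend f \<theta> (n + 2) w)\<^sup>2))" for \<theta> w
  \<comment> \<open>The Cauchy property replaces convergence because it is a countable condition,
    which gives measurability jointly in \<theta> and \<open>w\<close>.\<close>
  define G where "G \<theta> w \<longleftrightarrow> (w \<in> {0..<1} \<longrightarrow> Z \<theta> w < \<infinity> \<longrightarrow> Cauchy (\<lambda>n. dyadic_slope f \<theta> n w))" for \<theta> w
  have [measurable]: "(\<lambda>x. dyadic_bend f (\<theta> x) n (w x)) \<in> borel_measurable M"
    "(\<lambda>x. dyadic_slope f (\<theta> x) n (w x)) \<in> borel_measurable M"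
    if [measurable]: "\<theta> \<in> borel_measurable M" "w \<in> borel_measurable M" for \<theta> w n and M :: "(real \<times> real) measure"
    unfolding dyadic_bend_def dyadic_slope_def by measurable
  have G_pred: "Measurable.pred (borel \<Otimes>\<^sub>M borel) (\<lambda>x. G (\<theta> x) (w x))"
    if [measurable]: "\<theta> \<in> borel_measurable (borel \<Otimes>\<^sub>M borel)" "w \<in> borel_measurable (borel \<Otimes>\<^sub>M borel)" for \<theta> w :: "real \<times> real \<Rightarrow> real"
  proof -
    have [measurable]: "Measurable.pred (borel \<Otimes>\<^sub>M borel) (\<lambda>x. Cauchy (\<lambda>n. dyadic_slope f (\<theta> x) n (w x)))"
      unfolding pred_def by (rule sets_Collect_Cauchy) measurable
    show ?thesis unfolding G_def Z_def by measurable
  qed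
  define B where "B \<theta> w = (if G \<theta> w then 0 else 1 :: ennreal)" for \<theta> w
  have Bm: "(\<lambda>x. B (\<theta> x) (w x)) \<in> borel_measurable (borel \<Otimes>\<^sub>M borel)"
    if "\<theta> \<in> borel_measurable (borel \<Otimes>\<^sub>M borel)" "w \<in> borel_measurable (borel \<Otimes>\<^sub>M borel)" for \<theta> w :: "real \<times> real \<Rightarrow> real"
  proof -
    note [measurable] = G_pred[OF that]
    show ?thesis unfolding B_def by measurable
  qed
  have G_AE: "AE w in lborel. G \<theta> w" for \<theta>
    using dyadic_slope_convergent[of f \<theta>]
  proof eventually_elim
    case (elim w)
    show ?case unfolding G_def
    proof (intro impI)
      assume w: "w \<in> {0..<1}" and "Z \<theta> w < \<infinity>"
      then have "summable (\<lambda>n. (dyadic_bend f \<theta> (n + 2) w)\<^sup>2)"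
        unfolding Z_def by (intro summable_suminf_not_top) auto
      then have "summable (\<lambda>n. (dyadic_bend f \<theta> n w)\<^sup>2)" by (rule summable_iff_shift[THEN iffD1])
      then show "Cauchy (\<lambda>n. dyadic_slope f \<theta> n w)"
        using elim w by (auto intro: convergent_Cauchy)
    qed
  qed
  have "(\<integral>\<^sup>+w. B \<theta> w \<partial>lborel) = (\<integral>\<^sup>+w. 0 \<partial>(lborel :: real measure))" for \<theta>
    by (rule nn_integral_cong_AE) (use G_AE[of \<theta>] in \<open>eventually_elim, simp add: B_def\<close>)
  then have "0 = (\<integral>\<^sup>+\<theta>. \<integral>\<^sup>+w. B \<theta> w \<partial>lborel \<partial>lborel)" by simp
  also have "\<dots> = (\<integral>\<^sup>+w. \<integral>\<^sup>+\<theta>. B \<theta> w \<partial>lborel \<partial>lborel)"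
    by (rule lborel_pair.Fubini'[symmetric]) (use Bm[of snd fst] Bm[of fst snd] in \<open>simp add: case_prod_beta'\<close>)
  also have "\<dots> = (\<integral>\<^sup>+w. \<integral>\<^sup>+p. B (- w + p) w \<partial>lborel \<partial>lborel)"
  proof (rule nn_integral_cong)
    fix w :: real
    have "(\<lambda>\<theta>. B \<theta> w) \<in> borel_measurable borel"
    proof -
      have "(\<lambda>\<theta>. (\<theta>, w)) \<in> borel \<rightarrow>\<^sub>M borel \<Otimes>\<^sub>M (borel :: real measure)" by measurable
      from measurable_compose[OF this Bm[OF measurable_fst measurable_snd]] show ?thesis by simp
    qed
    then show "(\<integral>\<^sup>+\<theta>. B \<theta> w \<partial>lborel) = (\<integral>\<^sup>+p. B (- w + p) w \<partial>lborel)"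
      by (rule nn_integral_lborel_shift[symmetric])
  qed
  also have "\<dots> = (\<integral>\<^sup>+p. \<integral>\<^sup>+w. B (- w + p) w \<partial>lborel \<partial>lborel)"
    by (rule lborel_pair.Fubini')
      (use Bm[of "\<lambda>x. - fst x + snd x" fst] Bm[of "\<lambda>x. - snd x + fst x" snd] in \<open>simp add: case_prod_beta'\<close>)
  finally have zero: "(\<integral>\<^sup>+p. (\<integral>\<^sup>+w. B (- w + p) w \<partial>lborel) \<partial>lborel) = 0" ..
  have Bpm: "(\<lambda>w. B (- w + p) w) \<in> borel_measurable borel" for p
  proof -
    have "(\<lambda>w. (- w + p, w)) \<in> borel \<rightarrow>\<^sub>M borel \<Otimes>\<^sub>M (borel :: real measure)" by measurable
    from measurable_compose[OF this Bm[OF measurable_fst measurable_snd]] show ?thesis by simp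
  qed
  have "(\<lambda>p. \<integral>\<^sup>+w. B (- w + p) w \<partial>lborel) \<in> borel_measurable lborel"
    by (rule lborel.borel_measurable_nn_integral) (use Bm[of "\<lambda>x. - snd x + fst x" snd] in \<open>simp add: case_prod_beta'\<close>)
  then have "AE p in lborel. (\<integral>\<^sup>+w. B (- w + p) w \<partial>lborel) = 0"
    using zero by (simp add: nn_integral_0_iff_AE)
  then show ?thesis
  proof eventually_elim
    case (elim p)
    have B0: "AE w in lborel. B (- w + p) w = 0"
      using elim Bpm[of p] by (simp add: nn_integral_0_iff_AE)
    show ?case
    proof
      assume fin: "quotient_energy f p < \<infinity>"
      have Zm: "(\<lambda>w. Z (p - w) w * indicator {0..<1} w) \<in> borel_measurable lborel"
        unfolding Z_def dyadic_bend_def by measurable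
      have "(\<integral>\<^sup>+w. Z (p - w) w * indicator {0..<1} w \<partial>lborel) \<le> 162 * quotient_energy f p"
        unfolding Z_def by (rule nn_integral_bend_sum[OF fm])
      also have "\<dots> < \<infinity>" using fin by (simp add: ennreal_mult_less_top)
      finally have "AE w in lborel. Z (p - w) w * indicator {0..<1} w \<noteq> \<infinity>"
        by (intro nn_integral_PInf_AE[OF Zm]) simp
      with B0 have AE: "AE w in lborel. w \<in> {0..<1} \<longrightarrow> Cauchy (\<lambda>n. dyadic_slope f (p - w) n w)"
      proof eventually_elim
        case (elim w)
        then show ?case by (auto simp: B_def G_def less_top split: if_splits)
      qed
      \<comment> \<open>A single good shift suffices: \<open>differentiable_of_dyadic_slopes\<close>
        recovers all difference quotients from one grid.\<close>
      have "\<exists>w. Cauchy (\<lambda>n. dyadic_slope f (p - w) n w)"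
      proof (rule ccontr)
        assume "\<not> ?thesis"
        then have "AE w in lborel. w \<notin> {0..<1::real}" using AE by simp
        then have "emeasure lborel {0..<1::real} = 0"
          by (subst (asm) AE_iff_measurable[of "{0..<1}"]) auto
        then show False by simp
      qed
      then obtain w where "Cauchy (\<lambda>n. dyadic_slope f (p - w) n w)" by blast
      then show "f differentiable (at p)"
        by (intro differentiable_of_dyadic_slopes[OF zyg cont fin, of w] Cauchy_convergent)
    qed
  qed
qed

theorem theorem1p4:
  fixes f :: "real \<Rightarrow> real"
  assumes "f \<in> zygmund_class"
  shows "sym_diff {x. quotient_energy f x < \<infinity>} {x. f differentiable (at x)} \<in> null_sets lebesgue"
proof -
  obtain B where B: "\<And>x. \<bar>f x\<bar> \<le> B"
    using assms by (auto simp: zygmund_class_def bounded_iff)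
  obtain c where zyg: "\<And>x h. \<bar>f (x + h) + f (x - h) - 2 * f x\<bar> \<le> c * \<bar>h\<bar>"
    using assms by (auto simp: zygmund_class_def)
  have cont: "continuous_on UNIV f"
    using assms by (intro zygmund_continuous[OF zyg]) (simp add: zygmund_class_def)
  have "AE x in lborel. (quotient_energy f x < \<infinity>) = (f differentiable (at x))"
    using energy_finite_AE_differentiable[OF zyg cont] differentiable_AE_energy_finite[OF zyg B]
    by eventually_elim blast
  \<comment> \<open>The exceptional points are enclosed in a Borel null set; completeness of
    Lebesgue measure does the rest, so measurability of the two sets need not be discussed.\<close>
  then obtain N where N: "{x \<in> space lborel. \<not> (quotient_energy f x < \<infinity>) = (f differentiable (at x))} \<subseteq> N"
    "emeasure lborel N = 0" "N \<in> sets lborel"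
    by (rule AE_E)
  then have "N \<in> null_sets lebesgue" by (intro null_sets_completionI null_setsI)
  then show ?thesis
    by (rule null_sets_completion_subset[rotated]) (use N(1) in auto)
qed

end
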